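(* Suppose that $(\eta_0,u_0)\in H^1\times (H^2\cap H^1_0)$. Then there exists a time $T>0$ such that the system of integral equations $$\eta(x,t)=\eta_0(x)+\int_0^t \left[ L_N\!\left(\tfrac{a+b}{b}u+\eta u\right)+\tfrac{a}{b}u_x \right] d\tau,\qquad u(x,t)=u_0(x)+\int_0^t L_D\!\left(\eta+\tfrac{1}{2}u^2\right)d\tau$$ has a unique solution $(\eta,u)\in H^1_T\times H^2_T$.
   Context: Fix $L>0$ and real parameters $a<0$, $b>0$, $d>0$ with $a+b+d=\tfrac13$. $L^2=L^2(-L,L)$ and $H^s=H^s(-L,L)$ are the real Lebesgue/Sobolev spaces with norms $\|v\|$ and $\|v\|_s=\left(\sum_{j=0}^s\|\partial_x^jv\|^2\right)^{1/2}$; $H^1_0=\{v\in H^1: v(L)=v(-L)=0\}$. Set $H^1_T:=C(0,T;H^1)$ and $H^2_T:=C(0,T;H^2\cap H^1_0)$ (continuous functions of $t\in[0,T]$ with values in the indicated space), with norms $\|u\|_{H^s_T}=\sup_{0\le t\le T}\|u(\cdot,t)\|_s$. The operator $L_N$ is defined by $(L_Nf)(x)=\int_{-L}^{L}F_\xi(x,\xi)f(\xi)\,d\xi$, where $F_\xi=\partial F/\partial\xi$, $$F(x,\xi)=-\frac{1}{bW}\begin{cases}\omega_1(\xi)\omega_2(x), & -L\le\xi\le x,\\ \omega_1(x)\omega_2(\xi), & x<\xi\le L,\end{cases}$$ $\omega_1(x)=\cosh\left(\frac{L+x}{\sqrt b}\right)$, $\omega_2(x)=\cosh\left(\frac{L-x}{\sqrt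 b}\right)$, $W=-\frac{1}{\sqrt b}\sinh\left(\frac{2L}{\sqrt b}\right)$ ($F$ is the Green's function of $w-bw_{xx}=-f_x$, $w_x(\pm L)=0$). The operator $L_D$ is defined by $(L_Df)(x)=\int_{-L}^{L}G_\xi(x,\xi)f(\xi)\,d\xi$, where $G$ is given by the same formula with $b$ replaced by $d$, $\omega_1(x)=\sinh\left(\frac{L+x}{\sqrt d}\right)$, $\omega_2(x)=\sinh\left(\frac{L-x}{\sqrt d}\right)$, $W=-\frac{1}{\sqrt d}\sinh\left(\frac{2L}{\sqrt d}\right)$ ($G$ is the Green's function of $w-dw_{xx}=-f_x$, $w(\pm L)=0$). Both operators act in the variable $x$ at each fixed time. *)

theory Defs
  imports "HOL-Analysis.Analysis"
begin

text \<open>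
  Elements of $L^2(-L,L)$ and $H^s(-L,L)$ are represented by functions
  \<open>real \<Rightarrow> real\<close>, of which only the values on $[-L,L]$ matter and which are identified
  when they agree almost everywhere there (\<open>ae_eq\<close>). A function $v(x,t)$ is represented as
  \<open>v t x\<close>, time first.
\<close>

definition ae_eq :: "real \<Rightarrow> (real \<Rightarrow> real) \<Rightarrow> (real \<Rightarrow> real) \<Rightarrow> bool" where
  "ae_eq L f g \<longleftrightarrow> (AE x in lebesgue_on {-L..L}. f x = g x)"

definition L2_space :: "real \<Rightarrow> (real \<Rightarrow> real) set" where
  "L2_space L = {f. f \<in> borel_measurable (lebesgue_on {-L..L}) \<and>
                    integrable (lebesgue_on {-L..L}) (\<lambda>x. (f x)\<^sup>2)}"

definition L2_norm :: "real \<Rightarrow> (real \<Rightarrow> real) \<Rightarrow> real" where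
  "L2_norm L f = sqrt (LINT x|lebesgue_on {-L..L}. (f x)\<^sup>2)"

definition test_functions :: "real \<Rightarrow> (real \<Rightarrow> real) set" where
  "test_functions L = {\<phi>. \<phi> C1_differentiable_on UNIV \<and>
      compact (closure {x. \<phi> x \<noteq> 0}) \<and> closure {x. \<phi> x \<noteq> 0} \<subseteq> {-L<..<L}}"

text \<open>
  Weak derivatives in $L^2(-L,L)$, tested against $C^1_c(-L,L)$ as in Brezis,
  Functional Analysis, Sobolev Spaces and Partial Differential Equations, Section 8.2.
\<close>

definition has_weak_deriv :: "real \<Rightarrow> (real \<Rightarrow> real) \<Rightarrow> (real \<Rightarrow> real) \<Rightarrow> bool" where
  "has_weak_deriv L v g \<longleftrightarrow> v \<in> L2_space L \<and> g \<in> L2_space L \<and>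
     (\<forall>\<phi>\<in>test_functions L.
        (LINT x|lebesgue_on {-L..L}. v x * deriv \<phi> x) =
        - (LINT x|lebesgue_on {-L..L}. g x * \<phi> x))"

text \<open>The choice is unique up to \<open>ae_eq\<close> whenever a weak derivative exists.\<close>

definition weak_deriv :: "real \<Rightarrow> (real \<Rightarrow> real) \<Rightarrow> real \<Rightarrow> real" where
  "weak_deriv L v = (SOME g. has_weak_deriv L v g)"

fun sobolev :: "real \<Rightarrow> nat \<Rightarrow> (real \<Rightarrow> real) set" where
  "sobolev L 0 = L2_space L"
| "sobolev L (Suc s) = {v \<in> L2_space L. \<exists>g \<in> sobolev L s. has_weak_deriv L v g}"

definition sobolev_norm :: "real \<Rightarrow> nat \<Rightarrow> (real \<Rightarrow> real) \<Rightarrow> real" where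
  "sobolev_norm L s v = sqrt (\<Sum>j=0..s. (L2_norm L ((weak_deriv L ^^ j) v))\<^sup>2)"

text \<open>
  Point values of an element of $H^1(-L,L)$ are those of its continuous representative on
  $[-L,L]$, which is unique there; values of \<open>cont_rep\<close> outside $[-L,L]$ are irrelevant.
\<close>

definition cont_rep :: "real \<Rightarrow> (real \<Rightarrow> real) \<Rightarrow> real \<Rightarrow> real" where
  "cont_rep L v = (SOME g. continuous_on {-L..L} g \<and> ae_eq L g v)"

definition H10 :: "real \<Rightarrow> (real \<Rightarrow> real) set" where
  "H10 L = {v \<in> sobolev L 1. cont_rep L v L = 0 \<and> cont_rep L v (-L) = 0}"

definition continuous_in_time ::
    "real \<Rightarrow> real \<Rightarrow> nat \<Rightarrow> (real \<Rightarrow> real \<Rightarrow> real) \<Rightarrow> bool" where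
  "continuous_in_time L T s v \<longleftrightarrow>
     (\<forall>t\<in>{0..T}. ((\<lambda>r. sobolev_norm L s (\<lambda>x. v r x - v t x)) \<longlongrightarrow> 0) (at t within {0..T}))"

definition H1T :: "real \<Rightarrow> real \<Rightarrow> (real \<Rightarrow> real \<Rightarrow> real) set" where
  "H1T L T = {v. (\<forall>t\<in>{0..T}. v t \<in> sobolev L 1) \<and> continuous_in_time L T 1 v}"

definition H2T :: "real \<Rightarrow> real \<Rightarrow> (real \<Rightarrow> real \<Rightarrow> real) set" where
  "H2T L T = {v. (\<forall>t\<in>{0..T}. v t \<in> sobolev L 2 \<inter> H10 L) \<and> continuous_in_time L T 2 v}"

definition green_N :: "real \<Rightarrow> real \<Rightarrow> real \<Rightarrow> real \<Rightarrow> real" where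
  "green_N L b x \<xi> =
     (let \<omega>1 = (\<lambda>y. cosh ((L + y) / sqrt b));
          \<omega>2 = (\<lambda>y. cosh ((L - y) / sqrt b));
          W = - (1 / sqrt b) * sinh (2 * L / sqrt b)
      in - (1 / (b * W)) * (if \<xi> \<le> x then \<omega>1 \<xi> * \<omega>2 x else \<omega>1 x * \<omega>2 \<xi>))"

definition green_D :: "real \<Rightarrow> real \<Rightarrow> real \<Rightarrow> real \<Rightarrow> real" where
  "green_D L d x \<xi> =
     (let \<omega>1 = (\<lambda>y. sinh ((L + y) / sqrt d));
          \<omega>2 = (\<lambda>y. sinh ((L - y) / sqrt d));
          W = - (1 / sqrt d) * sinh (2 * L / sqrt d)
      in - (1 / (d * W)) * (if \<xi> \<le> x then \<omega>1 \<xi> * \<omega>2 x else \<omega>1 x * \<omega>2 \<xi>))"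

text \<open>
  The kernels have a kink at $\xi = x$, where \<open>deriv\<close> has an unspecified value; this is a
  null set for the integrals.
\<close>

definition op_N :: "real \<Rightarrow> real \<Rightarrow> (real \<Rightarrow> real) \<Rightarrow> real \<Rightarrow> real" where
  "op_N L b f x = (LINT \<xi>|lebesgue_on {-L..L}. deriv (green_N L b x) \<xi> * f \<xi>)"

definition op_D :: "real \<Rightarrow> real \<Rightarrow> (real \<Rightarrow> real) \<Rightarrow> real \<Rightarrow> real" where
  "op_D L d f x = (LINT \<xi>|lebesgue_on {-L..L}. deriv (green_D L d x) \<xi> * f \<xi>)"

definition eta_integrand ::
    "real \<Rightarrow> real \<Rightarrow> real \<Rightarrow> (real \<Rightarrow> real \<Rightarrow> real) \<Rightarrow> (real \<Rightarrow> real \<Rightarrow> real)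
      \<Rightarrow> real \<Rightarrow> real \<Rightarrow> real" where
  "eta_integrand L a b \<eta> u \<tau> x =
     op_N L b (\<lambda>\<xi>. (a + b) / b * u \<tau> \<xi> + \<eta> \<tau> \<xi> * u \<tau> \<xi>) x
     + a / b * cont_rep L (weak_deriv L (u \<tau>)) x"

definition u_integrand ::
    "real \<Rightarrow> real \<Rightarrow> (real \<Rightarrow> real \<Rightarrow> real) \<Rightarrow> (real \<Rightarrow> real \<Rightarrow> real)
      \<Rightarrow> real \<Rightarrow> real \<Rightarrow> real" where
  "u_integrand L d \<eta> u \<tau> x = op_D L d (\<lambda>\<xi>. \<eta> \<tau> \<xi> + 1 / 2 * (u \<tau> \<xi>)\<^sup>2) x"

text \<open>
  All terms are read through their continuous representatives in $x$, so the equations are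
  required at every $x \in [-L,L]$. Integrability is stated explicitly because the Bochner
  integral of a non-integrable function is $0$ by convention.
\<close>

definition solves_integral_system ::
    "real \<Rightarrow> real \<Rightarrow> real \<Rightarrow> real \<Rightarrow> (real \<Rightarrow> real) \<Rightarrow> (real \<Rightarrow> real) \<Rightarrow> real
      \<Rightarrow> (real \<Rightarrow> real \<Rightarrow> real) \<Rightarrow> (real \<Rightarrow> real \<Rightarrow> real) \<Rightarrow> bool" where
  "solves_integral_system L a b d \<eta>0 u0 T \<eta> u \<longleftrightarrow>
     (\<forall>t\<in>{0..T}. \<forall>x\<in>{-L..L}.
        integrable (lebesgue_on {0..t}) (\<lambda>\<tau>. eta_integrand L a b \<eta> u \<tau> x) \<and>
        integrable (lebesgue_on {0..t}) (\<lambda>\<tau>. u_integrand L d \<eta> u \<tau> x) \<and>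
        cont_rep L (\<eta> t) x =
          cont_rep L \<eta>0 x + (LINT \<tau>|lebesgue_on {0..t}. eta_integrand L a b \<eta> u \<tau> x) \<and>
        cont_rep L (u t) x =
          cont_rep L u0 x + (LINT \<tau>|lebesgue_on {0..t}. u_integrand L d \<eta> u \<tau> x))"

end

theory Submission
  imports Defs
begin

text \<open>
  Write $p = u_x$, so that $u(x) = \int_{-L}^x p$. Both $L_N$ and $\partial_x L_D$ map continuous
  functions to continuous functions, so the system is an ordinary differential equation with a
  locally Lipschitz right-hand side for $(\eta, p)$ in $C[-L,L]^2$; Gronwall's inequality gives
  uniqueness there, and by the Sobolev embedding every solution in $H^1_T \times H^2_T$ is one in
  $C[-L,L]^2$.

  For existence in the smaller space, note that $L_N$ and $\partial_x L_D - 1/d$ gain a derivative,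
  while what remains is multiplication of $(\eta, p)$ by a constant matrix. Hence $\eta_x$ and
  $p_x$ stay in the span of $\eta_0'$ and $u_0''$ up to continuous functions. Solving for the
  coefficients, the boundary values and the continuous parts is again an ordinary differential
  equation with locally Lipschitz right-hand side in a Banach space, and completeness of
  $L^2$ is never needed.
\<close>

section \<open>Ordinary differential equations in Banach spaces\<close>

text \<open>The term \<open>a / b * u_x\<close> costs a derivative of \<open>u\<close>, and
  \<open>L_D\<close> gains exactly one; taking \<open>u_x\<close> as unknown absorbs the loss, which
  is why the second equation is differentiated. The price is the jump of the kernel of
  \<open>L_D\<close> on the diagonal: it leaves \<open>\<eta> / d\<close> in the equation for
  \<open>u_x\<close>, so the system does not smooth, and regularity has to be carried over from the
  data. The only functions involved that are merely square integrable are the two fixed ones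
  \<eta>0' and u0''. The lifted unknown therefore stores, for each of \<eta> and \<open>u_x\<close>,
  two real coefficients in front of them, a boundary value and a continuous remainder. This is a
  Banach space for elementary reasons, and continuity in time with values in H^1 is that of a curve
  in it, pushed forward by a bounded linear map. The map need not be injective: the lift serves
  existence only, and uniqueness is decided after projecting back. An element of C[-L,L] is encoded
  as the bounded continuous function on the line that extends it by constants on either
  side.\<close>

lemma gronwall_zero:
  fixes f :: "real \<Rightarrow> real"
  assumes cont: "continuous_on {0..T} f" and nonneg: "\<And>t. t \<in> {0..T} \<Longrightarrow> 0 \<le> f t"
    and le: "\<And>t. t \<in> {0..T} \<Longrightarrow> f t \<le> K * integral {0..t} f" and "0 \<le> K"
    and t: "t \<in> {0..T}"
  shows "f t = 0"
proof -
  define \<phi> where "\<phi> t = integral {0..t} f" for t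
  have der: "(\<phi> has_real_derivative f s) (at s within {0..T})" if "s \<in> {0..T}" for s
    unfolding \<phi>_def using integral_has_real_derivative[OF cont that] .
  \<comment> \<open>Integrating factor: the derivative is
    \<open>exp (- K * s) * (f s - K * \<phi> s)\<close>, which is not positive by hypothesis. Since
    \<open>\<phi> 0 = 0\<close>, the integral is at most 0, and then so is
    \<open>f t\<close>.\<close>
  have "exp (- K * t) * \<phi> t \<le> exp (- K * 0) * \<phi> 0"
  proof (rule DERIV_nonpos_imp_decreasing_open[where f = "\<lambda>t. exp (- K * t) * \<phi> t"])
    show "0 \<le> t" using t by simp
    show "continuous_on {0..t} (\<lambda>t. exp (- K * t) * \<phi> t)"
      using t by (intro continuous_intros continuous_on_subset[OF DERIV_continuous_on[OF der]]) auto
    fix s assume s: "0 < s" "s < t"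
    then have "at s within {0..T} = at s"
      using t by (intro at_within_interior) auto
    then have "(\<phi> has_real_derivative f s) (at s)" using der[of s] s t by simp
    then have "((\<lambda>t. exp (- K * t) * \<phi> t) has_real_derivative
        exp (- K * s) * (f s - K * \<phi> s)) (at s)"
      by (auto intro!: derivative_eq_intros simp: algebra_simps)
    moreover have "exp (- K * s) * (f s - K * \<phi> s) \<le> 0"
      using le[of s] s t by (simp add: \<phi>_def mult_le_0_iff)
    ultimately show "\<exists>y. ((\<lambda>t. exp (- K * t) * \<phi> t) has_real_derivative y) (at s) \<and> y \<le> 0"
      by blast
  qed
  then have "\<phi> t \<le> 0" by (simp add: \<phi>_def mult_le_0_iff)
  then have "K * \<phi> t \<le> 0" using \<open>0 \<le> K\<close> by (simp add: mult_nonneg_nonpos)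
  then show ?thesis using le[OF t] nonneg[OF t] by (simp add: \<phi>_def)
qed

text \<open>One constant per ball is required, not per neighbourhood: balls are not compact in
  infinite dimension, so local constants would not give uniform ones. This form also yields
  boundedness on balls, which makes it stable under composition and bilinear products.\<close>

definition lipschitz_on_balls :: "('a::real_normed_vector \<Rightarrow> 'b::real_normed_vector) \<Rightarrow> bool" where
  "lipschitz_on_balls F \<longleftrightarrow>
     (\<forall>R. \<exists>K\<ge>0. \<forall>x y. norm x \<le> R \<longrightarrow> norm y \<le> R \<longrightarrow> norm (F x - F y) \<le> K * norm (x - y))"

lemma lipschitz_on_ballsE:
  assumes "lipschitz_on_balls F"
  obtains K where "0 \<le> K"
    "\<And>x y. norm x \<le> R \<Longrightarrow> norm y \<le> R \<Longrightarrow> norm (F x - F y) \<le> K * norm (x - y)"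
  using assms unfolding lipschitz_on_balls_def by blast

lemma lipschitz_on_balls_boundE:
  assumes "lipschitz_on_balls F"
  obtains B where "0 \<le> B" "\<And>x. norm x \<le> R \<Longrightarrow> norm (F x) \<le> B"
proof -
  \<comment> \<open>The radius \<open>max 0 R\<close> guarantees that 0 lies in the ball, so that
    \<open>F 0\<close> can serve as reference value even for negative \<open>R\<close>.\<close>
  obtain K where K: "0 \<le> K"
    "\<And>x y. norm x \<le> max 0 R \<Longrightarrow> norm y \<le> max 0 R \<Longrightarrow> norm (F x - F y) \<le> K * norm (x - y)"
    using lipschitz_on_ballsE[OF assms] by blast
  have "norm (F x) \<le> K * max 0 R + norm (F 0)" if "norm x \<le> R" for x
  proof -
    have "norm (F x) \<le> norm (F x - F 0) + norm (F 0)"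
      using norm_triangle_ineq[of "F x - F 0" "F 0"] by simp
    moreover have "norm (F x - F 0) \<le> K * norm x"
      using K(2)[of x 0] that by simp
    moreover have "K * norm x \<le> K * max 0 R"
      using K(1) that by (intro mult_left_mono) auto
    ultimately show ?thesis by linarith
  qed
  moreover have "0 \<le> K * max 0 R + norm (F 0)" using K(1) by simp
  ultimately show ?thesis using that by blast
qed

lemma lipschitz_on_balls_linear:
  assumes "bounded_linear F" shows "lipschitz_on_balls F"
proof -
  interpret bounded_linear F by fact
  obtain K where K: "\<And>x. norm (F x) \<le> norm x * K" "0 \<le> K" using nonneg_bounded by blast
  show ?thesis unfolding lipschitz_on_balls_def
  proof (intro allI exI[of _ K] conjI impI)
    fix x y show "norm (F x - F y) \<le> K * norm (x - y)"
      using K(1)[of "x - y"] by (simp add: diff mult.commute)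
  qed (rule K(2))
qed

lemma lipschitz_on_balls_compose:
  fixes F :: "'a::real_normed_vector \<Rightarrow> 'b::real_normed_vector" and G :: "'c::real_normed_vector \<Rightarrow> 'a"
  assumes F: "lipschitz_on_balls F" and G: "lipschitz_on_balls G"
  shows "lipschitz_on_balls (\<lambda>x. F (G x))"
  unfolding lipschitz_on_balls_def
proof
  fix R
  obtain B where B: "0 \<le> B" "\<And>x. norm x \<le> R \<Longrightarrow> norm (G x) \<le> B"
    using lipschitz_on_balls_boundE[OF G] by blast
  obtain K where K: "0 \<le> K"
    "\<And>x y. norm x \<le> R \<Longrightarrow> norm y \<le> R \<Longrightarrow> norm (G x - G y) \<le> K * norm (x - y)"
    using lipschitz_on_ballsE[OF G] by blast
  \<comment> \<open>\<open>G\<close> maps the ball of radius \<open>R\<close> into the ball of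
    radius \<open>B\<close>; the constant of \<open>F\<close> is taken on the latter.\<close>
  obtain M where M: "0 \<le> M"
    "\<And>x y. norm x \<le> B \<Longrightarrow> norm y \<le> B \<Longrightarrow> norm (F x - F y) \<le> M * norm (x - y)"
    using lipschitz_on_ballsE[OF F] by blast
  show "\<exists>K\<ge>0. \<forall>x y. norm x \<le> R \<longrightarrow> norm y \<le> R \<longrightarrow> norm (F (G x) - F (G y)) \<le> K * norm (x - y)"
  proof (intro exI[of _ "M * K"] conjI allI impI)
    fix x y :: 'c assume xy: "norm x \<le> R" "norm y \<le> R"
    have "norm (F (G x) - F (G y)) \<le> M * norm (G x - G y)"
      using M(2) B(2) xy by blast
    also have "\<dots> \<le> M * (K * norm (x - y))"
      using K(2)[OF xy] M(1) by (rule mult_left_mono)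
    finally show "norm (F (G x) - F (G y)) \<le> M * K * norm (x - y)" by (simp add: mult.assoc)
  qed (use K M in simp)
qed

lemma lipschitz_on_balls_linear_compose:
  assumes "bounded_linear F" "lipschitz_on_balls G"
  shows "lipschitz_on_balls (\<lambda>x. F (G x))"
  using lipschitz_on_balls_compose[OF lipschitz_on_balls_linear] assms by blast

lemma lipschitz_on_balls_Pair:
  assumes F: "lipschitz_on_balls F" and G: "lipschitz_on_balls G"
  shows "lipschitz_on_balls (\<lambda>x. (F x, G x))"
  unfolding lipschitz_on_balls_def
proof
  fix R
  obtain K where K: "0 \<le> K"
    "\<And>x y. norm x \<le> R \<Longrightarrow> norm y \<le> R \<Longrightarrow> norm (F x - F y) \<le> K * norm (x - y)"
    using lipschitz_on_ballsE[OF F] by blast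
  obtain M where M: "0 \<le> M"
    "\<And>x y. norm x \<le> R \<Longrightarrow> norm y \<le> R \<Longrightarrow> norm (G x - G y) \<le> M * norm (x - y)"
    using lipschitz_on_ballsE[OF G] by blast
  show "\<exists>K\<ge>0. \<forall>x y. norm x \<le> R \<longrightarrow> norm y \<le> R \<longrightarrow>
      norm ((F x, G x) - (F y, G y)) \<le> K * norm (x - y)"
  proof (intro exI[of _ "K + M"] conjI allI impI)
    fix x y :: 'a assume xy: "norm x \<le> R" "norm y \<le> R"
    have "norm ((F x, G x) - (F y, G y)) \<le> norm (F x - F y) + norm (G x - G y)"
      using norm_Pair_le[of "F x - F y" "G x - G y"] by simp
    also have "\<dots> \<le> (K + M) * norm (x - y)"
      using K(2)[OF xy] M(2)[OF xy] by (simp add: distrib_right)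
    finally show "norm ((F x, G x) - (F y, G y)) \<le> (K + M) * norm (x - y)" .
  qed (use K M in simp)
qed

lemma lipschitz_on_balls_add:
  assumes F: "lipschitz_on_balls F" and G: "lipschitz_on_balls G"
  shows "lipschitz_on_balls (\<lambda>x. F x + G x)"
  using lipschitz_on_balls_linear_compose[OF
      bounded_linear_add[OF bounded_linear_fst bounded_linear_snd] lipschitz_on_balls_Pair[OF F G]]
  by simp

lemma lipschitz_on_balls_bilinear:
  fixes F :: "'x::real_normed_vector \<Rightarrow> 'a::real_normed_vector" and G :: "'x \<Rightarrow> 'b::real_normed_vector"
    and pr :: "'a \<Rightarrow> 'b \<Rightarrow> 'c::real_normed_vector"
  assumes "bounded_bilinear pr" and F: "lipschitz_on_balls F" and G: "lipschitz_on_balls G"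
  shows "lipschitz_on_balls (\<lambda>x. pr (F x) (G x))"
  unfolding lipschitz_on_balls_def
proof
  fix R
  interpret bounded_bilinear pr by fact
  obtain C where C: "0 \<le> C" "\<And>a b. norm (pr a b) \<le> norm a * norm b * C"
    using nonneg_bounded by blast
  obtain K where K: "0 \<le> K"
    "\<And>x y. norm x \<le> R \<Longrightarrow> norm y \<le> R \<Longrightarrow> norm (F x - F y) \<le> K * norm (x - y)"
    using lipschitz_on_ballsE[OF F] by blast
  obtain M where M: "0 \<le> M"
    "\<And>x y. norm x \<le> R \<Longrightarrow> norm y \<le> R \<Longrightarrow> norm (G x - G y) \<le> M * norm (x - y)"
    using lipschitz_on_ballsE[OF G] by blast
  obtain A where A: "0 \<le> A" "\<And>x. norm x \<le> R \<Longrightarrow> norm (F x) \<le> A"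
    using lipschitz_on_balls_boundE[OF F] by blast
  obtain B where B: "0 \<le> B" "\<And>x. norm x \<le> R \<Longrightarrow> norm (G x) \<le> B"
    using lipschitz_on_balls_boundE[OF G] by blast
  show "\<exists>K\<ge>0. \<forall>x y. norm x \<le> R \<longrightarrow> norm y \<le> R \<longrightarrow>
      norm (pr (F x) (G x) - pr (F y) (G y)) \<le> K * norm (x - y)"
  proof (intro exI[of _ "(A * M + K * B) * C"] conjI allI impI)
    fix x y :: 'x assume xy: "norm x \<le> R" "norm y \<le> R"
    have "pr (F x) (G x) - pr (F y) (G y) = pr (F x) (G x - G y) + pr (F x - F y) (G y)"
      by (simp add: diff_right diff_left)
    then have "norm (pr (F x) (G x) - pr (F y) (G y)) \<le>
        norm (F x) * norm (G x - G y) * C + norm (F x - F y) * norm (G y) * C"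
      by (metis C(2) add_mono norm_triangle_le)
    also have "\<dots> \<le> A * (M * norm (x - y)) * C + (K * norm (x - y)) * B * C"
      using A B K M C xy by (intro add_mono mult_mono mult_nonneg_nonneg) auto
    finally show "norm (pr (F x) (G x) - pr (F y) (G y)) \<le> (A * M + K * B) * C * norm (x - y)"
      by (simp add: algebra_simps)
  qed (use A B K M C in simp)
qed

lemma lipschitz_on_balls_continuous_on:
  fixes F :: "'a::real_normed_vector \<Rightarrow> 'b::real_normed_vector"
  assumes F: "lipschitz_on_balls F" shows "continuous_on UNIV F"
  unfolding continuous_on_eq_continuous_at[OF open_UNIV]
proof
  fix x :: 'a
  obtain K where K: "0 \<le> K"
    "\<And>y z. norm y \<le> norm x + 1 \<Longrightarrow> norm z \<le> norm x + 1 \<Longrightarrow> norm (F y - F z) \<le> K * norm (y - z)"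
    using lipschitz_on_ballsE[OF F] by blast
  have near: "\<forall>\<^sub>F y in at x. norm y \<le> norm x + 1"
  proof -
    have "\<forall>\<^sub>F y in at x. dist y x < 1"
      by (metis eventually_at zero_less_one)
    then show ?thesis
      by eventually_elim (metis dist_norm add.commute add_mono_thms_linordered_semiring(3)
          diff_add_cancel less_eq_real_def norm_triangle_le order_refl)
  qed
  have "((\<lambda>y. F y - F x) \<longlongrightarrow> 0) (at x)"
  proof (rule Lim_null_comparison)
    show "\<forall>\<^sub>F y in at x. norm (F y - F x) \<le> K * norm (y - x)"
      using near by eventually_elim (simp add: K(2))
    show "((\<lambda>y. K * norm (y - x)) \<longlongrightarrow> 0) (at x)"
      by (rule tendsto_eq_intros | simp)+
  qed
  then show "isCont F x" unfolding isCont_def by (simp add: LIM_zero_iff)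
qed

lemma lipschitz_on_balls_continuous_comp:
  assumes "lipschitz_on_balls F" "continuous_on S z"
  shows "continuous_on S (\<lambda>s. F (z s))"
  using continuous_on_compose2[OF lipschitz_on_balls_continuous_on[OF assms(1)] assms(2)] by simp

text \<open>Contraction principle on curves defined on the whole line. Clipping time to [0,T] turns
  curves on [0,T] into bounded continuous functions on the line, so the complete space of these can
  be used; the curves that stay in the ball of radius \<open>norm z0 + 1\<close> form a closed
  subset.\<close>

theorem picard_existence:
  fixes F :: "'a::banach \<Rightarrow> 'a"
  assumes F: "lipschitz_on_balls F"
  obtains T and z :: "real \<Rightarrow> 'a" where "0 < T" "continuous_on {0..T} z"
    "\<And>t. t \<in> {0..T} \<Longrightarrow> z t = z0 + integral {0..t} (\<lambda>s. F (z s))"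
proof -
  define R where "R = norm z0 + 1"
  obtain K where K: "0 \<le> K"
    "\<And>x y. norm x \<le> R \<Longrightarrow> norm y \<le> R \<Longrightarrow> norm (F x - F y) \<le> K * norm (x - y)"
    using lipschitz_on_ballsE[OF F] by blast
  obtain B where B: "0 \<le> B" "\<And>x. norm x \<le> R \<Longrightarrow> norm (F x) \<le> B"
    using lipschitz_on_balls_boundE[OF F] by blast
  \<comment> \<open>The first bound keeps the iterates within distance 1 of \<open>z0\<close>, the
    second makes the iteration contract by 1/2. Adding 1 to \<open>B\<close> and \<open>K\<close>
    keeps the quotients finite if these vanish.\<close>
  define T where "T = min (1 / (B + 1)) (1 / (2 * (K + 1)))"
  have T: "0 < T" "B * T \<le> 1" "K * T \<le> 1 / 2"
  proof -
    show "0 < T" using B K by (simp add: T_def)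
    have "B * T \<le> B * (1 / (B + 1))" using B by (intro mult_left_mono) (auto simp: T_def)
    also have "\<dots> \<le> 1" using B by (simp add: field_simps)
    finally show "B * T \<le> 1" .
    have "K * T \<le> K * (1 / (2 * (K + 1)))" using K by (intro mult_left_mono) (auto simp: T_def)
    also have "\<dots> \<le> 1 / 2" using K by (simp add: field_simps)
    finally show "K * T \<le> 1 / 2" .
  qed
  define clip where "clip t = max 0 (min T t)" for t
  have clip: "clip t \<in> {0..T}" for t using T by (auto simp: clip_def)
  have clip_id: "clip t = t" if "t \<in> {0..T}" for t using that by (auto simp: clip_def)
  have cont_clip: "continuous_on UNIV clip" unfolding clip_def by (intro continuous_intros)
  \<comment> \<open>The upper limit is clipped and not the integrand, so only values of
    \<open>z\<close> on [0,T] enter, and there the fixed point solves the original equation.\<close>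
  define \<Phi> where "\<Phi> z = (\<lambda>t. z0 + integral {0..clip t} (\<lambda>s. F (apply_bcontfun z s)))"
    for z :: "real \<Rightarrow>\<^sub>C 'a"
  define S where "S = {z :: real \<Rightarrow>\<^sub>C 'a. \<forall>t. norm (z t) \<le> R}"
  have contF: "continuous_on A (\<lambda>s. F (apply_bcontfun z s))" for z :: "real \<Rightarrow>\<^sub>C 'a" and A
    by (rule lipschitz_on_balls_continuous_comp[OF F]) simp
  have integrF: "(\<lambda>s. F (apply_bcontfun z s)) integrable_on {0..t}" for z :: "real \<Rightarrow>\<^sub>C 'a" and t
    by (rule integrable_continuous_real[OF contF])
  have cont\<Phi>: "continuous_on UNIV (\<Phi> z)" for z
  proof -
    have "continuous_on {0..T} (\<lambda>t. integral {0..t} (\<lambda>s. F (apply_bcontfun z s)))"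
      by (rule indefinite_integral_continuous_1[OF integrF])
    then have "continuous_on UNIV (\<lambda>t. integral {0..clip t} (\<lambda>s. F (apply_bcontfun z s)))"
      by (rule continuous_on_compose2[OF _ cont_clip]) (use clip in auto)
    then show ?thesis unfolding \<Phi>_def by (intro continuous_intros)
  qed
  have bd\<Phi>: "norm (\<Phi> z t) \<le> R" if "z \<in> S" for z t
  proof -
    have "norm (integral {0..clip t} (\<lambda>s. F (apply_bcontfun z s))) \<le> B * (clip t - 0)"
      using clip[of t] that B by (intro integral_bound contF) (auto simp: S_def)
    also have "\<dots> \<le> B * T" using clip[of t] B by (intro mult_left_mono) auto
    finally show ?thesis
      unfolding \<Phi>_def R_def using T norm_triangle_ineq[of z0] by (smt (verit))
  qed
  have app: "apply_bcontfun (Bcontfun (\<Phi> z)) = \<Phi> z" if "z \<in> S" for z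
    by (rule Bcontfun_inverse, rule bcontfun_normI[OF cont\<Phi> bd\<Phi>[OF that]])
  have "\<exists>!z\<in>S. Bcontfun (\<Phi> z) = z"
  proof (rule Banach_fix[of _ "1/2"])
    have "S = PiC UNIV (\<lambda>_. cball 0 R)"
      by (auto simp: S_def mem_PiC_iff Pi_iff)
    then have "closed S" by (simp add: closed_PiC)
    then show "complete S" by (simp add: complete_eq_closed)
    have "const_bcontfun z0 \<in> S" by (simp add: S_def R_def)
    then show "S \<noteq> {}" by blast
    show "(\<lambda>z. Bcontfun (\<Phi> z)) ` S \<subseteq> S"
      using bd\<Phi> app by (auto simp: S_def)
    show "dist (Bcontfun (\<Phi> x)) (Bcontfun (\<Phi> y)) \<le> 1 / 2 * dist x y" if xy: "x \<in> S" "y \<in> S" for x y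
    proof (rule dist_bound)
      fix t
      have "norm (\<Phi> x t - \<Phi> y t) =
          norm (integral {0..clip t} (\<lambda>s. F (apply_bcontfun x s) - F (apply_bcontfun y s)))"
        unfolding \<Phi>_def by (simp add: integral_diff[OF integrF integrF])
      also have "\<dots> \<le> K * dist x y * (clip t - 0)"
      proof (intro integral_bound continuous_on_diff contF)
        fix s
        have "norm (F (apply_bcontfun x s) - F (apply_bcontfun y s)) \<le> K * norm (x s - y s)"
          using xy K(2) by (auto simp: S_def)
        also have "\<dots> \<le> K * dist x y"
          using dist_bounded[of x s y] K(1) by (intro mult_left_mono) (auto simp: dist_norm)
        finally show "norm (F (apply_bcontfun x s) - F (apply_bcontfun y s)) \<le> K * dist x y" .
      qed (use clip[of t] in auto)
      also have "\<dots> \<le> K * dist x y * T"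
        using clip[of t] K(1) by (intro mult_left_mono) auto
      also have "\<dots> = K * T * dist x y" by simp
      also have "\<dots> \<le> 1 / 2 * dist x y" using T by (intro mult_right_mono) auto
      finally show "dist (apply_bcontfun (Bcontfun (\<Phi> x)) t) (apply_bcontfun (Bcontfun (\<Phi> y)) t) \<le> 1 / 2 * dist x y"
        by (simp add: app xy dist_norm)
    qed
  qed auto
  then obtain z where z: "z \<in> S" "Bcontfun (\<Phi> z) = z" by blast
  show thesis
  proof (rule that[of T "apply_bcontfun z"])
    fix t assume "t \<in> {0..T}"
    then show "apply_bcontfun z t = z0 + integral {0..t} (\<lambda>s. F (apply_bcontfun z s))"
      using app[OF z(1)] z(2) clip_id[of t] unfolding \<Phi>_def by metis
  qed (use T in auto)
qed

text \<open>Two continuous curves on a compact interval lie in a common ball, so a single Lipschitz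
  constant feeds Gronwall's inequality. No smallness of \<open>T\<close> is involved.\<close>

theorem picard_uniqueness:
  fixes F :: "'a::banach \<Rightarrow> 'a" and y z :: "real \<Rightarrow> 'a"
  assumes F: "lipschitz_on_balls F"
    and cont: "continuous_on {0..T} y" "continuous_on {0..T} z"
    and y: "\<And>t. t \<in> {0..T} \<Longrightarrow> y t = z0 + integral {0..t} (\<lambda>s. F (y s))"
    and z: "\<And>t. t \<in> {0..T} \<Longrightarrow> z t = z0 + integral {0..t} (\<lambda>s. F (z s))"
    and t: "t \<in> {0..T}"
  shows "y t = z t"
proof -
  have "compact (y ` {0..T} \<union> z ` {0..T})"
    using cont by (intro compact_Un compact_continuous_image) auto
  then obtain R where R: "\<And>x. x \<in> y ` {0..T} \<union> z ` {0..T} \<Longrightarrow> norm x \<le> R"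
    by (meson bounded_iff compact_imp_bounded)
  obtain K where K: "0 \<le> K"
    "\<And>x y. norm x \<le> R \<Longrightarrow> norm y \<le> R \<Longrightarrow> norm (F x - F y) \<le> K * norm (x - y)"
    using lipschitz_on_ballsE[OF F] by blast
  have contF: "continuous_on {0..t} (\<lambda>s. F (y s))" "continuous_on {0..t} (\<lambda>s. F (z s))"
    if "t \<in> {0..T}" for t
    using that cont by (auto intro!: lipschitz_on_balls_continuous_comp[OF F] elim!: continuous_on_subset)
  have contn: "continuous_on {0..T} (\<lambda>s. norm (y s - z s))"
    by (intro continuous_intros cont)
  have "norm (y t - z t) = 0"
  proof (rule gronwall_zero[OF contn _ _ K(1) t])
    fix r assume r: "r \<in> {0..T}"
    have "norm (y r - z r) = norm (integral {0..r} (\<lambda>s. F (y s) - F (z s)))"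
      using contF[OF r] by (simp add: y[OF r] z[OF r] integral_diff integrable_continuous_real)
    also have "\<dots> \<le> integral {0..r} (\<lambda>s. K * norm (y s - z s))"
    proof (rule integral_norm_bound_integral)
      show "(\<lambda>s. K * norm (y s - z s)) integrable_on {0..r}"
        using r by (intro integrable_continuous_real continuous_on_mult_left
            continuous_on_subset[OF contn]) auto
      show "(\<lambda>s. F (y s) - F (z s)) integrable_on {0..r}"
        by (intro integrable_continuous_real continuous_on_diff contF[OF r])
      show "norm (F (y s) - F (z s)) \<le> K * norm (y s - z s)" if "s \<in> {0..r}" for s
        using that r by (intro K(2) R) auto
    qed
    finally show "norm (y r - z r) \<le> K * integral {0..r} (\<lambda>s. norm (y s - z s))" by simp
  qed simp
  then show ?thesis by simp
qed

section \<open>Integral operators on continuous functions\<close>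

definition bc_mult :: "('a::topological_space \<Rightarrow>\<^sub>C real) \<Rightarrow> ('a \<Rightarrow>\<^sub>C real) \<Rightarrow> ('a \<Rightarrow>\<^sub>C real)" where
  "bc_mult f g = Bcontfun (\<lambda>x. f x * g x)"

lemma norm_bc_mult_apply: "norm (apply_bcontfun f x * apply_bcontfun g x) \<le> norm f * norm g"
  for f g :: "'a::topological_space \<Rightarrow>\<^sub>C real"
  unfolding norm_mult by (intro mult_mono norm_bounded) auto

lemma apply_bc_mult [simp]: "apply_bcontfun (bc_mult f g) x = f x * g x"
proof -
  have "(\<lambda>x. f x * g x) \<in> bcontfun"
    by (intro bcontfun_normI[OF _ norm_bc_mult_apply] continuous_intros) auto
  then show ?thesis by (simp add: bc_mult_def Bcontfun_inverse)
qed

lemma bounded_bilinear_bc_mult: "bounded_bilinear bc_mult"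
proof
  show "\<exists>K. \<forall>a b. norm (bc_mult a b) \<le> norm a * norm b * K"
    by (rule exI[of _ 1]) (use norm_bc_mult_apply in \<open>auto intro!: norm_bound\<close>)
qed (auto intro!: bcontfun_eqI simp: algebra_simps)

lemma bounded_linear_apply_bcontfun: "bounded_linear (\<lambda>f. apply_bcontfun f x)"
  by (rule bounded_linear_intro[of _ 1]) (auto simp: norm_bounded)

lemma bounded_linear_const_bcontfun: "bounded_linear const_bcontfun"
  by (rule bounded_linear_intro[of _ 1]) (auto intro!: bcontfun_eqI norm_bound)

instance bcontfun :: (metric_space, banach) banach ..

text \<open>Point evaluation is bounded and linear, hence passes under the integral of a curve of
  functions.\<close>

lemma integral_apply_bcontfun:
  fixes f :: "real \<Rightarrow> 'b::metric_space \<Rightarrow>\<^sub>C 'a::banach"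
  assumes "continuous_on {a..b} f"
  shows "apply_bcontfun (integral {a..b} f) x = integral {a..b} (\<lambda>s. apply_bcontfun (f s) x)"
  using integral_linear[OF _ bounded_linear_apply_bcontfun[of x], of f "{a..b}"]
  using integrable_continuous_real[OF assms] by (simp add: comp_def)

lemma DERIV_transform_within:
  assumes "(f has_field_derivative D) (at x within S)" "x \<in> S" "\<And>y. y \<in> S \<Longrightarrow> g y = f y"
  shows "(g has_field_derivative D) (at x within S)"
  using has_derivative_transform[OF assms(2,3)] assms(1) by (simp add: has_field_derivative_def)

section \<open>Continuous functions on the interval, their primitives and kernel operators\<close>

locale interval =
  fixes L :: real
  assumes L_pos: "0 < L"
begin

definition clip :: "real \<Rightarrow> real" where
  "clip x = max (- L) (min L x)"

definition ext :: "(real \<Rightarrow> real) \<Rightarrow> real \<Rightarrow>\<^sub>C real" where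
  "ext f = Bcontfun (\<lambda>x. f (clip x))"

text \<open>Clamped functions are constant to the left of \<open>-L\<close> and to the right of
  \<open>L\<close>. They are determined by their restriction to [-L,L], and their norm is the
  supremum over that interval, so they form a copy of C[-L,L].\<close>

definition clamped :: "(real \<Rightarrow>\<^sub>C real) \<Rightarrow> bool" where
  "clamped f \<longleftrightarrow> (\<forall>x. f (clip x) = f x)"

definition J :: "(real \<Rightarrow>\<^sub>C real) \<Rightarrow> real \<Rightarrow>\<^sub>C real" where
  "J f = ext (\<lambda>x. integral {-L..x} f)"

text \<open>The integral from \<open>x\<close> to \<open>L\<close>, as
  \<open>apply_Jr_integral\<close> confirms. Writing it through \<open>J\<close> lets linearity,
  boundedness and clampedness be inherited.\<close>

definition Jr :: "(real \<Rightarrow>\<^sub>C real) \<Rightarrow> real \<Rightarrow>\<^sub>C real" where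
  "Jr f = const_bcontfun (J f L) - J f"

lemma clip_in [simp]: "clip x \<in> {-L..L}" "- L \<le> clip x" "clip x \<le> L"
  using L_pos by (auto simp: clip_def)

lemma clip_id [simp]: "x \<in> {-L..L} \<Longrightarrow> clip x = x"
  by (auto simp: clip_def)

lemma clip_ends [simp]: "clip L = L" "clip (-L) = -L" "clip (clip x) = clip x"
  using L_pos by (auto simp: clip_def)

lemma continuous_on_clip: "continuous_on S clip"
  unfolding clip_def by (intro continuous_intros)

lemma apply_ext:
  assumes "continuous_on {-L..L} f"
  shows "apply_bcontfun (ext f) x = f (clip x)"
proof -
  have "continuous_on UNIV (\<lambda>x. f (clip x))"
    by (rule continuous_on_compose2[OF assms continuous_on_clip]) auto
  moreover have "bounded (range (\<lambda>x. f (clip x)))"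
  proof (rule bounded_subset)
    show "bounded (f ` {-L..L})"
      using assms by (intro compact_imp_bounded compact_continuous_image) auto
    show "range (\<lambda>x. f (clip x)) \<subseteq> f ` {-L..L}" by (auto intro!: imageI)
  qed
  ultimately have "(\<lambda>x. f (clip x)) \<in> bcontfun" by (simp add: bcontfun_def)
  then show ?thesis by (simp add: ext_def Bcontfun_inverse)
qed

lemma clamped_ext: "continuous_on {-L..L} f \<Longrightarrow> clamped (ext f)"
  by (simp add: clamped_def apply_ext)

lemma clamped_eqI:
  assumes "clamped f" "clamped g" "\<And>x. x \<in> {-L..L} \<Longrightarrow> f x = g x"
  shows "f = g"
proof (rule bcontfun_eqI)
  fix x show "f x = g x"
    using assms(1,2) assms(3)[of "clip x"] by (simp add: clamped_def)
qed

lemma integrable_apply_bcontfun [simp]: "apply_bcontfun f integrable_on {a..b}"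
  for f :: "real \<Rightarrow>\<^sub>C real"
  by (intro integrable_continuous_real) simp

lemma apply_J: "J f x = integral {-L..clip x} f"
  unfolding J_def
  by (rule apply_ext, rule indefinite_integral_continuous_1) simp

lemma J_left [simp]: "J f (-L) = 0"
  by (simp add: apply_J)

lemma clamped_J [simp]: "clamped (J f)"
  by (simp add: clamped_def apply_J)

lemma apply_Jr: "Jr f x = J f L - J f x"
  by (simp add: Jr_def)

lemma apply_Jr_integral: "x \<in> {-L..L} \<Longrightarrow> Jr f x = integral {x..L} f"
  using Henstock_Kurzweil_Integration.integral_combine[where a = "-L" and c = x and b = L and f = "apply_bcontfun f"]
  by (simp add: apply_Jr apply_J)

lemma clamped_Jr [simp]: "clamped (Jr f)"
  using clamped_J[of f] by (simp add: clamped_def Jr_def)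

lemma clamped_intros:
  "clamped (const_bcontfun c)"
  "clamped f \<Longrightarrow> clamped g \<Longrightarrow> clamped (f + g)"
  "clamped f \<Longrightarrow> clamped g \<Longrightarrow> clamped (f - g)"
  "clamped f \<Longrightarrow> clamped (- f)"
  "clamped f \<Longrightarrow> clamped (c *\<^sub>R f)"
  "clamped f \<Longrightarrow> clamped g \<Longrightarrow> clamped (bc_mult f g)"
  by (auto simp: clamped_def)

lemma bounded_linear_J: "bounded_linear J"
proof (rule bounded_linear_intro[of _ "2 * L"])
  show "J (f + g) = J f + J g" for f g
    by (rule bcontfun_eqI) (simp add: apply_J integral_add)
  show "J (c *\<^sub>R f) = c *\<^sub>R J f" for c f
    by (rule bcontfun_eqI) (simp add: apply_J)
  show "norm (J f) \<le> norm f * (2 * L)" for f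
  proof (rule norm_bound)
    fix x
    have "norm (integral {-L..clip x} f) \<le> norm f * (clip x - (-L))"
      by (rule integral_bound) (auto intro: norm_bounded[of f, unfolded real_norm_def])
    also have "\<dots> \<le> norm f * (2 * L)"
      by (intro mult_left_mono) auto
    finally show "norm (J f x) \<le> norm f * (2 * L)" by (simp add: apply_J)
  qed
qed

lemma bounded_linear_Jr: "bounded_linear Jr"
  unfolding Jr_def
  by (intro bounded_linear_sub bounded_linear_J
      bounded_linear_compose[OF bounded_linear_const_bcontfun]
      bounded_linear_compose[OF bounded_linear_apply_bcontfun bounded_linear_J])

lemma J_has_derivative:
  fixes f :: "real \<Rightarrow>\<^sub>C real"
  assumes "x \<in> {-L..L}"
  shows "(J f has_real_derivative f x) (at x within {-L..L})"
proof -
  have "((\<lambda>x. integral {-L..x} f) has_real_derivative f x) (at x within {-L..L})"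
    using assms by (intro integral_has_real_derivative) auto
  then show ?thesis
    by (rule DERIV_transform_within[OF _ assms]) (simp add: apply_J)
qed

lemma Jr_has_derivative:
  fixes f :: "real \<Rightarrow>\<^sub>C real"
  assumes "x \<in> {-L..L}"
  shows "(Jr f has_real_derivative - f x) (at x within {-L..L})"
proof -
  have "((\<lambda>x. J f L - J f x) has_real_derivative - f x) (at x within {-L..L})"
    by (auto intro!: derivative_eq_intros J_has_derivative[OF assms])
  then show ?thesis
    by (rule DERIV_transform_within[OF _ assms]) (simp add: apply_Jr)
qed

text \<open>Gains of a derivative are recorded in this form below, because a constant plus a
  primitive is exactly what the lifted unknown can store: a boundary value and a continuous
  derivative.\<close>

lemma eq_const_plus_J:
  fixes f g :: "real \<Rightarrow>\<^sub>C real"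
  assumes g: "clamped g"
    and der: "\<And>x. x \<in> {-L..L} \<Longrightarrow> (apply_bcontfun g has_real_derivative f x) (at x within {-L..L})"
  shows "g = const_bcontfun (g (-L)) + J f"
proof (rule clamped_eqI[OF g])
  show "clamped (const_bcontfun (g (-L)) + J f)" by (intro clamped_intros clamped_J)
  fix x assume x: "x \<in> {-L..L}"
  have "(apply_bcontfun f has_integral g x - g (-L)) {-L..x}"
  proof (rule fundamental_theorem_of_calculus)
    fix y assume "y \<in> {-L..x}"
    then show "(apply_bcontfun g has_vector_derivative f y) (at y within {-L..x})"
      using x der[of y] has_vector_derivative_within_subset[of g "f y" y "{-L..L}" "{-L..x}"]
      by (auto simp: has_real_derivative_iff_has_vector_derivative)
  qed (use x in auto)
  then have "integral {-L..x} f = g x - g (-L)" by (rule integral_unique)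
  then show "g x = (const_bcontfun (g (-L)) + J f) x"
    using x by (simp add: apply_J)
qed

text \<open>Both primitives are differentiated, with one-sided derivatives at the end points. This
  recovers \<open>u_x\<close> from \<open>u\<close>, and later also turns equality almost everywhere
  of continuous functions into equality.\<close>

lemma J_eqD:
  assumes "clamped p" "clamped q" "J p = J q"
  shows "p = q"
proof (rule clamped_eqI[OF assms(1,2)])
  fix x assume x: "x \<in> {-L..L}"
  have "(J p has_vector_derivative p x) (at x within {-L..L})"
    "(J p has_vector_derivative q x) (at x within {-L..L})"
    using J_has_derivative[OF x, of p] J_has_derivative[OF x, of q] assms(3)
    by (simp_all add: has_real_derivative_iff_has_vector_derivative)
  then show "p x = q x"
    using x L_pos by (metis vector_derivative_unique_within islimpt_Icc trivial_limit_within neg_less_pos)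
qed

text \<open>
  Green kernels split into products on either side of the diagonal, so \<open>L_N\<close>, \<open>L_D\<close> and
  their derivatives all have the shape of \<open>W\<close>.
\<close>

definition W where
  "W g1 h1 g2 h2 f = bc_mult g1 (J (bc_mult h1 f)) + bc_mult g2 (Jr (bc_mult h2 f))"

lemma bounded_linear_W: "bounded_linear (W g1 h1 g2 h2)"
  unfolding W_def
  by (intro bounded_linear_add
      bounded_linear_compose[OF bounded_bilinear.bounded_linear_right[OF bounded_bilinear_bc_mult]]
      bounded_linear_compose[OF bounded_linear_J] bounded_linear_compose[OF bounded_linear_Jr]
      bounded_bilinear.bounded_linear_right[OF bounded_bilinear_bc_mult])

lemma clamped_W [intro]: "clamped g1 \<Longrightarrow> clamped g2 \<Longrightarrow> clamped (W g1 h1 g2 h2 f)"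
  unfolding W_def by (intro clamped_intros clamped_J clamped_Jr)

lemma W_has_derivative:
  fixes f g1 g1' g2 g2' h1 h2 :: "real \<Rightarrow>\<^sub>C real"
  assumes x: "x \<in> {-L..L}"
    and "(apply_bcontfun g1 has_real_derivative g1' x) (at x within {-L..L})"
    and "(apply_bcontfun g2 has_real_derivative g2' x) (at x within {-L..L})"
  shows "(W g1 h1 g2 h2 f has_real_derivative W g1' h1 g2' h2 f x + (g1 x * h1 x - g2 x * h2 x) * f x)
           (at x within {-L..L})"
proof -
  have "((\<lambda>x. g1 x * J (bc_mult h1 f) x + g2 x * Jr (bc_mult h2 f) x) has_real_derivative
      W g1' h1 g2' h2 f x + (g1 x * h1 x - g2 x * h2 x) * f x) (at x within {-L..L})"
    by (rule derivative_eq_intros assms J_has_derivative Jr_has_derivative refl)+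
      (simp add: W_def algebra_simps)
  then show ?thesis
    by (rule DERIV_transform_within[OF _ x]) (simp add: W_def)
qed

section \<open>Hyperbolic kernels and the operators built from them\<close>

definition "sinh_plus \<beta> = ext (\<lambda>x. sinh (\<beta> * (L + x)))"
definition "sinh_minus \<beta> = ext (\<lambda>x. sinh (\<beta> * (L - x)))"
definition "cosh_plus \<beta> = ext (\<lambda>x. cosh (\<beta> * (L + x)))"
definition "cosh_minus \<beta> = ext (\<lambda>x. cosh (\<beta> * (L - x)))"

lemma apply_hyp:
  "sinh_plus \<beta> x = sinh (\<beta> * (L + clip x))" "sinh_minus \<beta> x = sinh (\<beta> * (L - clip x))"
  "cosh_plus \<beta> x = cosh (\<beta> * (L + clip x))" "cosh_minus \<beta> x = cosh (\<beta> * (L - clip x))"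
  unfolding sinh_plus_def sinh_minus_def cosh_plus_def cosh_minus_def
  by (subst apply_ext; (intro continuous_intros)?; simp)+

lemma clamped_hyp: "clamped (sinh_plus \<beta>)" "clamped (sinh_minus \<beta>)" "clamped (cosh_plus \<beta>)" "clamped (cosh_minus \<beta>)"
  by (simp_all add: clamped_def apply_hyp)

lemma hyp_has_derivative:
  assumes x: "x \<in> {-L..L}"
  shows "(sinh_plus \<beta> has_real_derivative (\<beta> *\<^sub>R cosh_plus \<beta>) x) (at x within {-L..L})"
    "(sinh_minus \<beta> has_real_derivative (- \<beta> *\<^sub>R cosh_minus \<beta>) x) (at x within {-L..L})"
    "(cosh_plus \<beta> has_real_derivative (\<beta> *\<^sub>R sinh_plus \<beta>) x) (at x within {-L..L})"
    "(cosh_minus \<beta> has_real_derivative (- \<beta> *\<^sub>R sinh_minus \<beta>) x) (at x within {-L..L})"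
    "(apply_bcontfun (- sinh_plus \<beta>) has_real_derivative (- \<beta> *\<^sub>R cosh_plus \<beta>) x) (at x within {-L..L})"
    "(apply_bcontfun (- cosh_plus \<beta>) has_real_derivative (- \<beta> *\<^sub>R sinh_plus \<beta>) x) (at x within {-L..L})"
proof -
  have "((\<lambda>x. sinh (\<beta> * (L + x))) has_real_derivative (\<beta> *\<^sub>R cosh_plus \<beta>) x) (at x within {-L..L})"
    using x by (auto intro!: derivative_eq_intros simp: apply_hyp)
  then show *: "(sinh_plus \<beta> has_real_derivative (\<beta> *\<^sub>R cosh_plus \<beta>) x) (at x within {-L..L})"
    by (rule DERIV_transform_within[OF _ x]) (simp add: apply_hyp)
  have "((\<lambda>x. sinh (\<beta> * (L - x))) has_real_derivative (- \<beta> *\<^sub>R cosh_minus \<beta>) x) (at x within {-L..L})"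
    using x by (auto intro!: derivative_eq_intros simp: apply_hyp)
  then show "(sinh_minus \<beta> has_real_derivative (- \<beta> *\<^sub>R cosh_minus \<beta>) x) (at x within {-L..L})"
    by (rule DERIV_transform_within[OF _ x]) (simp add: apply_hyp)
  have "((\<lambda>x. cosh (\<beta> * (L + x))) has_real_derivative (\<beta> *\<^sub>R sinh_plus \<beta>) x) (at x within {-L..L})"
    using x by (auto intro!: derivative_eq_intros simp: apply_hyp)
  then show **: "(cosh_plus \<beta> has_real_derivative (\<beta> *\<^sub>R sinh_plus \<beta>) x) (at x within {-L..L})"
    by (rule DERIV_transform_within[OF _ x]) (simp add: apply_hyp)
  have "((\<lambda>x. cosh (\<beta> * (L - x))) has_real_derivative (- \<beta> *\<^sub>R sinh_minus \<beta>) x) (at x within {-L..L})"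
    using x by (auto intro!: derivative_eq_intros simp: apply_hyp)
  then show "(cosh_minus \<beta> has_real_derivative (- \<beta> *\<^sub>R sinh_minus \<beta>) x) (at x within {-L..L})"
    by (rule DERIV_transform_within[OF _ x]) (simp add: apply_hyp)
  show "(apply_bcontfun (- sinh_plus \<beta>) has_real_derivative (- \<beta> *\<^sub>R cosh_plus \<beta>) x) (at x within {-L..L})"
    using DERIV_minus[OF *] by (simp add: uminus_bcontfun.rep_eq[abs_def])
  show "(apply_bcontfun (- cosh_plus \<beta>) has_real_derivative (- \<beta> *\<^sub>R sinh_plus \<beta>) x) (at x within {-L..L})"
    using DERIV_minus[OF **] by (simp add: uminus_bcontfun.rep_eq[abs_def])
qed

definition "S \<beta> = sinh (2 * L * \<beta>)"

text \<open>
  With $\beta = 1/\sqrt b$ (respectively $\beta = 1/\sqrt d$), \<open>V_N\<close> and \<open>V_D\<close> are $L_N$ and $L_D$ on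
  continuous functions. The jump of the kernel on the diagonal contributes the term $\beta^2 f$ to
  the derivatives \<open>dV_N\<close> and \<open>dV_D\<close>.
\<close>

definition "V_N \<beta> f = (\<beta>\<^sup>2 / S \<beta>) *\<^sub>R W (cosh_minus \<beta>) (sinh_plus \<beta>) (- cosh_plus \<beta>) (sinh_minus \<beta>) f"
definition "dV_N \<beta> f = \<beta>\<^sup>2 *\<^sub>R f - (\<beta> ^ 3 / S \<beta>) *\<^sub>R W (sinh_minus \<beta>) (sinh_plus \<beta>) (sinh_plus \<beta>) (sinh_minus \<beta>) f"
definition "V_D \<beta> f = (\<beta>\<^sup>2 / S \<beta>) *\<^sub>R W (sinh_minus \<beta>) (cosh_plus \<beta>) (- sinh_plus \<beta>) (cosh_minus \<beta>) f"
definition "rest_D \<beta> f = - (\<beta> ^ 3 / S \<beta>) *\<^sub>R W (cosh_minus \<beta>) (cosh_plus \<beta>) (cosh_plus \<beta>) (cosh_minus \<beta>) f"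
definition "dV_D \<beta> f = \<beta>\<^sup>2 *\<^sub>R f + rest_D \<beta> f"

lemma W_scaleR: "W (c *\<^sub>R g1) h1 (c *\<^sub>R g2) h2 f = c *\<^sub>R W g1 h1 g2 h2 f"
  by (rule bcontfun_eqI) (simp add: W_def algebra_simps)

lemma W_minus_scaleR: "W (- (c *\<^sub>R g1)) h1 (- (c *\<^sub>R g2)) h2 f = - (c *\<^sub>R W g1 h1 g2 h2 f)"
  by (rule bcontfun_eqI) (simp add: W_def algebra_simps)

text \<open>Addition formula: the two arguments add up to \<open>2 * L * \<beta>\<close> whatever
  \<open>x\<close> is, so the jump on the diagonal is constant.\<close>

lemma wronskian: "x \<in> {-L..L} \<Longrightarrow> cosh_minus \<beta> x * sinh_plus \<beta> x + cosh_plus \<beta> x * sinh_minus \<beta> x = S \<beta>"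
  using sinh_add[of "\<beta> * (L + x)" "\<beta> * (L - x)"]
  by (simp add: apply_hyp S_def algebra_simps)

lemma S_pos: "0 < \<beta> \<Longrightarrow> 0 < S \<beta>"
  using L_pos by (simp add: S_def)

lemma scaleR_has_derivative:
  "(apply_bcontfun g has_real_derivative D) (at x within A) \<Longrightarrow>
   (apply_bcontfun (c *\<^sub>R g) has_real_derivative c * D) (at x within A)" for g :: "real \<Rightarrow>\<^sub>C real"
  using DERIV_cmult[of g D x A c] by (simp add: scaleR_bcontfun.rep_eq[abs_def])

text \<open>The prefactor turns the constant jump \<open>S \<beta>\<close> into the term
  \<open>\<beta>\<^sup>2 *\<^sub>R f\<close> of \<open>dV_N\<close>. The boundary value at
  \<open>-L\<close> has to be kept since, unlike that of \<open>V_D\<close>, it need not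
  vanish.\<close>

lemma V_N_eq:
  assumes "0 < \<beta>"
  shows "V_N \<beta> f = const_bcontfun (V_N \<beta> f (-L)) + J (dV_N \<beta> f)"
proof (rule eq_const_plus_J)
  show "clamped (V_N \<beta> f)"
    unfolding V_N_def by (intro clamped_intros clamped_W clamped_hyp)
  fix x assume x: "x \<in> {-L..L}"
  have "(W (cosh_minus \<beta>) (sinh_plus \<beta>) (- cosh_plus \<beta>) (sinh_minus \<beta>) f has_real_derivative
      - \<beta> * W (sinh_minus \<beta>) (sinh_plus \<beta>) (sinh_plus \<beta>) (sinh_minus \<beta>) f x + S \<beta> * f x) (at x within {-L..L})"
    using W_has_derivative[OF x hyp_has_derivative(4)[OF x, of \<beta>] hyp_has_derivative(6)[OF x, of \<beta>], of "sinh_plus \<beta>" "sinh_minus \<beta>" f]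
      wronskian[OF x, of \<beta>]
    by (simp add: W_minus_scaleR)
  from scaleR_has_derivative[OF this, of "\<beta>\<^sup>2 / S \<beta>"]
  show "(V_N \<beta> f has_real_derivative dV_N \<beta> f x) (at x within {-L..L})"
    using S_pos[OF assms] unfolding V_N_def dV_N_def
    by (simp add: field_simps power2_eq_square power3_eq_cube)
qed

lemma V_D_ends: "V_D \<beta> f (-L) = 0" "V_D \<beta> f L = 0"
  by (simp_all add: V_D_def W_def apply_hyp apply_Jr)

lemma V_D_eq:
  assumes "0 < \<beta>"
  shows "V_D \<beta> f = J (dV_D \<beta> f)"
proof -
  have "V_D \<beta> f = const_bcontfun (V_D \<beta> f (-L)) + J (dV_D \<beta> f)"
  proof (rule eq_const_plus_J)
    show "clamped (V_D \<beta> f)"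
      unfolding V_D_def by (intro clamped_intros clamped_W clamped_hyp)
    fix x assume x: "x \<in> {-L..L}"
    have "(W (sinh_minus \<beta>) (cosh_plus \<beta>) (- sinh_plus \<beta>) (cosh_minus \<beta>) f has_real_derivative
        - \<beta> * W (cosh_minus \<beta>) (cosh_plus \<beta>) (cosh_plus \<beta>) (cosh_minus \<beta>) f x + S \<beta> * f x) (at x within {-L..L})"
      using W_has_derivative[OF x hyp_has_derivative(2)[OF x, of \<beta>] hyp_has_derivative(5)[OF x, of \<beta>], of "cosh_plus \<beta>" "cosh_minus \<beta>" f]
        wronskian[OF x, of \<beta>]
      by (simp add: W_minus_scaleR algebra_simps)
    from scaleR_has_derivative[OF this, of "\<beta>\<^sup>2 / S \<beta>"]
    show "(V_D \<beta> f has_real_derivative dV_D \<beta> f x) (at x within {-L..L})"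
      using S_pos[OF assms] unfolding V_D_def dV_D_def rest_D_def
      by (simp add: field_simps power2_eq_square power3_eq_cube)
  qed
  then show ?thesis by (simp add: V_D_ends)
qed

text \<open>Integrated form of the equation \<open>w - d * w_xx = - f_x\<close> for
  \<open>w = V_D \<beta> f\<close> with \<open>\<beta>\<^sup>2 = 1 / d\<close>: it says that
  \<open>w_x - \<beta>\<^sup>2 f\<close> has derivative \<open>\<beta>\<^sup>2 w\<close>, without
  differentiating \<open>f\<close>. In terms of kernels, the two branches of \<open>rest_D\<close>
  agree on the diagonal, so no jump arises.\<close>

lemma rest_D_eq:
  "rest_D \<beta> f = const_bcontfun (rest_D \<beta> f (-L)) + J (\<beta>\<^sup>2 *\<^sub>R V_D \<beta> f)"
proof (rule eq_const_plus_J)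
  show "clamped (rest_D \<beta> f)"
    unfolding rest_D_def by (intro clamped_intros clamped_W clamped_hyp)
  fix x assume x: "x \<in> {-L..L}"
  have "(W (cosh_minus \<beta>) (cosh_plus \<beta>) (cosh_plus \<beta>) (cosh_minus \<beta>) f has_real_derivative
      - \<beta> * W (sinh_minus \<beta>) (cosh_plus \<beta>) (- sinh_plus \<beta>) (cosh_minus \<beta>) f x) (at x within {-L..L})"
    using W_has_derivative[OF x hyp_has_derivative(4)[OF x, of \<beta>] hyp_has_derivative(3)[OF x, of \<beta>], of "cosh_plus \<beta>" "cosh_minus \<beta>" f]
      W_scaleR[of "- \<beta>" "sinh_minus \<beta>" "cosh_plus \<beta>" "- sinh_plus \<beta>" "cosh_minus \<beta>" f]
    by (simp add: mult.commute)
  from scaleR_has_derivative[OF this, of "- (\<beta> ^ 3 / S \<beta>)"]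
  show "(rest_D \<beta> f has_real_derivative (\<beta>\<^sup>2 *\<^sub>R V_D \<beta> f) x) (at x within {-L..L})"
    unfolding V_D_def rest_D_def
    by (simp add: field_simps power2_eq_square power3_eq_cube)
qed

end

section \<open>The du Bois-Reymond lemma\<close>

lemma borel_measurable_id_lebesgue_on [measurable]:
  "(\<lambda>x. x) \<in> borel_measurable (lebesgue_on S)" for S :: "real set"
  by (rule measurable_restrict_space1) (simp add: measurable_completion)

text \<open>The positive and the negative part of \<open>g\<close> are densities of two finite
  measures with equal mass on every half-line. Half-lines determine such measures, and measures
  determine their densities almost everywhere.\<close>

lemma AE_zero_of_tail_integrals_zero:
  fixes g :: "real \<Rightarrow> real"
  assumes g: "integrable lborel g"
    and tail: "\<And>a. (LINT x|lborel. indicator {a<..} x * g x) = 0"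
  shows "AE x in lborel. g x = 0"
proof -
  have [measurable]: "g \<in> borel_measurable lborel" using g by auto
  \<comment> \<open>\<open>ennreal\<close> sends negative numbers to 0, so \<open>P g\<close> and
    \<open>P (\<lambda>x. - g x)\<close> are the measures with densities the positive and the
    negative part of \<open>g\<close>.\<close>
  define P where "P h = density lborel (\<lambda>x. ennreal (h x))" for h :: "real \<Rightarrow> real"
  have em: "emeasure (P h) {a<..} = ennreal (LINT x|lborel. indicator {a<..} x * max 0 (h x))"
    if h: "integrable lborel h" for a h
  proof -
    have [measurable]: "h \<in> borel_measurable lborel" using h by auto
    have int: "integrable lborel (\<lambda>x. indicator {a<..} x * max 0 (h x))"
      using h by (intro Bochner_Integration.integrable_bound[OF h]) (auto simp: indicator_def)
    have "emeasure (P h) {a<..} = (\<integral>\<^sup>+x. ennreal (indicator {a<..} x * max 0 (h x)) \<partial>lborel)"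
      unfolding P_def by (subst emeasure_density)
        (auto intro!: nn_integral_cong simp: indicator_def max_def ennreal_neg)
    also have "\<dots> = ennreal (LINT x|lborel. indicator {a<..} x * max 0 (h x))"
      by (rule nn_integral_eq_integral[OF int]) auto
    finally show ?thesis .
  qed
  have "P g = P (\<lambda>x. - g x)"
  proof (rule measure_eqI_lessThan)
    fix a
    show "emeasure (P g) {a<..} < \<infinity>" by (simp add: em[OF g])
    have int: "integrable lborel (\<lambda>x. indicator {a<..} x * max 0 (h x))"
      if "integrable lborel h" for h :: "real \<Rightarrow> real"
      using that by (intro Bochner_Integration.integrable_bound[OF that]) (auto simp: indicator_def)
    have "indicator {a<..} x * g x = indicator {a<..} x * max 0 (g x) - indicator {a<..} x * max 0 (- g x)" for x
      by (simp add: max_def)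
    then have "(LINT x|lborel. indicator {a<..} x * max 0 (g x)) - (LINT x|lborel. indicator {a<..} x * max 0 (- g x))
      = (LINT x|lborel. indicator {a<..} x * g x)"
      using Bochner_Integration.integral_diff[OF int[OF g] int[OF Bochner_Integration.integrable_minus[OF g]]]
      by presburger
    then show "emeasure (P g) {a<..} = emeasure (P (\<lambda>x. - g x)) {a<..}"
      using g tail[of a] by (subst (1 2) em) auto
  qed (auto simp: P_def)
  \<comment> \<open>At most one of \<open>g x\<close> and \<open>- g x\<close> is positive, so
    equality after truncation forces both to be 0.\<close>
  then have "AE x in lborel. ennreal (g x) = ennreal (- g x)"
    unfolding P_def by (intro sigma_finite_measure.density_unique sigma_finite_lborel) auto
  then show ?thesis
  proof eventually_elim
    case (elim x)
    then show ?case
      by (cases "0 \<le> g x") (auto simp: ennreal_neg ennreal_eq_0_iff dest: sym)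
  qed
qed

context interval begin

abbreviation "M \<equiv> lebesgue_on {-L..L}"

sublocale finite_measure "lebesgue_on {-L..L}"
  by (rule finite_measure_lebesgue_on) simp

lemma space_M [simp]: "space M = {-L..L}" by simp

lemma continuous_measurable_M: "continuous_on {-L..L} f \<Longrightarrow> f \<in> borel_measurable M"
  by (rule continuous_imp_measurable_on_sets_lebesgue) auto

text \<open>Reduction to the previous lemma: \<open>f\<close> is extended by zero to the line and
  replaced by a Borel function that agrees with it almost everywhere.\<close>

lemma AE_zero_of_tail_integrals_zero_M:
  fixes f :: "real \<Rightarrow> real"
  assumes f: "integrable M f" and tail: "\<And>a. (LINT x|M. indicator {a<..} x * f x) = 0"
  shows "AE x in M. f x = 0"
proof -
  have fi: "integrable lebesgue (\<lambda>x. indicator {-L..L} x *\<^sub>R f x)"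
    using f by (subst (asm) integrable_restrict_space) auto
  then obtain g where g: "g \<in> borel_measurable lborel"
    and fg: "AE x in lborel. indicator {-L..L} x *\<^sub>R f x = g x"
    using completion_ex_borel_measurable_real[of "\<lambda>x. indicator {-L..L} x *\<^sub>R f x" lborel] by auto
  have fg': "AE x in lebesgue. indicator {-L..L} x *\<^sub>R f x = g x"
    using fg by (simp add: AE_completion_iff)
  have gl [measurable]: "g \<in> borel_measurable lebesgue" using g by (simp add: measurable_completion)
  have "integrable lebesgue g"
    using fi integrable_cong_AE[OF _ gl fg'] by auto
  then have gi: "integrable lborel g" using g by (simp add: integrable_completion)
  have "AE x in lborel. g x = 0"
  proof (rule AE_zero_of_tail_integrals_zero[OF gi])
    fix a
    have "(LINT x|lborel. indicator {a<..} x * g x) = (LINT x|lebesgue. indicator {a<..} x * g x)"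
      using g by (intro integral_completion[symmetric]) auto
    also have "\<dots> = (LINT x|lebesgue. indicator {-L..L} x *\<^sub>R (indicator {a<..} x * f x))"
    proof (rule integral_cong_AE)
      have ind: "indicator {a<..} \<in> borel_measurable lebesgue" for a :: real
        by (rule measurable_completion) simp
      have eq: "indicator {-L..L} x *\<^sub>R (indicator {a<..} x * f x) =
          indicator {a<..} x * (indicator {-L..L} x *\<^sub>R f x)" for x by simp
      show "(\<lambda>x. indicator {a<..} x * g x) \<in> borel_measurable lebesgue"
        by (intro borel_measurable_times ind gl)
      show "(\<lambda>x. indicator {-L..L} x *\<^sub>R (indicator {a<..} x * f x)) \<in> borel_measurable lebesgue"
        unfolding eq using fi by (intro borel_measurable_times ind) auto
      show "AE x in lebesgue. indicator {a<..} x * g x =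
          indicator {-L..L} x *\<^sub>R (indicator {a<..} x * f x)"
        unfolding eq using fg' by eventually_elim simp
    qed
    also have "\<dots> = (LINT x|M. indicator {a<..} x * f x)"
      by (subst integral_restrict_space) auto
    finally show "(LINT x|lborel. indicator {a<..} x * g x) = 0" using tail by simp
  qed
  then have "AE x in lebesgue. indicator {-L..L} x *\<^sub>R f x = 0"
    using fg' by (auto simp: AE_completion_iff elim: eventually_elim2)
  then show ?thesis
    by (subst AE_restrict_space_iff) (auto elim!: eventually_mono simp: indicator_def)
qed

lemma test_functionE:
  assumes "\<phi> \<in> test_functions L"
  obtains s t where "-L < s" "s \<le> t" "t < L" "\<And>x. x \<notin> {s..t} \<Longrightarrow> \<phi> x = 0"
    "\<And>x. (\<phi> has_real_derivative deriv \<phi> x) (at x)" "continuous_on UNIV (deriv \<phi>)" "continuous_on UNIV \<phi>"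
proof -
  let ?K = "closure {x. \<phi> x \<noteq> 0}"
  have K: "compact ?K" "?K \<subseteq> {-L<..<L}" and C1: "\<phi> C1_differentiable_on UNIV"
    using assms by (auto simp: test_functions_def)
  from C1 obtain D where D: "\<And>x. (\<phi> has_vector_derivative D x) (at x)" "continuous_on UNIV D"
    unfolding C1_differentiable_on_def by auto
  then have D': "(\<phi> has_real_derivative D x) (at x)" for x
    by (simp add: has_real_derivative_iff_has_vector_derivative)
  then have dD: "deriv \<phi> = D" by (intro ext DERIV_imp_deriv)
  have cont: "continuous_on UNIV \<phi>" by (meson D' DERIV_isCont continuous_at_imp_continuous_on)
  have "\<exists>s t. -L < s \<and> s \<le> t \<and> t < L \<and> ?K \<subseteq> {s..t}"
  proof (cases "?K = {}")
    case True
    then show ?thesis using L_pos by (intro exI[of _ 0]) auto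
  next
    case False
    obtain s where s: "s \<in> ?K" "\<forall>x\<in>?K. s \<le> x"
      using compact_attains_inf[OF K(1) False] by blast
    obtain t where t: "t \<in> ?K" "\<forall>x\<in>?K. x \<le> t"
      using compact_attains_sup[OF K(1) False] by blast
    have "-L < s" "t < L" using K(2) s(1) t(1) by auto
    then show ?thesis using s t by (intro exI[of _ s] exI[of _ t] conjI subsetI) auto
  qed
  then obtain s t where st: "-L < s" "s \<le> t" "t < L" "?K \<subseteq> {s..t}" by blast
  have "\<phi> x = 0" if "x \<notin> {s..t}" for x
    using that st(4) closure_subset[of "{x. \<phi> x \<noteq> 0}"] by blast
  then show thesis using that[of s t] st D' D(2) cont unfolding dD by blast
qed

text \<open>A primitive of a function supported in \<open>{s..t}\<close> is constant beyond
  \<open>t\<close>; the vanishing total integral makes that constant 0 and hence the support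
  compact.\<close>

lemma test_function_antiderivative:
  assumes \<psi>: "continuous_on UNIV \<psi>" and st: "-L < s" "t < L" and z: "\<And>x. x \<notin> {s..t} \<Longrightarrow> \<psi> x = 0"
    and tot: "integral {-L..L} \<psi> = 0"
  defines "\<phi> \<equiv> \<lambda>x. integral {-L..x} \<psi>"
  shows "\<phi> \<in> test_functions L" "deriv \<phi> = \<psi>"
proof -
  have left: "\<phi> x = 0" if "x < s" for x
  proof -
    have "integral {-L..x} \<psi> = integral {-L..x} (\<lambda>_. 0)"
      using that z by (intro Henstock_Kurzweil_Integration.integral_cong) auto
    then show ?thesis by (simp add: \<phi>_def)
  qed
  have int: "\<psi> integrable_on {u..v}" for u v
    using \<psi> by (intro integrable_continuous_real) (auto intro: continuous_on_subset)
  have right: "\<phi> x = 0" if "x > t" for x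
  proof (cases "x \<le> L")
    case True
    have "integral {x..L} \<psi> = integral {x..L} (\<lambda>_. 0)"
      using that z by (intro Henstock_Kurzweil_Integration.integral_cong) auto
    moreover have "x < -L \<Longrightarrow> integral {-L..x} \<psi> = 0" by simp
    ultimately show ?thesis
      using Henstock_Kurzweil_Integration.integral_combine[OF _ True int, of "-L"] tot
      by (cases "-L \<le> x") (auto simp: \<phi>_def)
  next
    case False
    have "integral {L..x} \<psi> = integral {L..x} (\<lambda>_. 0)"
      using st z by (intro Henstock_Kurzweil_Integration.integral_cong) auto
    then show ?thesis
      using Henstock_Kurzweil_Integration.integral_combine[OF _ _ int, of "-L" L x] False tot L_pos
      by (auto simp: \<phi>_def)
  qed
  have der: "(\<phi> has_real_derivative \<psi> x) (at x)" for x
  proof (cases "x < s")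
    case True
    have "((\<lambda>x. 0) has_real_derivative \<psi> x) (at x)" using z[of x] True by simp
    then show ?thesis
      by (rule has_field_derivative_transform_within_open[of _ _ _ "{..<s}"]) (use True left in auto)
  next
    case False
    have "((\<lambda>x. integral {-L..x} \<psi>) has_real_derivative \<psi> x) (at x within {-L..x+1})"
      using False st by (intro integral_has_real_derivative continuous_on_subset[OF \<psi>]) auto
    moreover have "at x within {-L..x+1} = at x"
      using False st by (intro at_within_interior) auto
    ultimately show ?thesis by (simp add: \<phi>_def)
  qed
  then show "deriv \<phi> = \<psi>" by (intro ext DERIV_imp_deriv)
  have supp: "{x. \<phi> x \<noteq> 0} \<subseteq> {s..t}" using left right by force
  then have "closure {x. \<phi> x \<noteq> 0} \<subseteq> {s..t}" by (rule closure_minimal) simp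
  moreover from this have "compact (closure {x. \<phi> x \<noteq> 0})"
    by (meson bounded_closed_interval bounded_subset compact_eq_bounded_closed closed_closure)
  moreover have "\<phi> C1_differentiable_on UNIV"
    unfolding C1_differentiable_on_def
    using der \<psi> by (auto simp: has_real_derivative_iff_has_vector_derivative)
  ultimately show "\<phi> \<in> test_functions L"
    using st unfolding test_functions_def by force
qed

lemma integrable_mult_continuous_M:
  fixes w \<psi> :: "real \<Rightarrow> real"
  assumes w: "integrable M w" and \<psi>: "continuous_on {-L..L} \<psi>"
  shows "integrable M (\<lambda>x. w x * \<psi> x)"
proof -
  have "bounded (\<psi> ` {-L..L})"
    using \<psi> by (intro compact_imp_bounded compact_continuous_image) auto
  then obtain B where B: "\<And>x. x \<in> {-L..L} \<Longrightarrow> \<bar>\<psi> x\<bar> \<le> B"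
    unfolding bounded_iff real_norm_def by blast
  show ?thesis
  proof (rule Bochner_Integration.integrable_bound)
    show "integrable M (\<lambda>x. B * w x)" using w by simp
    show "(\<lambda>x. w x * \<psi> x) \<in> borel_measurable M"
      using w continuous_measurable_M[OF \<psi>] by auto
    show "AE x in M. norm (w x * \<psi> x) \<le> norm (B * w x)"
    proof (rule AE_I2)
      fix x assume "x \<in> space M"
      then have "\<bar>\<psi> x\<bar> \<le> \<bar>B\<bar>" using B[of x] by auto
      then show "norm (w x * \<psi> x) \<le> norm (B * w x)"
        by (simp add: abs_mult mult.commute mult_right_mono)
    qed
  qed
qed

text \<open>Subtracting a multiple of a fixed bump \<open>\<rho>\<close> gives any compactly
  supported continuous \<psi> mean zero, so the difference is the derivative of a test function.
  Hence \<open>w - C\<close> annihilates all such \<psi>, and approximating indicators of intervals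
  reduces the claim to vanishing tail integrals.\<close>

theorem du_bois_reymond:
  fixes w :: "real \<Rightarrow> real"
  assumes w: "integrable M w"
    and test: "\<And>\<phi>. \<phi> \<in> test_functions L \<Longrightarrow> (LINT x|M. w x * deriv \<phi> x) = 0"
  obtains C where "AE x in M. w x = C"
proof -
  \<comment> \<open>A tent supported in [-L/2, L/2]; only its compact support and nonzero integral
    matter.\<close>
  define \<rho> :: "real \<Rightarrow> real" where "\<rho> x = max 0 (L / 2 - \<bar>x\<bar>)" for x
  have \<rho>: "continuous_on A \<rho>" for A unfolding \<rho>_def by (intro continuous_intros)
  define m where "m = integral {-L..L} \<rho>"
  have "m \<noteq> 0"
  proof
    assume "m = 0"
    then have "(\<rho> has_integral 0) (cbox (-L) L)"
      using integrable_continuous_real[OF \<rho>, of "-L" L] by (simp add: m_def has_integral_iff)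
    then have "\<rho> 0 = 0"
    proof (rule has_integral_0_cbox_imp_0[rotated 2])
      show "continuous_on (cbox (-L) L) \<rho>" by (rule \<rho>)
    qed (use L_pos in \<open>auto simp: \<rho>_def box_real\<close>)
    then show False using L_pos by (simp add: \<rho>_def)
  qed
  \<comment> \<open>The only candidate: integrating \<open>w = C\<close> against
    \<open>\<rho>\<close> gives \<open>C * m\<close>.\<close>
  define C where "C = (LINT x|M. w x * \<rho> x) / m"
  have main: "(LINT x|M. (w x - C) * \<psi> x) = 0"
    if \<psi>: "continuous_on UNIV \<psi>" and st: "-L < s" "t < L" and z: "\<And>x. x \<notin> {s..t} \<Longrightarrow> \<psi> x = 0" for \<psi> s t
  proof -
    define k where "k = integral {-L..L} \<psi>"
    define \<theta> where "\<theta> x = \<psi> x - k / m * \<rho> x" for x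
    have \<psi>': "continuous_on A \<psi>" for A using \<psi> by (rule continuous_on_subset) auto
    have "continuous_on UNIV \<theta>" unfolding \<theta>_def by (intro continuous_intros \<psi> \<rho>)
    moreover have "\<theta> x = 0" if "x \<notin> {min s (-L/2)..max t (L/2)}" for x
      using that z[of x] by (auto simp: \<theta>_def \<rho>_def min_def max_def split: if_splits)
    moreover have "integral {-L..L} \<theta> = 0"
      unfolding \<theta>_def using \<open>m \<noteq> 0\<close>
      by (subst Henstock_Kurzweil_Integration.integral_diff)
        (auto intro!: integrable_continuous_real continuous_intros \<psi>' \<rho> simp: k_def m_def)
    moreover have "-L < min s (-L/2)" "max t (L/2) < L" using st L_pos by auto
    ultimately have "(\<lambda>x. integral {-L..x} \<theta>) \<in> test_functions L" "deriv (\<lambda>x. integral {-L..x} \<theta>) = \<theta>"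
      using test_function_antiderivative[of \<theta> "min s (-L/2)" "max t (L/2)"] by blast+
    with test have "(LINT x|M. w x * \<theta> x) = 0" by metis
    moreover have "(LINT x|M. w x * \<theta> x) = (LINT x|M. w x * \<psi> x - k / m * (w x * \<rho> x))"
      by (simp add: \<theta>_def algebra_simps)
    moreover have "\<dots> = (LINT x|M. w x * \<psi> x) - k / m * (LINT x|M. w x * \<rho> x)"
      using integrable_mult_continuous_M[OF w \<psi>'] integrable_mult_continuous_M[OF w \<rho>]
      by (subst Bochner_Integration.integral_diff) auto
    moreover have "(LINT x|M. (w x - C) * \<psi> x) = (LINT x|M. w x * \<psi> x) - C * (LINT x|M. \<psi> x)"
      using integrable_mult_continuous_M[OF w \<psi>'] continuous_imp_integrable_real[OF \<psi>', of "-L" L]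
      by (simp add: left_diff_distrib)
    moreover have "(LINT x|M. \<psi> x) = k"
      unfolding k_def by (intro lebesgue_integral_eq_integral continuous_imp_integrable_real \<psi>') simp
    ultimately show ?thesis by (simp add: C_def)
  qed
  have "AE x in M. w x - C = 0"
  proof (rule AE_zero_of_tail_integrals_zero_M)
    show int: "integrable M (\<lambda>x. w x - C)" using w by simp
    fix a
    define a' where "a' = max a (-L)"
    \<comment> \<open>Trapezoids of height at most 1 with ramps of slope \<open>n + 1\<close>,
      supported at distance \<open>1 / (n + 1)\<close> inside (a', L). They increase to full height
      once \<open>1 / (n + 1)\<close> is below half the distance of \<open>x\<close> to the end
      points, and so tend to the indicator of the open interval.\<close>
    define \<psi> :: "nat \<Rightarrow> real \<Rightarrow> real" where
      "\<psi> n x = min 1 (real (Suc n) * max 0 (min (x - a' - inverse (real (Suc n))) (L - inverse (real (Suc n)) - x)))" for n x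
    have cont\<psi>: "continuous_on A (\<psi> n)" for A n
      unfolding \<psi>_def by (intro continuous_intros)
    have \<psi>0: "(LINT x|M. (w x - C) * \<psi> n x) = 0" for n
    proof (rule main[of _ "a' + inverse (real (Suc n))" "L - inverse (real (Suc n))"])
      show "continuous_on UNIV (\<psi> n)" by (rule cont\<psi>)
      have "0 < inverse (real (Suc n))" "-L \<le> a'" by (simp_all add: a'_def)
      then show "-L < a' + inverse (real (Suc n))" "L - inverse (real (Suc n)) < L" by linarith+
      show "\<psi> n x = 0" if "x \<notin> {a' + inverse (real (Suc n))..L - inverse (real (Suc n))}" for x
      proof -
        have "min (x - a' - inverse (real (Suc n))) (L - inverse (real (Suc n)) - x) \<le> 0"
          using that by (auto simp del: of_nat_Suc)
        then show ?thesis unfolding \<psi>_def by (simp add: max_absorb1)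
      qed
    qed
    have lim: "(\<lambda>n. \<psi> n x) \<longlonglongrightarrow> indicator {a'<..<L} x" for x
    proof (cases "x \<in> {a'<..<L}")
      case True
      define \<delta> where "\<delta> = min (x - a') (L - x)"
      have "0 < \<delta>" using True by (simp add: \<delta>_def)
      have "\<forall>\<^sub>F n in sequentially. inverse (real (Suc n)) < \<delta> / 2"
        using LIMSEQ_inverse_real_of_nat \<open>0 < \<delta>\<close> by (intro order_tendstoD(2)) auto
      then have "\<forall>\<^sub>F n in sequentially. \<psi> n x = 1"
      proof eventually_elim
        case (elim n)
        have "1 \<le> real (Suc n) * (\<delta> / 2)"
          using elim by (simp add: field_simps)
        also have "\<dots> \<le> real (Suc n) * max 0 (min (x - a' - inverse (real (Suc n))) (L - inverse (real (Suc n)) - x))"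
          using elim by (intro mult_left_mono) (simp_all add: \<delta>_def le_max_iff_disj, linarith)
        finally show ?case unfolding \<psi>_def by simp
      qed
      then show ?thesis using True by (simp add: tendsto_eventually)
    next
      case False
      have "\<psi> n x = 0" for n
      proof -
        have "0 < inverse (real (Suc n))" by simp
        then have "min (x - a' - inverse (real (Suc n))) (L - inverse (real (Suc n)) - x) \<le> 0"
          using False unfolding min_le_iff_disj greaterThanLessThan_iff by linarith
        then show ?thesis unfolding \<psi>_def by (simp add: max_absorb1)
      qed
      then show ?thesis using False by simp
    qed
    have "(\<lambda>n. LINT x|M. (w x - C) * \<psi> n x) \<longlonglongrightarrow> (LINT x|M. (w x - C) * indicator {a'<..<L} x)"
    proof (rule integral_dominated_convergence[where w = "\<lambda>x. \<bar>w x - C\<bar>"])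
      show "integrable M (\<lambda>x. \<bar>w x - C\<bar>)" using int by simp
      show "(\<lambda>x. (w x - C) * \<psi> n x) \<in> borel_measurable M" for n
        by (intro borel_measurable_times continuous_measurable_M cont\<psi> borel_measurable_integrable[OF int])
      show "(\<lambda>x. (w x - C) * indicator {a'<..<L} x) \<in> borel_measurable M"
        by (intro borel_measurable_times borel_measurable_integrable[OF int] measurable_restrict_space1[OF measurable_completion] borel_measurable_indicator) simp
      show "AE x in M. (\<lambda>n. (w x - C) * \<psi> n x) \<longlonglongrightarrow> (w x - C) * indicator {a'<..<L} x"
        by (auto intro!: tendsto_intros lim)
      have "\<bar>\<psi> n x\<bar> \<le> 1" for n x
      proof -
        have "0 \<le> \<psi> n x" "\<psi> n x \<le> 1" unfolding \<psi>_def by (simp_all del: of_nat_Suc)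
        then show ?thesis by simp
      qed
      then show "AE x in M. norm ((w x - C) * \<psi> n x) \<le> \<bar>w x - C\<bar>" for n
        by (simp add: abs_mult mult_left_le)
    qed
    then have "(LINT x|M. (w x - C) * indicator {a'<..<L} x) = 0"
      by (simp add: \<psi>0 LIMSEQ_const_iff)
    \<comment> \<open>On [-L,L] the two indicators differ at most at the end points, a null
      set.\<close>
    moreover have "(LINT x|M. indicator {a<..} x * (w x - C)) = (LINT x|M. (w x - C) * indicator {a'<..<L} x)"
    proof (rule integral_cong_AE)
      have "AE x in lebesgue. x \<noteq> L" "AE x in lebesgue. x \<noteq> -L"
        by (auto simp: AE_completion_iff AE_lborel_singleton)
      then have "AE x in M. x \<noteq> L \<and> x \<noteq> - L"
        by (subst AE_restrict_space_iff) auto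
      then show "AE x in M. indicator {a<..} x * (w x - C) = (w x - C) * indicator {a'<..<L} x"
        using AE_space by eventually_elim (auto simp: a'_def indicator_def)
      show "(\<lambda>x. indicator {a<..} x * (w x - C)) \<in> borel_measurable M"
        "(\<lambda>x. (w x - C) * indicator {a'<..<L} x) \<in> borel_measurable M"
        by (intro borel_measurable_times borel_measurable_integrable[OF int] measurable_restrict_space1[OF measurable_completion] borel_measurable_indicator; simp)+
    qed
    ultimately show "(LINT x|M. indicator {a<..} x * (w x - C)) = 0" by simp
  qed
  then show thesis using that[of C] by auto
qed

section \<open>Weak derivatives and continuous representatives\<close>

lemma test_function_continuous:
  assumes "\<phi> \<in> test_functions L"
  shows "continuous_on A \<phi>" "continuous_on A (deriv \<phi>)"
proof -
  have "continuous_on UNIV \<phi>" "continuous_on UNIV (deriv \<phi>)"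
    by (rule test_functionE[OF assms]; assumption)+
  then show "continuous_on A \<phi>" "continuous_on A (deriv \<phi>)"
    using continuous_on_subset by blast+
qed

lemma L2_integrable: "f \<in> L2_space L \<Longrightarrow> integrable M f"
proof -
  assume f: "f \<in> L2_space L"
  show "integrable M f"
  proof (rule Bochner_Integration.integrable_bound)
    show "integrable M (\<lambda>x. 1 + (f x)\<^sup>2)" using f by (simp add: L2_space_def)
    show "f \<in> borel_measurable M" using f by (simp add: L2_space_def)
    have "\<bar>f x\<bar> \<le> \<bar>1 + (f x)\<^sup>2\<bar>" for x
      using zero_le_power2[of "\<bar>f x\<bar> - 1"] by (simp add: power2_eq_square algebra_simps abs_if split: if_splits)
    then show "AE x in M. norm (f x) \<le> norm (1 + (f x)\<^sup>2)" by simp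
  qed
qed

lemma L2_measurable: "f \<in> L2_space L \<Longrightarrow> f \<in> borel_measurable M"
  by (simp add: L2_space_def)

lemma L2_continuous: "continuous_on {-L..L} f \<Longrightarrow> f \<in> L2_space L"
  unfolding L2_space_def
  by (auto intro!: continuous_measurable_M continuous_imp_integrable_real continuous_intros)

lemma L2_cmult:
  assumes f: "f \<in> L2_space L" shows "(\<lambda>x. c * f x) \<in> L2_space L"
proof -
  have [measurable]: "f \<in> borel_measurable M" using f by (rule L2_measurable)
  have "(\<lambda>x. c * f x) \<in> borel_measurable M" by measurable
  then show ?thesis using f by (simp add: L2_space_def power_mult_distrib)
qed

lemma L2_add:
  assumes f: "f \<in> L2_space L" and g: "g \<in> L2_space L"
  shows "(\<lambda>x. f x + g x) \<in> L2_space L"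
proof -
  have [measurable]: "f \<in> borel_measurable M" "g \<in> borel_measurable M"
    using f g by (simp_all add: L2_space_def)
  have "integrable M (\<lambda>x. (f x + g x)\<^sup>2)"
  proof (rule Bochner_Integration.integrable_bound)
    show "integrable M (\<lambda>x. 2 * (f x)\<^sup>2 + 2 * (g x)\<^sup>2)" using f g by (simp add: L2_space_def)
    have "(f x + g x)\<^sup>2 \<le> 2 * (f x)\<^sup>2 + 2 * (g x)\<^sup>2" for x
      using zero_le_power2[of "f x - g x"] by (simp add: power2_eq_square algebra_simps)
    then show "AE x in M. norm ((f x + g x)\<^sup>2) \<le> norm (2 * (f x)\<^sup>2 + 2 * (g x)\<^sup>2)" by simp
  qed measurable
  then show ?thesis by (simp add: L2_space_def)
qed

lemma L2_norm_power2: "(L2_norm L f)\<^sup>2 = (LINT x|M. (f x)\<^sup>2)"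
  unfolding L2_norm_def by (intro real_sqrt_pow2 Bochner_Integration.integral_nonneg) simp

lemma L2_norm_cong:
  assumes "f \<in> L2_space L" "g \<in> L2_space L" "ae_eq L f g"
  shows "L2_norm L f = L2_norm L g"
proof -
  have "(LINT x|M. (f x)\<^sup>2) = (LINT x|M. (g x)\<^sup>2)"
    using assms by (intro integral_cong_AE) (auto simp: L2_space_def ae_eq_def elim: eventually_mono)
  then show ?thesis by (simp add: L2_norm_def)
qed

lemma integral_eq_LINT_indicator_left:
  fixes g :: "real \<Rightarrow> real"
  assumes g: "integrable M g" and x: "x \<in> {-L..L}"
  shows "integral {-L..x} g = (LINT y|M. indicator {..x} y * g y)"
proof -
  have "integral {-L..x} g = (LINT y|lebesgue_on {-L..x}. g y)"
    using x by (intro lebesgue_integral_eq_integral[symmetric]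
        Equivalence_Lebesgue_Henstock_Integration.integrable_subinterval[OF g]) auto
  also have "\<dots> = (LINT y|lebesgue. indicator {-L..L} y *\<^sub>R (indicator {..x} y * g y))"
    using x by (subst integral_restrict_space)
      (auto intro!: Bochner_Integration.integral_cong simp: indicator_def)
  also have "\<dots> = (LINT y|M. indicator {..x} y * g y)"
    by (subst integral_restrict_space) auto
  finally show ?thesis .
qed

lemma integral_eq_LINT_indicator_right:
  fixes g :: "real \<Rightarrow> real"
  assumes g: "integrable M g" and x: "x \<in> {-L..L}"
  shows "integral {x..L} g = (LINT y|M. indicator {x..} y * g y)"
proof -
  have "integral {x..L} g = (LINT y|lebesgue_on {x..L}. g y)"
    using x by (intro lebesgue_integral_eq_integral[symmetric]
        Equivalence_Lebesgue_Henstock_Integration.integrable_subinterval[OF g]) auto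
  also have "\<dots> = (LINT y|lebesgue. indicator {-L..L} y *\<^sub>R (indicator {x..} y * g y))"
    using x by (subst integral_restrict_space)
      (auto intro!: Bochner_Integration.integral_cong simp: indicator_def)
  also have "\<dots> = (LINT y|M. indicator {x..} y * g y)"
    by (subst integral_restrict_space) auto
  finally show ?thesis .
qed

lemma borel_measurable_M_borel: "f \<in> borel_measurable borel \<Longrightarrow> f \<in> borel_measurable M" for f :: "real \<Rightarrow> real"
  by (rule measurable_restrict_space1, rule measurable_completion) simp

lemma integral_cong_ae_eq:
  assumes f: "integrable M f" and g: "integrable M g" and eq: "ae_eq L f g" and x: "x \<in> {-L..L}"
  shows "integral {-L..x} f = integral {-L..x} g"
proof -
  have [measurable]: "(indicator {..x} :: real \<Rightarrow> real) \<in> borel_measurable M"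
    "f \<in> borel_measurable M" "g \<in> borel_measurable M"
    using f g by (auto intro!: borel_measurable_M_borel)
  show ?thesis
    unfolding integral_eq_LINT_indicator_left[OF f x] integral_eq_LINT_indicator_left[OF g x]
    using eq by (intro integral_cong_AE) (auto simp: ae_eq_def elim: eventually_mono)
qed

text \<open>Integration by parts when \<open>g\<close> is only integrable: Fubini on the triangle
  \<open>y \<le> x\<close> leaves the inner integral of \<open>deriv \<phi>\<close> from
  \<open>y\<close> to \<open>L\<close>, which is \<open>- \<phi> y\<close> since \<phi> vanishes at
  \<open>L\<close>.\<close>

lemma primitive_by_parts:
  assumes g: "integrable M g" and \<phi>: "\<phi> \<in> test_functions L"
  shows "(LINT x|M. integral {-L..x} g * deriv \<phi> x) = - (LINT y|M. g y * \<phi> y)"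
proof -
  obtain s t where st: "-L < s" "t < L" "\<And>x. x \<notin> {s..t} \<Longrightarrow> \<phi> x = 0"
    and der: "\<And>x. (\<phi> has_real_derivative deriv \<phi> x) (at x)"
    and cont: "continuous_on UNIV (deriv \<phi>)"
    using test_functionE[OF \<phi>] by metis
  define D where "D = deriv \<phi>"
  have contD: "continuous_on A D" for A unfolding D_def using cont continuous_on_subset by blast
  have [measurable]: "D \<in> borel_measurable M" by (rule continuous_measurable_M[OF contD])
  have [measurable]: "g \<in> borel_measurable M" using g by auto
  interpret P: pair_sigma_finite M M ..
  define f where "f x y = (if y \<le> x then g y * D x else 0)" for x y
  have "bounded (D ` {-L..L})"
    using contD by (intro compact_imp_bounded compact_continuous_image) auto
  then obtain B where B: "\<And>x. x \<in> {-L..L} \<Longrightarrow> \<bar>D x\<bar> \<le> B"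
    unfolding bounded_iff real_norm_def by blast
  have int: "integrable (M \<Otimes>\<^sub>M M) (case_prod f)"
  proof (rule Bochner_Integration.integrable_bound)
    show "integrable (M \<Otimes>\<^sub>M M) (\<lambda>(x, y). B * g y)"
      by (rule P.Fubini_integrable) (use g in auto)
    show "case_prod f \<in> borel_measurable (M \<Otimes>\<^sub>M M)"
      unfolding f_def by measurable
    show "AE z in M \<Otimes>\<^sub>M M. norm (case_prod f z) \<le> norm (case z of (x, y) \<Rightarrow> B * g y)"
    proof (rule AE_I2)
      fix z assume "z \<in> space (M \<Otimes>\<^sub>M M)"
      then obtain x y where z: "z = (x, y)" "x \<in> {-L..L}" by (auto simp: space_pair_measure)
      have "\<bar>D x\<bar> \<le> \<bar>B\<bar>" using B[OF z(2)] by auto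
      then show "norm (case_prod f z) \<le> norm (case z of (x, y) \<Rightarrow> B * g y)"
        by (simp add: z f_def abs_mult mult.commute mult_right_mono)
    qed
  qed
  have "(LINT x|M. integral {-L..x} g * D x) = (LINT x|M. LINT y|M. f x y)"
  proof (rule Bochner_Integration.integral_cong)
    fix x assume "x \<in> space M"
    then have x: "x \<in> {-L..L}" by simp
    have "f x y = indicator {..x} y * g y * D x" for y by (simp add: f_def)
    then show "integral {-L..x} g * D x = (LINT y|M. f x y)"
      by (simp add: integral_eq_LINT_indicator_left[OF g x])
  qed simp
  also have "\<dots> = (LINT y|M. LINT x|M. f x y)"
    by (rule P.Fubini_integral[OF int, symmetric])
  also have "\<dots> = (LINT y|M. - (g y * \<phi> y))"
  proof (rule Bochner_Integration.integral_cong)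
    fix y assume "y \<in> space M"
    then have y: "y \<in> {-L..L}" by simp
    have "f x y = g y * (indicator {y..} x * D x)" for x by (simp add: f_def)
    then have "(LINT x|M. f x y) = g y * (LINT x|M. indicator {y..} x * D x)"
      by simp
    also have "(LINT x|M. indicator {y..} x * D x) = integral {y..L} D"
      by (rule integral_eq_LINT_indicator_right[OF continuous_imp_integrable_real[OF contD] y, symmetric])
    also have "integral {y..L} D = \<phi> L - \<phi> y"
      using y der unfolding D_def
      by (intro integral_unique fundamental_theorem_of_calculus)
        (auto simp: has_real_derivative_iff_has_vector_derivative intro: has_vector_derivative_at_within)
    finally show "(LINT x|M. f x y) = - (g y * \<phi> y)" using st by simp
  qed simp
  finally show ?thesis by (simp add: D_def)
qed

lemma has_weak_derivD:
  assumes "has_weak_deriv L v g"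
  shows "v \<in> L2_space L" "g \<in> L2_space L" "integrable M v" "integrable M g"
    "\<phi> \<in> test_functions L \<Longrightarrow> (LINT x|M. v x * deriv \<phi> x) = - (LINT x|M. g x * \<phi> x)"
  using assms L2_integrable by (auto simp: has_weak_deriv_def)

lemma primitive_continuous:
  "integrable M g \<Longrightarrow> continuous_on {-L..L} (\<lambda>x. integral {-L..x} g)" for g :: "real \<Rightarrow> real"
  by (intro indefinite_integral_continuous_1 integrable_on_lebesgue_on) auto

text \<open>By \<open>primitive_by_parts\<close>, \<open>v\<close> minus the primitive of
  \<open>g\<close> annihilates every derivative of a test function, so the du Bois-Reymond lemma
  makes it constant.\<close>

lemma weak_deriv_primitive:
  assumes v: "has_weak_deriv L v g"
  obtains C where "ae_eq L v (\<lambda>x. C + integral {-L..x} g)"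
proof -
  note v' = has_weak_derivD[OF v]
  have pi: "integrable M (\<lambda>x. integral {-L..x} g)"
    by (rule continuous_imp_integrable_real[OF primitive_continuous[OF v'(4)]])
  obtain C where "AE x in M. v x - integral {-L..x} g = C"
  proof (rule du_bois_reymond)
    show "integrable M (\<lambda>x. v x - integral {-L..x} g)" using v' pi by simp
    fix \<phi> assume \<phi>: "\<phi> \<in> test_functions L"
    note cont = test_function_continuous(2)[OF \<phi>, of "{-L..L}"]
    show "(LINT x|M. (v x - integral {-L..x} g) * deriv \<phi> x) = 0"
      using v'(5)[OF \<phi>] primitive_by_parts[OF v'(4) \<phi>]
        integrable_mult_continuous_M[OF v'(3) cont] integrable_mult_continuous_M[OF pi cont]
      by (simp add: left_diff_distrib)
  qed
  then have "ae_eq L v (\<lambda>x. C + integral {-L..x} g)"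
    unfolding ae_eq_def by eventually_elim simp
  then show thesis by (rule that)
qed

lemma ae_eq_sym: "ae_eq L f g \<Longrightarrow> ae_eq L g f"
  unfolding ae_eq_def by (auto elim: eventually_mono)

lemma ae_eq_trans: "ae_eq L f g \<Longrightarrow> ae_eq L g h \<Longrightarrow> ae_eq L f h"
  unfolding ae_eq_def by (auto elim: eventually_elim2)

lemma ae_eqI: "(\<And>x. x \<in> {-L..L} \<Longrightarrow> f x = g x) \<Longrightarrow> ae_eq L f g"
  unfolding ae_eq_def by (auto intro!: AE_I2)

lemma ae_eq_diff: "ae_eq L f f' \<Longrightarrow> ae_eq L g g' \<Longrightarrow> ae_eq L (\<lambda>x. f x - g x) (\<lambda>x. f' x - g' x)"
  unfolding ae_eq_def by (auto elim: eventually_elim2)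

text \<open>The primitives of the two functions coincide everywhere, and differentiating them gives
  the functions back.\<close>

lemma ae_eq_continuous_imp_eq:
  assumes f: "continuous_on {-L..L} f" and g: "continuous_on {-L..L} g"
    and eq: "ae_eq L f g" and x: "x \<in> {-L..L}"
  shows "f x = g x"
proof -
  have "J (ext f) = J (ext g)"
  proof (rule clamped_eqI)
    fix y assume y: "y \<in> {-L..L}"
    have "ae_eq L (ext f) (ext g)"
      using eq AE_space[of M] unfolding ae_eq_def
      by eventually_elim (use f g in \<open>auto simp: apply_ext\<close>)
    then show "J (ext f) y = J (ext g) y"
      using y by (simp add: apply_J integral_cong_ae_eq continuous_imp_integrable_real)
  qed auto
  then have "ext f = ext g" by (rule J_eqD[OF clamped_ext[OF f] clamped_ext[OF g]])
  then have "ext f x = ext g x" by simp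
  then show ?thesis using x f g by (simp add: apply_ext)
qed

lemma cont_rep_eq:
  assumes f: "continuous_on {-L..L} f" and eq: "ae_eq L f v"
  shows "continuous_on {-L..L} (cont_rep L v)" "ae_eq L (cont_rep L v) v"
    "x \<in> {-L..L} \<Longrightarrow> cont_rep L v x = f x"
proof -
  have *: "continuous_on {-L..L} (cont_rep L v) \<and> ae_eq L (cont_rep L v) v"
    unfolding cont_rep_def by (rule someI[of _ f]) (use assms in simp)
  then show "continuous_on {-L..L} (cont_rep L v)" "ae_eq L (cont_rep L v) v" by auto
  show "cont_rep L v x = f x" if "x \<in> {-L..L}"
    by (rule ae_eq_continuous_imp_eq[OF conjunct1[OF *] f
          ae_eq_trans[OF conjunct2[OF *] ae_eq_sym[OF eq]] that])
qed

lemma weak_deriv_cont_rep: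
  assumes v: "has_weak_deriv L v g"
  shows "continuous_on {-L..L} (cont_rep L v)" "ae_eq L (cont_rep L v) v"
    "x \<in> {-L..L} \<Longrightarrow> cont_rep L v x = cont_rep L v (-L) + integral {-L..x} g"
proof -
  obtain C where C: "ae_eq L v (\<lambda>x. C + integral {-L..x} g)"
    using weak_deriv_primitive[OF v] .
  have cont: "continuous_on {-L..L} (\<lambda>x. C + integral {-L..x} g)"
    by (intro continuous_intros primitive_continuous has_weak_derivD[OF v])
  note * = cont_rep_eq[OF cont ae_eq_sym[OF C]]
  show "continuous_on {-L..L} (cont_rep L v)" "ae_eq L (cont_rep L v) v" by (rule *)+
  show "cont_rep L v x = cont_rep L v (-L) + integral {-L..x} g" if "x \<in> {-L..L}"
    using *(3)[OF that] *(3)[of "-L"] L_pos by simp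
qed

lemma LINT_mult_cong_ae_eq:
  assumes "ae_eq L f g" and [measurable]: "f \<in> borel_measurable M" "g \<in> borel_measurable M" "h \<in> borel_measurable M"
  shows "(LINT x|M. f x * h x) = (LINT x|M. g x * h x)"
proof (rule integral_cong_AE)
  show "AE x in M. f x * h x = g x * h x"
    using assms(1) unfolding ae_eq_def by eventually_elim simp
qed measurable

text \<open>Since \<open>weak_deriv\<close> picks an arbitrary representative, every argument has to
  be free to change functions on null sets.\<close>

lemma has_weak_deriv_cong:
  assumes v: "has_weak_deriv L v g" and "v' \<in> L2_space L" "g' \<in> L2_space L"
    and "ae_eq L v v'" "ae_eq L g g'"
  shows "has_weak_deriv L v' g'"
  unfolding has_weak_deriv_def
proof (intro conjI ballI assms)
  fix \<phi> assume \<phi>: "\<phi> \<in> test_functions L"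
  have m: "\<phi> \<in> borel_measurable M" "deriv \<phi> \<in> borel_measurable M"
    by (rule continuous_measurable_M, rule test_function_continuous[OF \<phi>])+
  note L2 = L2_measurable[OF assms(2)] L2_measurable[OF assms(3)]
    L2_measurable[OF has_weak_derivD(1)[OF v]] L2_measurable[OF has_weak_derivD(2)[OF v]]
  have "(LINT x|M. v x * deriv \<phi> x) = (LINT x|M. v' x * deriv \<phi> x)"
    by (rule LINT_mult_cong_ae_eq[OF assms(4) L2(3) L2(1) m(2)])
  moreover have "(LINT x|M. g x * \<phi> x) = (LINT x|M. g' x * \<phi> x)"
    by (rule LINT_mult_cong_ae_eq[OF assms(5) L2(4) L2(2) m(1)])
  ultimately show "(LINT x|M. v' x * deriv \<phi> x) = - (LINT x|M. g' x * \<phi> x)"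
    using has_weak_derivD(5)[OF v \<phi>] by simp
qed

lemma has_weak_deriv_add:
  assumes v: "has_weak_deriv L v g" and v': "has_weak_deriv L v' g'"
  shows "has_weak_deriv L (\<lambda>x. v x + v' x) (\<lambda>x. g x + g' x)"
  unfolding has_weak_deriv_def
proof (intro conjI ballI L2_add has_weak_derivD[OF v] has_weak_derivD[OF v'])
  fix \<phi> assume \<phi>: "\<phi> \<in> test_functions L"
  note c = test_function_continuous[OF \<phi>, of "{-L..L}"]
  show "(LINT x|M. (v x + v' x) * deriv \<phi> x) = - (LINT x|M. (g x + g' x) * \<phi> x)"
    using has_weak_derivD(5)[OF v \<phi>] has_weak_derivD(5)[OF v' \<phi>]
      integrable_mult_continuous_M[OF has_weak_derivD(3)[OF v] c(2)]
      integrable_mult_continuous_M[OF has_weak_derivD(3)[OF v'] c(2)]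
      integrable_mult_continuous_M[OF has_weak_derivD(4)[OF v] c(1)]
      integrable_mult_continuous_M[OF has_weak_derivD(4)[OF v'] c(1)]
    by (simp add: distrib_right)
qed

lemma has_weak_deriv_cmult:
  assumes v: "has_weak_deriv L v g"
  shows "has_weak_deriv L (\<lambda>x. c * v x) (\<lambda>x. c * g x)"
  unfolding has_weak_deriv_def
proof (intro conjI ballI L2_cmult has_weak_derivD[OF v])
  fix \<phi> assume \<phi>: "\<phi> \<in> test_functions L"
  show "(LINT x|M. (c * v x) * deriv \<phi> x) = - (LINT x|M. (c * g x) * \<phi> x)"
    using has_weak_derivD(5)[OF v \<phi>] by (simp add: mult.assoc)
qed

lemma has_weak_deriv_diff:
  "has_weak_deriv L v g \<Longrightarrow> has_weak_deriv L v' g' \<Longrightarrow>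
   has_weak_deriv L (\<lambda>x. v x - v' x) (\<lambda>x. g x - g' x)"
  using has_weak_deriv_add[of v g "\<lambda>x. (-1) * v' x" "\<lambda>x. (-1) * g' x"]
    has_weak_deriv_cmult[of v' g' "-1"] by simp

lemma has_weak_deriv_J: "has_weak_deriv L (J p) p"
  unfolding has_weak_deriv_def
proof (intro conjI ballI L2_continuous)
  fix \<phi> assume \<phi>: "\<phi> \<in> test_functions L"
  have "(LINT x|M. J p x * deriv \<phi> x) = (LINT x|M. integral {-L..x} p * deriv \<phi> x)"
    by (intro Bochner_Integration.integral_cong) (auto simp: apply_J)
  then show "(LINT x|M. J p x * deriv \<phi> x) = - (LINT x|M. p x * \<phi> x)"
    using primitive_by_parts[OF _ \<phi>, of p] by (simp add: continuous_imp_integrable_real)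
qed auto

lemma has_weak_deriv_const: "has_weak_deriv L (\<lambda>_. c) (\<lambda>_. 0)"
  unfolding has_weak_deriv_def
proof (intro conjI ballI L2_continuous)
  fix \<phi> assume \<phi>: "\<phi> \<in> test_functions L"
  obtain s t where st: "-L < s" "t < L" "\<And>x. x \<notin> {s..t} \<Longrightarrow> \<phi> x = 0"
    and der: "\<And>x. (\<phi> has_real_derivative deriv \<phi> x) (at x)"
    and cont: "continuous_on UNIV (deriv \<phi>)"
    using test_functionE[OF \<phi>] by metis
  have "(LINT x|M. deriv \<phi> x) = integral {-L..L} (deriv \<phi>)"
    using cont by (intro lebesgue_integral_eq_integral continuous_imp_integrable_real)
      (auto intro: continuous_on_subset)
  also have "\<dots> = \<phi> L - \<phi> (-L)"
    using L_pos der by (intro integral_unique fundamental_theorem_of_calculus)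
        (auto simp: has_real_derivative_iff_has_vector_derivative intro: has_vector_derivative_at_within)
  finally have "(LINT x|M. deriv \<phi> x) = 0" using st by simp
  then show "(LINT x|M. c * deriv \<phi> x) = - (LINT x|M. 0 * \<phi> x)" by simp
qed auto

text \<open>The difference \<open>h\<close> is a weak derivative of 0. Its primitive then equals the
  continuous representative of 0, so all integrals of \<open>h\<close> over initial segments vanish,
  and with them the tail integrals.\<close>

lemma has_weak_deriv_unique:
  assumes "has_weak_deriv L v g" "has_weak_deriv L v g'"
  shows "ae_eq L g g'"
proof -
  define h where "h x = g x - g' x" for x
  have wd: "has_weak_deriv L (\<lambda>_. 0) h"
    using has_weak_deriv_diff[OF assms] by (simp add: h_def[abs_def])
  note h = has_weak_derivD[OF wd]
  have cr: "cont_rep L (\<lambda>_. 0) x = 0" if "x \<in> {-L..L}" for x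
    using cont_rep_eq(3)[of "\<lambda>_. 0" "\<lambda>_. 0" x] that by (simp add: ae_eqI)
  have zero: "integral {-L..x} h = 0" if "x \<in> {-L..L}" for x
    using weak_deriv_cont_rep(3)[OF wd that] cr[OF that] cr[of "-L"] L_pos by simp
  have "AE x in M. h x = 0"
  proof (rule AE_zero_of_tail_integrals_zero_M[OF h(4)])
    fix a
    have [measurable]: "(indicator {..c} :: real \<Rightarrow> real) \<in> borel_measurable M" for c
      by (auto intro!: borel_measurable_M_borel)
    have int: "integrable M (\<lambda>x. indicator {..c} x * h x)" for c
    proof (rule Bochner_Integration.integrable_bound[OF h(4)])
      show "(\<lambda>x. indicator {..c} x * h x) \<in> borel_measurable M"
        using h(4) by (intro borel_measurable_times) auto
    qed (auto simp: indicator_def)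
    \<comment> \<open>The threshold is moved into [-L,L]. For \<open>x\<close> in the interval other
      than \<open>-L\<close>, the conditions \<open>x \<le> a\<close> and \<open>x \<le> c\<close>
      are equivalent.\<close>
    define c where "c = clip a"
    have LL: "(LINT x|M. indicator {..L} x * h x) = 0"
      using integral_eq_LINT_indicator_left[OF h(4), of L] zero[of L] L_pos by simp
    have cc: "(LINT x|M. indicator {..c} x * h x) = 0"
      using integral_eq_LINT_indicator_left[OF h(4), of c] zero[of c] by (simp add: c_def)
    have "AE x in lebesgue. x \<noteq> -L"
      by (auto simp: AE_completion_iff AE_lborel_singleton)
    then have ne: "AE x in M. x \<noteq> - L"
      by (subst AE_restrict_space_iff) auto
    have "(LINT x|M. indicator {a<..} x * h x) = (LINT x|M. indicator {..L} x * h x - indicator {..c} x * h x)"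
    proof (rule integral_cong_AE)
      show "AE x in M. indicator {a<..} x * h x = indicator {..L} x * h x - indicator {..c} x * h x"
        using ne AE_space
      proof eventually_elim
        case (elim x)
        then have "x \<le> c \<longleftrightarrow> x \<le> a" unfolding c_def clip_def space_M atLeastAtMost_iff by linarith
        then show ?case using elim by (simp add: indicator_def)
      qed
      show "(\<lambda>x. indicator {a<..} x * h x) \<in> borel_measurable M"
        by (intro borel_measurable_times borel_measurable_integrable[OF h(4)])
          (rule borel_measurable_M_borel, simp)
      show "(\<lambda>x. indicator {..L} x * h x - indicator {..c} x * h x) \<in> borel_measurable M"
        by (intro borel_measurable_diff borel_measurable_integrable[OF int])
    qed
    then show "(LINT x|M. indicator {a<..} x * h x) = 0"
      by (simp add: LL cc Bochner_Integration.integral_diff[OF int int])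
  qed
  then show ?thesis unfolding ae_eq_def h_def by eventually_elim simp
qed

lemma has_weak_deriv_weak_deriv:
  assumes "has_weak_deriv L v g"
  shows "has_weak_deriv L v (weak_deriv L v)" "ae_eq L (weak_deriv L v) g"
proof -
  show "has_weak_deriv L v (weak_deriv L v)"
    unfolding weak_deriv_def by (rule someI[of "has_weak_deriv L v", OF assms])
  then show "ae_eq L (weak_deriv L v) g" by (rule has_weak_deriv_unique[OF _ assms])
qed

section \<open>Sobolev norms of orders one and two, and the embedding into continuous
  functions\<close>

lemma sobolev_1_iff: "v \<in> sobolev L 1 \<longleftrightarrow> (\<exists>g. has_weak_deriv L v g)"
  unfolding One_nat_def sobolev.simps has_weak_deriv_def by blast

lemma sobolev_2_iff: "v \<in> sobolev L 2 \<longleftrightarrow> (\<exists>g h. has_weak_deriv L v g \<and> has_weak_deriv L g h)"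
  unfolding numeral_2_eq_2 sobolev.simps has_weak_deriv_def by blast

lemma sobolev_norm_1: "(sobolev_norm L 1 v)\<^sup>2 = (L2_norm L v)\<^sup>2 + (L2_norm L (weak_deriv L v))\<^sup>2"
  unfolding sobolev_norm_def by (subst real_sqrt_pow2; simp)

lemma sobolev_norm_2:
  "(sobolev_norm L 2 v)\<^sup>2 = (L2_norm L v)\<^sup>2 + (sobolev_norm L 1 (weak_deriv L v))\<^sup>2"
  unfolding sobolev_norm_1 unfolding sobolev_norm_def
  by (subst real_sqrt_pow2; simp add: numeral_2_eq_2 sum_nonneg)

lemma sobolev_norm_nonneg: "0 \<le> sobolev_norm L s v"
  unfolding sobolev_norm_def by (simp add: sum_nonneg)

text \<open>The oscillation of the representative \<open>c\<close> is at most the integral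
  \<open>A\<close> of \<open>\<bar>g\<bar>\<close>. Averaging
  \<open>(c x)\<^sup>2 \<le> 2 * (c y)\<^sup>2 + 2 * A\<^sup>2\<close> over \<open>y\<close> gives
  the summand \<open>1 / L\<close>; the bound on \<open>A\<^sup>2\<close> gives
  \<open>4 * L\<close>. Convergence in H^1 thus implies uniform convergence.\<close>

theorem sobolev_embedding:
  assumes v: "has_weak_deriv L v g" and x: "x \<in> {-L..L}"
  shows "\<bar>cont_rep L v x\<bar> \<le> sqrt (1 / L + 4 * L) * sobolev_norm L 1 v"
proof -
  note v' = has_weak_derivD[OF v]
  define c where "c = cont_rep L v"
  note c = weak_deriv_cont_rep[OF v, folded c_def]
  define A where "A = (LINT y|M. \<bar>g y\<bar>)"
  have meas: "measure M (space M) = 2 * L"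
    using L_pos by (simp add: measure_restrict_space)
  \<comment> \<open>The Cauchy-Schwarz inequality against the constant 1, obtained by expanding the
    nonnegative variance of \<open>\<bar>g\<bar>\<close> about its mean
    \<open>A / (2 * L)\<close>.\<close>
  have A2: "A\<^sup>2 \<le> 2 * L * (L2_norm L g)\<^sup>2"
  proof -
    have "0 \<le> (LINT y|M. (\<bar>g y\<bar> - A / (2 * L))\<^sup>2)" by simp
    also have "(LINT y|M. (\<bar>g y\<bar> - A / (2 * L))\<^sup>2) =
      (LINT y|M. ((g y)\<^sup>2 - 2 * (A / (2 * L)) * \<bar>g y\<bar>) + (A / (2 * L))\<^sup>2)"
      by (intro Bochner_Integration.integral_cong) (auto simp: power2_diff)
    also have "\<dots> = (L2_norm L g)\<^sup>2 - 2 * (A / (2 * L)) * A + (A / (2 * L))\<^sup>2 * (2 * L)"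
      using v' meas by (simp add: L2_norm_power2 A_def L2_space_def)
    finally show ?thesis using L_pos by (simp add: field_simps power2_eq_square)
  qed
  have diff: "\<bar>c x - c y\<bar> \<le> A" if y: "y \<in> {-L..L}" for y
  proof -
    have *: "\<bar>c z - c w\<bar> \<le> A" if "w \<le> z" "w \<in> {-L..L}" "z \<in> {-L..L}" for w z
    proof -
      have gi: "g integrable_on {-L..L}" by (intro integrable_on_lebesgue_on v') simp
      have gn: "(\<lambda>y. \<bar>g y\<bar>) integrable_on {-L..L}"
        using v' by (intro integrable_on_lebesgue_on) auto
      have sub: "{w..z} \<subseteq> {-L..L}" using that by auto
      have "integral {-L..w} g + integral {w..z} g = integral {-L..z} g"
        using that by (intro Henstock_Kurzweil_Integration.integral_combine
            integrable_subinterval_real[OF gi]) auto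
      then have "\<bar>c z - c w\<bar> = norm (integral {w..z} g)"
        using c(3)[OF that(2)] c(3)[OF that(3)] unfolding real_norm_def by linarith
      also have "\<dots> \<le> integral {w..z} (\<lambda>y. \<bar>g y\<bar>)"
        by (rule integral_norm_bound_integral)
          (use integrable_subinterval_real[OF gi sub] integrable_subinterval_real[OF gn sub] in auto)
      also have "\<dots> \<le> integral {-L..L} (\<lambda>y. \<bar>g y\<bar>)"
        by (rule integral_subset_le[OF sub integrable_subinterval_real[OF gn sub] gn]) auto
      also have "\<dots> = A"
        unfolding A_def using v' by (intro lebesgue_integral_eq_integral[symmetric]) auto
      finally show ?thesis .
    qed
    show ?thesis
      using *[of x y] *[of y x] x y by (cases "x \<le> y") auto
  qed
  have "2 * L * (c x)\<^sup>2 = (LINT y|M. (c x)\<^sup>2)" using meas by simp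
  also have "\<dots> \<le> (LINT y|M. 2 * (c y)\<^sup>2 + 2 * A\<^sup>2)"
  proof (rule integral_mono)
    show "integrable M (\<lambda>y. 2 * (c y)\<^sup>2 + 2 * A\<^sup>2)"
      using c(1) by (intro continuous_imp_integrable_real continuous_intros)
    fix y assume "y \<in> space M"
    then have "(c x - c y)\<^sup>2 \<le> A\<^sup>2" using diff[of y] by (intro abs_le_square_iff[THEN iffD1]) auto
    moreover have "(c x)\<^sup>2 \<le> 2 * (c y)\<^sup>2 + 2 * (c x - c y)\<^sup>2"
      using zero_le_power2[of "c x - 2 * c y"] by (simp add: power2_eq_square algebra_simps)
    ultimately show "(c x)\<^sup>2 \<le> 2 * (c y)\<^sup>2 + 2 * A\<^sup>2" by linarith
  qed simp
  also have "\<dots> = 2 * (L2_norm L c)\<^sup>2 + 4 * L * A\<^sup>2"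
    using L2_continuous[OF c(1)] meas by (simp add: L2_norm_power2 L2_space_def)
  also have "L2_norm L c = L2_norm L v"
    using L2_norm_cong[OF L2_continuous[OF c(1)] v'(1) c(2)] .
  finally have "(c x)\<^sup>2 \<le> (L2_norm L v)\<^sup>2 / L + 2 * A\<^sup>2"
    using L_pos by (simp add: field_simps)
  also have "\<dots> \<le> (L2_norm L v)\<^sup>2 / L + 4 * L * (L2_norm L g)\<^sup>2" using A2 by simp
  also have "\<dots> \<le> (1 / L + 4 * L) * ((L2_norm L v)\<^sup>2 + (L2_norm L g)\<^sup>2)"
    using L_pos by (simp add: algebra_simps)
  also have "L2_norm L g = L2_norm L (weak_deriv L v)"
    using has_weak_deriv_weak_deriv[OF v] v'(2) has_weak_derivD(2)
    by (intro L2_norm_cong) (auto intro: ae_eq_sym)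
  finally have "(c x)\<^sup>2 \<le> (1 / L + 4 * L) * (sobolev_norm L 1 v)\<^sup>2"
    by (simp only: sobolev_norm_1)
  then have "sqrt ((c x)\<^sup>2) \<le> sqrt ((1 / L + 4 * L) * (sobolev_norm L 1 v)\<^sup>2)"
    by (rule real_sqrt_le_mono)
  then show ?thesis by (simp add: c_def real_sqrt_mult sobolev_norm_nonneg)
qed

section \<open>The Green kernels\<close>

lemma piecewise_kernel_measurable:
  fixes k A B :: "real \<Rightarrow> real"
  assumes A: "continuous_on {-L..L} A" and B: "continuous_on {-L..L} B"
    and k: "\<And>\<xi>. \<xi> < x \<Longrightarrow> k \<xi> = A \<xi>" "\<And>\<xi>. x < \<xi> \<Longrightarrow> k \<xi> = B \<xi>"
  shows "k \<in> borel_measurable M"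
proof -
  have [measurable]: "A \<in> borel_measurable M" "B \<in> borel_measurable M"
    by (intro continuous_measurable_M A B)+
  \<comment> \<open>The kernel is known only off the diagonal; its value at the kink is kept as the
    unknown constant \<open>k x\<close>.\<close>
  have "k = (\<lambda>\<xi>. if \<xi> < x then A \<xi> else if x < \<xi> then B \<xi> else k x)"
    using k by (auto simp: fun_eq_iff not_less)
  moreover have "(\<lambda>\<xi>. if \<xi> < x then A \<xi> else if x < \<xi> then B \<xi> else k x) \<in> borel_measurable M"
    by measurable
  ultimately show ?thesis by simp
qed

lemma piecewise_kernel_integral:
  fixes k A B f :: "real \<Rightarrow> real"
  assumes A: "continuous_on {-L..L} A" and B: "continuous_on {-L..L} B"
    and k: "\<And>\<xi>. \<xi> < x \<Longrightarrow> k \<xi> = A \<xi>" "\<And>\<xi>. x < \<xi> \<Longrightarrow> k \<xi> = B \<xi>"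
    and f: "continuous_on {-L..L} f" and x: "x \<in> {-L..L}"
  shows "(LINT \<xi>|M. k \<xi> * f \<xi>) =
    integral {-L..x} (\<lambda>\<xi>. A \<xi> * f \<xi>) + integral {x..L} (\<lambda>\<xi>. B \<xi> * f \<xi>)"
proof -
  have Af: "integrable M (\<lambda>\<xi>. A \<xi> * f \<xi>)" and Bf: "integrable M (\<lambda>\<xi>. B \<xi> * f \<xi>)"
    by (intro continuous_imp_integrable_real continuous_intros A B f)+
  have ind: "integrable M (\<lambda>\<xi>. indicator S \<xi> * g \<xi>)"
    if g: "integrable M g" and S: "S \<in> sets borel" for g :: "real \<Rightarrow> real" and S
  proof (rule Bochner_Integration.integrable_bound[OF g])
    have [measurable]: "(indicator S :: real \<Rightarrow> real) \<in> borel_measurable M" "g \<in> borel_measurable M"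
      using S g by (auto intro!: borel_measurable_M_borel)
    show "(\<lambda>\<xi>. indicator S \<xi> * g \<xi>) \<in> borel_measurable M" by measurable
  qed (simp add: indicator_def)
  note iA = ind[OF Af, of "{..x}", simplified] and iB = ind[OF Bf, of "{x..}", simplified]
  have "AE \<xi> in lebesgue. \<xi> \<noteq> x"
    by (auto simp: AE_completion_iff AE_lborel_singleton)
  then have ne: "AE \<xi> in M. \<xi> \<noteq> x"
    by (subst AE_restrict_space_iff) auto
  have "(LINT \<xi>|M. k \<xi> * f \<xi>) =
      (LINT \<xi>|M. indicator {..x} \<xi> * (A \<xi> * f \<xi>) + indicator {x..} \<xi> * (B \<xi> * f \<xi>))"
  proof (rule integral_cong_AE)
    show "(\<lambda>\<xi>. k \<xi> * f \<xi>) \<in> borel_measurable M"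
      by (intro borel_measurable_times piecewise_kernel_measurable[OF A B k] continuous_measurable_M f)
    show "(\<lambda>\<xi>. indicator {..x} \<xi> * (A \<xi> * f \<xi>) + indicator {x..} \<xi> * (B \<xi> * f \<xi>)) \<in> borel_measurable M"
      using iA iB by (intro borel_measurable_add borel_measurable_integrable) 
    show "AE \<xi> in M. k \<xi> * f \<xi> = indicator {..x} \<xi> * (A \<xi> * f \<xi>) + indicator {x..} \<xi> * (B \<xi> * f \<xi>)"
      using ne
    proof eventually_elim
      case (elim \<xi>)
      then consider "\<xi> < x" | "x < \<xi>" by linarith
      then show ?case by cases (simp_all add: k)
    qed
  qed
  also have "\<dots> = (LINT \<xi>|M. indicator {..x} \<xi> * (A \<xi> * f \<xi>)) + (LINT \<xi>|M. indicator {x..} \<xi> * (B \<xi> * f \<xi>))"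
    by (rule Bochner_Integration.integral_add[OF iA iB])
  also have "\<dots> = integral {-L..x} (\<lambda>\<xi>. A \<xi> * f \<xi>) + integral {x..L} (\<lambda>\<xi>. B \<xi> * f \<xi>)"
    using integral_eq_LINT_indicator_left[OF Af x] integral_eq_LINT_indicator_right[OF Bf x] by simp
  finally show ?thesis .
qed

text \<open>The Wronskian in the Green's function is \<open>- \<beta> * S \<beta>\<close>, and
  \<open>1 / b = \<beta>\<^sup>2\<close>. The extra factor \<open>1 / sqrt b\<close> is the one
  produced by differentiating the kernel in \<xi>.\<close>

lemma green_scaling:
  assumes "0 < b" "\<beta> = 1 / sqrt b" "0 < S \<beta>"
  shows "- (1 / (b * (- (1 / sqrt b) * sinh (2 * L / sqrt b)))) * (1 / sqrt b) = \<beta>\<^sup>2 / S \<beta>"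
proof -
  have Sh: "sinh (2 * L / sqrt b) = S \<beta>" using assms by (simp add: S_def)
  have "b * sqrt b \<noteq> 0" "b = sqrt b * sqrt b" using assms(1) by simp_all
  then show ?thesis
    using assms(3) unfolding Sh unfolding assms(2)
    by (simp add: power2_eq_square divide_simps)
qed

lemma deriv_green_N:
  assumes b: "0 < b" and \<beta>: "\<beta> = 1 / sqrt b"
  shows "\<xi> < x \<Longrightarrow> deriv (green_N L b x) \<xi> =
      \<beta>\<^sup>2 / S \<beta> * (cosh (\<beta> * (L - x)) * sinh (\<beta> * (L + \<xi>)))"
    and "x < \<xi> \<Longrightarrow> deriv (green_N L b x) \<xi> =
      \<beta>\<^sup>2 / S \<beta> * (- cosh (\<beta> * (L + x)) * sinh (\<beta> * (L - \<xi>)))"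
proof -
  define K where "K = - (1 / (b * (- (1 / sqrt b) * sinh (2 * L / sqrt b))))"
  have K: "K * \<beta> = \<beta>\<^sup>2 / S \<beta>"
    using green_scaling[OF b \<beta>] S_pos b by (simp add: K_def \<beta>)
  have G: "green_N L b x \<xi> = (if \<xi> \<le> x then K * (cosh (\<beta> * (L + \<xi>)) * cosh (\<beta> * (L - x)))
      else K * (cosh (\<beta> * (L + x)) * cosh (\<beta> * (L - \<xi>))))" for \<xi>
    by (simp add: green_N_def Let_def K_def \<beta>)
  show "deriv (green_N L b x) \<xi> = \<beta>\<^sup>2 / S \<beta> * (cosh (\<beta> * (L - x)) * sinh (\<beta> * (L + \<xi>)))"
    if "\<xi> < x"
  proof -
    have "((\<lambda>\<xi>. K * (cosh (\<beta> * (L + \<xi>)) * cosh (\<beta> * (L - x)))) has_real_derivative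
        (K * \<beta>) * (cosh (\<beta> * (L - x)) * sinh (\<beta> * (L + \<xi>)))) (at \<xi>)"
      by (auto intro!: derivative_eq_intros)
    then have "(green_N L b x has_real_derivative
        (K * \<beta>) * (cosh (\<beta> * (L - x)) * sinh (\<beta> * (L + \<xi>)))) (at \<xi>)"
      by (rule has_field_derivative_transform_within_open[of _ _ _ "{..<x}"]) (use that in \<open>auto simp: G\<close>)
    then show ?thesis unfolding K by (rule DERIV_imp_deriv)
  qed
  show "deriv (green_N L b x) \<xi> = \<beta>\<^sup>2 / S \<beta> * (- cosh (\<beta> * (L + x)) * sinh (\<beta> * (L - \<xi>)))"
    if "x < \<xi>"
  proof -
    have "((\<lambda>\<xi>. K * (cosh (\<beta> * (L + x)) * cosh (\<beta> * (L - \<xi>)))) has_real_derivative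
        (K * \<beta>) * (- cosh (\<beta> * (L + x)) * sinh (\<beta> * (L - \<xi>)))) (at \<xi>)"
      by (auto intro!: derivative_eq_intros)
    then have "(green_N L b x has_real_derivative
        (K * \<beta>) * (- cosh (\<beta> * (L + x)) * sinh (\<beta> * (L - \<xi>)))) (at \<xi>)"
      by (rule has_field_derivative_transform_within_open[of _ _ _ "{x<..}"]) (use that in \<open>auto simp: G\<close>)
    then show ?thesis unfolding K by (rule DERIV_imp_deriv)
  qed
qed

lemma deriv_green_D:
  assumes d: "0 < d" and \<beta>: "\<beta> = 1 / sqrt d"
  shows "\<xi> < x \<Longrightarrow> deriv (green_D L d x) \<xi> =
      \<beta>\<^sup>2 / S \<beta> * (sinh (\<beta> * (L - x)) * cosh (\<beta> * (L + \<xi>)))"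
    and "x < \<xi> \<Longrightarrow> deriv (green_D L d x) \<xi> =
      \<beta>\<^sup>2 / S \<beta> * (- sinh (\<beta> * (L + x)) * cosh (\<beta> * (L - \<xi>)))"
proof -
  define K where "K = - (1 / (d * (- (1 / sqrt d) * sinh (2 * L / sqrt d))))"
  have K: "K * \<beta> = \<beta>\<^sup>2 / S \<beta>"
    using green_scaling[OF d \<beta>] S_pos d by (simp add: K_def \<beta>)
  have G: "green_D L d x \<xi> = (if \<xi> \<le> x then K * (sinh (\<beta> * (L + \<xi>)) * sinh (\<beta> * (L - x)))
      else K * (sinh (\<beta> * (L + x)) * sinh (\<beta> * (L - \<xi>))))" for \<xi>
    by (simp add: green_D_def Let_def K_def \<beta>)
  show "deriv (green_D L d x) \<xi> = \<beta>\<^sup>2 / S \<beta> * (sinh (\<beta> * (L - x)) * cosh (\<beta> * (L + \<xi>)))"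
    if "\<xi> < x"
  proof -
    have "((\<lambda>\<xi>. K * (sinh (\<beta> * (L + \<xi>)) * sinh (\<beta> * (L - x)))) has_real_derivative
        (K * \<beta>) * (sinh (\<beta> * (L - x)) * cosh (\<beta> * (L + \<xi>)))) (at \<xi>)"
      by (auto intro!: derivative_eq_intros)
    then have "(green_D L d x has_real_derivative
        (K * \<beta>) * (sinh (\<beta> * (L - x)) * cosh (\<beta> * (L + \<xi>)))) (at \<xi>)"
      by (rule has_field_derivative_transform_within_open[of _ _ _ "{..<x}"]) (use that in \<open>auto simp: G\<close>)
    then show ?thesis unfolding K by (rule DERIV_imp_deriv)
  qed
  show "deriv (green_D L d x) \<xi> = \<beta>\<^sup>2 / S \<beta> * (- sinh (\<beta> * (L + x)) * cosh (\<beta> * (L - \<xi>)))"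
    if "x < \<xi>"
  proof -
    have "((\<lambda>\<xi>. K * (sinh (\<beta> * (L + x)) * sinh (\<beta> * (L - \<xi>)))) has_real_derivative
        (K * \<beta>) * (- sinh (\<beta> * (L + x)) * cosh (\<beta> * (L - \<xi>)))) (at \<xi>)"
      by (auto intro!: derivative_eq_intros)
    then have "(green_D L d x has_real_derivative
        (K * \<beta>) * (- sinh (\<beta> * (L + x)) * cosh (\<beta> * (L - \<xi>)))) (at \<xi>)"
      by (rule has_field_derivative_transform_within_open[of _ _ _ "{x<..}"]) (use that in \<open>auto simp: G\<close>)
    then show ?thesis unfolding K by (rule DERIV_imp_deriv)
  qed
qed

lemma apply_bc_mult_abs: "apply_bcontfun (bc_mult f g) = (\<lambda>x. f x * g x)"
  by (simp add: fun_eq_iff)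

lemma integral_bc_mult_left:
  fixes h f :: "real \<Rightarrow>\<^sub>C real"
  assumes "x \<in> {-L..L}" "\<And>\<xi>. \<xi> \<in> {-L..L} \<Longrightarrow> h \<xi> = H \<xi>"
  shows "integral {-L..x} (\<lambda>\<xi>. c * (e * H \<xi>) * f \<xi>) = c * (e * J (bc_mult h f) x)"
proof -
  have "integral {-L..x} (\<lambda>\<xi>. c * (e * H \<xi>) * f \<xi>) = integral {-L..x} (\<lambda>\<xi>. c * (e * (h \<xi> * f \<xi>)))"
    using assms by (intro Henstock_Kurzweil_Integration.integral_cong) (simp add: mult.assoc)
  then show ?thesis using assms(1) by (simp add: apply_J apply_bc_mult_abs)
qed

lemma integral_bc_mult_right:
  fixes h f :: "real \<Rightarrow>\<^sub>C real"
  assumes "x \<in> {-L..L}" "\<And>\<xi>. \<xi> \<in> {-L..L} \<Longrightarrow> h \<xi> = H \<xi>"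
  shows "integral {x..L} (\<lambda>\<xi>. c * (e * H \<xi>) * f \<xi>) = c * (e * Jr (bc_mult h f) x)"
proof -
  have "integral {x..L} (\<lambda>\<xi>. c * (e * H \<xi>) * f \<xi>) = integral {x..L} (\<lambda>\<xi>. c * (e * (h \<xi> * f \<xi>)))"
    using assms by (intro Henstock_Kurzweil_Integration.integral_cong) (simp add: mult.assoc)
  then show ?thesis using assms(1) by (simp add: apply_Jr_integral apply_bc_mult_abs)
qed

text \<open>\<open>f\<close> is any measurable representative of the continuous \<open>g\<close>.
  This generality is needed for uniqueness, where competing solutions are given only up to null
  sets.\<close>

lemma op_N_eq_V_N:
  assumes b: "0 < b" and f: "f \<in> borel_measurable M" "ae_eq L f (apply_bcontfun g)"
    and x: "x \<in> {-L..L}"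
  shows "op_N L b f x = V_N (1 / sqrt b) g x"
proof -
  define \<beta> where "\<beta> = 1 / sqrt b"
  let ?A = "\<lambda>\<xi>. \<beta>\<^sup>2 / S \<beta> * (cosh (\<beta> * (L - x)) * sinh (\<beta> * (L + \<xi>)))"
  let ?B = "\<lambda>\<xi>. \<beta>\<^sup>2 / S \<beta> * (- cosh (\<beta> * (L + x)) * sinh (\<beta> * (L - \<xi>)))"
  note k = deriv_green_N[OF b \<beta>_def, where x = x]
  have A: "continuous_on {-L..L} ?A" and B: "continuous_on {-L..L} ?B"
    by (intro continuous_intros)+
  have "op_N L b f x = (LINT \<xi>|M. f \<xi> * deriv (green_N L b x) \<xi>)"
    by (simp add: op_N_def mult.commute)
  also have "\<dots> = (LINT \<xi>|M. g \<xi> * deriv (green_N L b x) \<xi>)"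
    by (intro LINT_mult_cong_ae_eq f continuous_measurable_M piecewise_kernel_measurable[OF A B k]) auto
  also have "\<dots> = (LINT \<xi>|M. deriv (green_N L b x) \<xi> * g \<xi>)"
    by (simp add: mult.commute)
  also have "\<dots> = integral {-L..x} (\<lambda>\<xi>. ?A \<xi> * g \<xi>) + integral {x..L} (\<lambda>\<xi>. ?B \<xi> * g \<xi>)"
    by (rule piecewise_kernel_integral[OF A B k _ x]) auto
  also have "\<dots> = \<beta>\<^sup>2 / S \<beta> * (cosh (\<beta> * (L - x)) * J (bc_mult (sinh_plus \<beta>) g) x) +
      \<beta>\<^sup>2 / S \<beta> * (- cosh (\<beta> * (L + x)) * Jr (bc_mult (sinh_minus \<beta>) g) x)"
    by (intro arg_cong2[where f = "(+)"] integral_bc_mult_left integral_bc_mult_right x)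
      (simp_all add: apply_hyp)
  also have "\<dots> = V_N \<beta> g x"
    using x by (simp add: V_N_def W_def apply_hyp algebra_simps)
  finally show ?thesis by (simp add: \<beta>_def)
qed

lemma op_D_eq_V_D:
  assumes d: "0 < d" and f: "f \<in> borel_measurable M" "ae_eq L f (apply_bcontfun g)"
    and x: "x \<in> {-L..L}"
  shows "op_D L d f x = V_D (1 / sqrt d) g x"
proof -
  define \<beta> where "\<beta> = 1 / sqrt d"
  let ?A = "\<lambda>\<xi>. \<beta>\<^sup>2 / S \<beta> * (sinh (\<beta> * (L - x)) * cosh (\<beta> * (L + \<xi>)))"
  let ?B = "\<lambda>\<xi>. \<beta>\<^sup>2 / S \<beta> * (- sinh (\<beta> * (L + x)) * cosh (\<beta> * (L - \<xi>)))"
  note k = deriv_green_D[OF d \<beta>_def, where x = x]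
  have A: "continuous_on {-L..L} ?A" and B: "continuous_on {-L..L} ?B"
    by (intro continuous_intros)+
  have "op_D L d f x = (LINT \<xi>|M. f \<xi> * deriv (green_D L d x) \<xi>)"
    by (simp add: op_D_def mult.commute)
  also have "\<dots> = (LINT \<xi>|M. g \<xi> * deriv (green_D L d x) \<xi>)"
    by (intro LINT_mult_cong_ae_eq f continuous_measurable_M piecewise_kernel_measurable[OF A B k]) auto
  also have "\<dots> = (LINT \<xi>|M. deriv (green_D L d x) \<xi> * g \<xi>)"
    by (simp add: mult.commute)
  also have "\<dots> = integral {-L..x} (\<lambda>\<xi>. ?A \<xi> * g \<xi>) + integral {x..L} (\<lambda>\<xi>. ?B \<xi> * g \<xi>)"
    by (rule piecewise_kernel_integral[OF A B k _ x]) auto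
  also have "\<dots> = \<beta>\<^sup>2 / S \<beta> * (sinh (\<beta> * (L - x)) * J (bc_mult (cosh_plus \<beta>) g) x) +
      \<beta>\<^sup>2 / S \<beta> * (- sinh (\<beta> * (L + x)) * Jr (bc_mult (cosh_minus \<beta>) g) x)"
    by (intro arg_cong2[where f = "(+)"] integral_bc_mult_left integral_bc_mult_right x)
      (simp_all add: apply_hyp)
  also have "\<dots> = V_D \<beta> g x"
    using x by (simp add: V_D_def W_def apply_hyp algebra_simps)
  finally show ?thesis by (simp add: \<beta>_def)
qed

section \<open>The evolution equation\<close>

lemma bounded_linear_V:
  "bounded_linear (V_N \<beta>)" "bounded_linear (dV_N \<beta>)" "bounded_linear (V_D \<beta>)" "bounded_linear (rest_D \<beta>)"
  unfolding V_N_def[abs_def] dV_N_def[abs_def] V_D_def[abs_def] rest_D_def[abs_def]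
  by (intro bounded_linear_sub bounded_linear_compose[OF bounded_linear_scaleR_right]
      bounded_linear_W bounded_linear_scaleR_right)+

lemma bounded_linear_dV_D: "bounded_linear (dV_D \<beta>)"
  unfolding dV_D_def[abs_def]
  by (intro bounded_linear_add bounded_linear_scaleR_right bounded_linear_V)

lemma clamped_V:
  "clamped (V_N \<beta> f)" "clamped (V_D \<beta> f)" "clamped (rest_D \<beta> f)"
  unfolding V_N_def V_D_def rest_D_def by (intro clamped_intros clamped_W clamped_hyp)+

text \<open>Half of \<open>u\<^sup>2\<close> is the primitive of \<open>u * u_x\<close>, without a
  constant because \<open>u\<close> vanishes at \<open>-L\<close>. So the nonlinear part of
  \<open>f_D\<close> has a continuous derivative.\<close>

lemma J_square: "(1 / 2) *\<^sub>R bc_mult (J p) (J p) = J (bc_mult (J p) p)"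
proof -
  have "(1 / 2) *\<^sub>R bc_mult (J p) (J p) =
      const_bcontfun (((1 / 2) *\<^sub>R bc_mult (J p) (J p)) (-L)) + J (bc_mult (J p) p)"
  proof (rule eq_const_plus_J)
    show "clamped ((1 / 2) *\<^sub>R bc_mult (J p) (J p))" by (intro clamped_intros clamped_J)
    fix x assume x: "x \<in> {-L..L}"
    have "((\<lambda>x. 1 / 2 * (J p x * J p x)) has_real_derivative bc_mult (J p) p x) (at x within {-L..L})"
      by (rule derivative_eq_intros J_has_derivative[OF x] refl)+ simp
    then show "(apply_bcontfun ((1 / 2) *\<^sub>R bc_mult (J p) (J p)) has_real_derivative bc_mult (J p) p x)
        (at x within {-L..L})"
      by (rule DERIV_transform_within[OF _ x]) simp
  qed
  then show ?thesis by simp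
qed

lemma clamped_integral:
  fixes f :: "real \<Rightarrow> real \<Rightarrow>\<^sub>C real"
  assumes "continuous_on {s..t} f" "\<And>r. r \<in> {s..t} \<Longrightarrow> clamped (f r)"
  shows "clamped (integral {s..t} f)"
  unfolding clamped_def
proof
  fix x
  show "integral {s..t} f (clip x) = integral {s..t} f x"
    unfolding integral_apply_bcontfun[OF assms(1)]
    using assms(2) by (intro Henstock_Kurzweil_Integration.integral_cong) (simp add: clamped_def)
qed

lemma L2_norm_bcontfun: "(L2_norm L (apply_bcontfun f))\<^sup>2 \<le> 2 * L * (norm f)\<^sup>2"
proof -
  have "(L2_norm L f)\<^sup>2 \<le> (LINT x|M. (norm f)\<^sup>2)"
    unfolding L2_norm_power2
  proof (rule integral_mono)
    show "integrable M (\<lambda>x. (f x)\<^sup>2)"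
      using L2_continuous[of "apply_bcontfun f"] by (simp add: L2_space_def)
    show "(f x)\<^sup>2 \<le> (norm f)\<^sup>2" for x
      using power_mono[OF norm_bounded[of f x] norm_ge_zero, of 2] by simp
  qed simp
  also have "\<dots> = 2 * L * (norm f)\<^sup>2" using L_pos by (simp add: measure_restrict_space)
  finally show ?thesis .
qed

text \<open>Computes the norm from any convenient weak derivative and any representative, in place
  of the choice made by \<open>weak_deriv\<close>.\<close>

lemma sobolev_norm_1_eq:
  assumes v: "has_weak_deriv L v g" and v': "v' \<in> L2_space L" "ae_eq L v v'"
  shows "(sobolev_norm L 1 v')\<^sup>2 = (L2_norm L v)\<^sup>2 + (L2_norm L g)\<^sup>2"
proof -
  have "has_weak_deriv L v' g"
    by (rule has_weak_deriv_cong[OF v v'(1) _ v'(2)]) (auto intro: has_weak_derivD[OF v] ae_eqI)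
  note w = has_weak_deriv_weak_deriv[OF this]
  have "L2_norm L (weak_deriv L v') = L2_norm L g"
    by (rule L2_norm_cong[OF has_weak_derivD(2)[OF w(1)] has_weak_derivD(2)[OF v] w(2)])
  moreover have "L2_norm L v = L2_norm L v'"
    by (rule L2_norm_cong[OF has_weak_derivD(1)[OF v] v'])
  ultimately show ?thesis unfolding sobolev_norm_1 by simp
qed

lemma continuous_in_timeI:
  assumes bound: "\<And>r t. r \<in> {0..T} \<Longrightarrow> t \<in> {0..T} \<Longrightarrow>
      sobolev_norm L s (\<lambda>x. v r x - v t x) \<le> K * norm (e r - e t)"
    and e: "continuous_on {0..T} e"
  shows "continuous_in_time L T s v"
  unfolding continuous_in_time_def
proof
  fix t assume t: "t \<in> {0..T}"
  have "(e \<longlongrightarrow> e t) (at t within {0..T})" using e t by (simp add: continuous_on)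
  then have "((\<lambda>r. K * norm (e r - e t)) \<longlongrightarrow> K * norm (e t - e t)) (at t within {0..T})"
    by (intro tendsto_intros)
  then have lim: "((\<lambda>r. K * norm (e r - e t)) \<longlongrightarrow> 0) (at t within {0..T})" by simp
  show "((\<lambda>r. sobolev_norm L s (\<lambda>x. v r x - v t x)) \<longlongrightarrow> 0) (at t within {0..T})"
  proof (rule Lim_null_comparison[OF _ lim])
    show "\<forall>\<^sub>F r in at t within {0..T}. norm (sobolev_norm L s (\<lambda>x. v r x - v t x)) \<le> K * norm (e r - e t)"
      unfolding eventually_at_filter using bound[OF _ t]
      by (intro always_eventually) (simp add: sobolev_norm_nonneg)
  qed
qed

text \<open>The embedding applied to differences \<open>v r - v t\<close>. It is used for \<eta> and
  for \<open>u_x\<close>, to place an arbitrary solution into C[-L,L].\<close>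

lemma continuous_on_ext_cont_rep:
  assumes v: "\<And>t. t \<in> {0..T} \<Longrightarrow> v t \<in> sobolev L 1"
    and lim: "\<And>t. t \<in> {0..T} \<Longrightarrow>
      ((\<lambda>r. sobolev_norm L 1 (\<lambda>x. v r x - v t x)) \<longlongrightarrow> 0) (at t within {0..T})"
  shows "continuous_on {0..T} (\<lambda>t. ext (cont_rep L (v t)))"
  unfolding continuous_on
proof
  fix t assume t: "t \<in> {0..T}"
  define K where "K = sqrt (1 / L + 4 * L)"
  have cr: "continuous_on {-L..L} (cont_rep L (v r))" "ae_eq L (cont_rep L (v r)) (v r)" if "r \<in> {0..T}" for r
    using v[OF that] weak_deriv_cont_rep(1,2) unfolding sobolev_1_iff by blast+
  have bound: "norm (ext (cont_rep L (v r)) - ext (cont_rep L (v t))) \<le>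
      K * sobolev_norm L 1 (\<lambda>x. v r x - v t x)" if r: "r \<in> {0..T}" for r
  proof (rule norm_bound)
    fix x
    obtain g where g: "has_weak_deriv L (\<lambda>x. v r x - v t x) g"
      using v[OF r] v[OF t] has_weak_deriv_diff unfolding sobolev_1_iff by blast
    have "cont_rep L (\<lambda>x. v r x - v t x) (clip x) = cont_rep L (v r) (clip x) - cont_rep L (v t) (clip x)"
      by (rule cont_rep_eq(3)) (intro continuous_intros cr r t ae_eq_diff clip_in)+
    then show "norm ((ext (cont_rep L (v r)) - ext (cont_rep L (v t))) x) \<le>
        K * sobolev_norm L 1 (\<lambda>x. v r x - v t x)"
      using sobolev_embedding[OF g, of "clip x"] cr[OF r] cr[OF t] by (simp add: apply_ext K_def)
  qed
  have "((\<lambda>r. K * sobolev_norm L 1 (\<lambda>x. v r x - v t x)) \<longlongrightarrow> K * 0) (at t within {0..T})"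
    by (intro tendsto_intros lim t)
  then have lim': "((\<lambda>r. K * sobolev_norm L 1 (\<lambda>x. v r x - v t x)) \<longlongrightarrow> 0) (at t within {0..T})" by simp
  have "((\<lambda>r. ext (cont_rep L (v r)) - ext (cont_rep L (v t))) \<longlongrightarrow> 0) (at t within {0..T})"
  proof (rule Lim_null_comparison[OF _ lim'])
    show "\<forall>\<^sub>F r in at t within {0..T}. norm (ext (cont_rep L (v r)) - ext (cont_rep L (v t)))
        \<le> K * sobolev_norm L 1 (\<lambda>x. v r x - v t x)"
      unfolding eventually_at_filter using bound by (intro always_eventually) simp
  qed
  then show "((\<lambda>t. ext (cont_rep L (v t))) \<longlongrightarrow> ext (cont_rep L (v t))) (at t within {0..T})"
    by (rule LIM_zero_cancel)
qed

end

text \<open>\<open>h0\<close> and \<open>p0\<close> stand for the continuous representatives of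
  \<eta>0 and u0', and \<open>g1\<close>, \<open>g2\<close> for their weak derivatives. As
  \<open>J\<close> vanishes at \<open>-L\<close>, the boundary condition on \<open>u0\<close>
  reduces to \<open>J p0 L = 0\<close>.\<close>

locale wave_system = interval +
  fixes a b d :: real and \<eta>0 u0 g1 g2 :: "real \<Rightarrow> real" and h0 p0 :: "real \<Rightarrow>\<^sub>C real"
  assumes b: "0 < b" and d: "0 < d"
    and h0: "clamped h0" "has_weak_deriv L h0 g1" "\<And>x. x \<in> {-L..L} \<Longrightarrow> cont_rep L \<eta>0 x = h0 x"
    and p0: "clamped p0" "has_weak_deriv L p0 g2" "\<And>x. x \<in> {-L..L} \<Longrightarrow> cont_rep L u0 x = J p0 x"
      "J p0 L = 0"
begin

section \<open>The vector field for the continuous unknowns and its lift\<close>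

definition "\<beta> = 1 / sqrt b"
definition "\<gamma> = 1 / sqrt d"

lemma beta_gamma_pos: "0 < \<beta>" "0 < \<gamma>"
  using b d by (simp_all add: \<beta>_def \<gamma>_def)

definition f_N :: "(real \<Rightarrow>\<^sub>C real) \<times> (real \<Rightarrow>\<^sub>C real) \<Rightarrow> real \<Rightarrow>\<^sub>C real" where
  "f_N z = ((a + b) / b) *\<^sub>R J (snd z) + bc_mult (fst z) (J (snd z))"

definition f_D :: "(real \<Rightarrow>\<^sub>C real) \<times> (real \<Rightarrow>\<^sub>C real) \<Rightarrow> real \<Rightarrow>\<^sub>C real" where
  "f_D z = fst z + (1 / 2) *\<^sub>R bc_mult (J (snd z)) (J (snd z))"

text \<open>The pair \<open>z\<close> stands for $(\eta, u_x)$.\<close>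

definition F :: "(real \<Rightarrow>\<^sub>C real) \<times> (real \<Rightarrow>\<^sub>C real) \<Rightarrow> (real \<Rightarrow>\<^sub>C real) \<times> (real \<Rightarrow>\<^sub>C real)" where
  "F z = (V_N \<beta> (f_N z) + (a / b) *\<^sub>R snd z, dV_D \<gamma> (f_D z))"

text \<open>
  The argument \<open>(c1, c2, k, y)\<close> of \<open>embed\<close> makes the weak derivative visible: it is
  \<open>c1 g1 + c2 g2 + y\<close>.
\<close>

definition embed :: "real \<times> real \<times> real \<times> (real \<Rightarrow>\<^sub>C real) \<Rightarrow> real \<Rightarrow>\<^sub>C real" where
  "embed e = fst e *\<^sub>R h0 + fst (snd e) *\<^sub>R p0 + const_bcontfun (fst (snd (snd e))) + J (snd (snd (snd e)))"

definition "embed2 w = (embed (fst w), embed (snd w))"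

text \<open>Terms that gain no derivative, \<open>(a / b) * u_x\<close> and
  \<open>\<gamma>\<^sup>2 * \<eta>\<close>, act directly on the coordinates of the other unknown.
  All others enter by their value at \<open>-L\<close> and their continuous derivative:
  \<open>dV_N\<close> for \<open>V_N\<close>, \<open>\<gamma>\<^sup>2 * V_D\<close> for
  \<open>rest_D\<close>, and \<open>\<gamma>\<^sup>2 * u * u_x\<close> for
  \<open>\<gamma>\<^sup>2 * u\<^sup>2 / 2\<close>, whose value at \<open>-L\<close> is 0.\<close>

definition "lifted_F w =
  (let z = embed2 w in
    ((a / b) *\<^sub>R snd w + (0, 0, V_N \<beta> (f_N z) (-L), dV_N \<beta> (f_N z)),
     \<gamma>\<^sup>2 *\<^sub>R fst w + (0, 0, rest_D \<gamma> (f_D z) (-L),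
        \<gamma>\<^sup>2 *\<^sub>R bc_mult (J (snd z)) (snd z) + \<gamma>\<^sup>2 *\<^sub>R V_D \<gamma> (f_D z))))"

lemma bounded_linear_embed: "bounded_linear embed"
  unfolding embed_def[abs_def]
  by (intro bounded_linear_add bounded_linear_compose[OF bounded_linear_scaleR_left]
      bounded_linear_compose[OF bounded_linear_const_bcontfun] bounded_linear_compose[OF bounded_linear_J]
      bounded_linear_fst bounded_linear_snd
      bounded_linear_compose[OF bounded_linear_fst bounded_linear_snd]
      bounded_linear_compose[OF bounded_linear_fst bounded_linear_compose[OF bounded_linear_snd bounded_linear_snd]]
      bounded_linear_compose[OF bounded_linear_snd bounded_linear_compose[OF bounded_linear_snd bounded_linear_snd]])

lemma bounded_linear_embed2: "bounded_linear embed2"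
  unfolding embed2_def[abs_def]
  by (intro bounded_linear_Pair bounded_linear_compose[OF bounded_linear_embed]
      bounded_linear_fst bounded_linear_snd)

lemmas lipschitz_intros = lipschitz_on_balls_add lipschitz_on_balls_Pair
  lipschitz_on_balls_bilinear[OF bounded_bilinear_bc_mult]
  lipschitz_on_balls_linear[OF bounded_linear_fst] lipschitz_on_balls_linear[OF bounded_linear_snd]
  lipschitz_on_balls_linear_compose[OF bounded_linear_scaleR_right]
  lipschitz_on_balls_linear_compose[OF bounded_linear_J]
  lipschitz_on_balls_linear_compose[OF bounded_linear_V(1)]
  lipschitz_on_balls_linear_compose[OF bounded_linear_V(2)]
  lipschitz_on_balls_linear_compose[OF bounded_linear_V(3)]
  lipschitz_on_balls_linear_compose[OF bounded_linear_V(4)]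
  lipschitz_on_balls_linear_compose[OF bounded_linear_dV_D]
  lipschitz_on_balls_linear_compose[OF bounded_linear_apply_bcontfun]

lemma lipschitz_f: "lipschitz_on_balls f_N" "lipschitz_on_balls f_D"
  unfolding f_N_def[abs_def] f_D_def[abs_def] by (intro lipschitz_intros)+

lemma lipschitz_F: "lipschitz_on_balls F"
  unfolding F_def[abs_def] by (intro lipschitz_intros lipschitz_f)

lemma lipschitz_const: "lipschitz_on_balls (\<lambda>_. c)"
  unfolding lipschitz_on_balls_def by auto

lemma lipschitz_lifted_F: "lipschitz_on_balls lifted_F"
proof -
  have e: "lipschitz_on_balls embed2" by (rule lipschitz_on_balls_linear[OF bounded_linear_embed2])
  have s: "lipschitz_on_balls (\<lambda>w. snd (embed2 w))"
    by (rule lipschitz_on_balls_linear_compose[OF bounded_linear_snd e])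
  note f = lipschitz_on_balls_compose[OF lipschitz_f(1) e] lipschitz_on_balls_compose[OF lipschitz_f(2) e]
  show ?thesis
    unfolding lifted_F_def[abs_def] Let_def by (intro lipschitz_intros lipschitz_const f s)
qed

text \<open>This intertwining makes \<open>embed2\<close> carry solutions of the lifted equation to
  solutions of the original one. It collects the three gains of a derivative: \<open>V_N_eq\<close>,
  \<open>rest_D_eq\<close> and \<open>J_square\<close>.\<close>

lemma embed2_lifted_F: "embed2 (lifted_F w) = F (embed2 w)"
proof -
  define z where "z = embed2 w"
  have z: "fst z = embed (fst w)" "snd z = embed (snd w)" by (simp_all add: z_def embed2_def)
  interpret e: bounded_linear embed by (rule bounded_linear_embed)
  interpret j: bounded_linear J by (rule bounded_linear_J)
  have e1: "embed (0, 0, k, y) = const_bcontfun k + J y" for k y by (simp add: embed_def)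
  have "embed (fst (lifted_F w)) = (a / b) *\<^sub>R snd z + V_N \<beta> (f_N z)"
    unfolding lifted_F_def Let_def z_def[symmetric]
    by (simp add: e.add e.scaleR e1 z(2) V_N_eq[OF beta_gamma_pos(1), symmetric])
  moreover have "embed (snd (lifted_F w)) = dV_D \<gamma> (f_D z)"
  proof -
    have "embed (snd (lifted_F w)) = \<gamma>\<^sup>2 *\<^sub>R fst z + \<gamma>\<^sup>2 *\<^sub>R J (bc_mult (J (snd z)) (snd z)) +
        (const_bcontfun (rest_D \<gamma> (f_D z) (-L)) + J (\<gamma>\<^sup>2 *\<^sub>R V_D \<gamma> (f_D z)))"
      unfolding lifted_F_def Let_def z_def[symmetric]
      by (simp add: e.add e.scaleR e1 z(1) j.add j.scaleR)
    also have "\<dots> = dV_D \<gamma> (f_D z)"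
      unfolding rest_D_eq[symmetric] dV_D_def
      by (simp add: f_D_def J_square scaleR_add_right)
    finally show ?thesis .
  qed
  ultimately show ?thesis by (simp add: embed2_def[of "lifted_F w"] F_def z_def[symmetric] add.commute)
qed

lemma clamped_F:
  assumes "clamped (fst z)" "clamped (snd z)" shows "clamped (fst (F z))" "clamped (snd (F z))"
  unfolding F_def dV_D_def f_D_def fst_conv snd_conv
  by (intro clamped_intros clamped_V clamped_J assms)+

text \<open>Translates the integrands, stated with representatives and chosen weak derivatives, into
  the vector field. The second component is integrated in \<open>x\<close>, since the system
  prescribes \<open>u\<close> while \<open>F\<close> describes \<open>u_x\<close>.\<close>

lemma integrand_eq:
  fixes z :: "(real \<Rightarrow>\<^sub>C real) \<times> (real \<Rightarrow>\<^sub>C real)"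
  assumes \<eta>: "\<eta> \<tau> \<in> borel_measurable M" "ae_eq L (\<eta> \<tau>) (fst z)"
    and u: "u \<tau> \<in> borel_measurable M" "ae_eq L (u \<tau>) (J (snd z))"
    and ux: "\<And>x. x \<in> {-L..L} \<Longrightarrow> cont_rep L (weak_deriv L (u \<tau>)) x = snd z x"
    and x: "x \<in> {-L..L}"
  shows "eta_integrand L a b \<eta> u \<tau> x = fst (F z) x"
    and "u_integrand L d \<eta> u \<tau> x = J (snd (F z)) x"
proof -
  note [measurable] = \<eta>(1) u(1)
  have "op_N L b (\<lambda>\<xi>. (a + b) / b * u \<tau> \<xi> + \<eta> \<tau> \<xi> * u \<tau> \<xi>) x = V_N \<beta> (f_N z) x"
    unfolding \<beta>_def
  proof (rule op_N_eq_V_N[OF b _ _ x])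
    show "ae_eq L (\<lambda>\<xi>. (a + b) / b * u \<tau> \<xi> + \<eta> \<tau> \<xi> * u \<tau> \<xi>) (f_N z)"
      using \<eta>(2) u(2) unfolding ae_eq_def by eventually_elim (simp add: f_N_def)
  qed measurable
  then show "eta_integrand L a b \<eta> u \<tau> x = fst (F z) x"
    by (simp add: eta_integrand_def F_def ux[OF x])
  have "op_D L d (\<lambda>\<xi>. \<eta> \<tau> \<xi> + 1 / 2 * (u \<tau> \<xi>)\<^sup>2) x = V_D \<gamma> (f_D z) x"
    unfolding \<gamma>_def
  proof (rule op_D_eq_V_D[OF d _ _ x])
    show "ae_eq L (\<lambda>\<xi>. \<eta> \<tau> \<xi> + 1 / 2 * (u \<tau> \<xi>)\<^sup>2) (f_D z)"
      using \<eta>(2) u(2) unfolding ae_eq_def by eventually_elim (simp add: f_D_def power2_eq_square)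
  qed measurable
  then show "u_integrand L d \<eta> u \<tau> x = J (snd (F z)) x"
    by (simp add: u_integrand_def F_def V_D_eq[OF beta_gamma_pos(2)])
qed

text \<open>The functional \<open>l\<close> will be evaluation of \<eta> or of
  \<open>u = J p\<close> at a point. The lemma identifies the pointwise time integrals of the system
  with one integral in the Banach space.\<close>

lemma integral_F:
  fixes l :: "(real \<Rightarrow>\<^sub>C real) \<times> (real \<Rightarrow>\<^sub>C real) \<Rightarrow> real"
    and z :: "real \<Rightarrow> (real \<Rightarrow>\<^sub>C real) \<times> (real \<Rightarrow>\<^sub>C real)"
  assumes l: "bounded_linear l" and z: "continuous_on {0..t} z"
    and eq: "\<And>\<tau>. \<tau> \<in> {0..t} \<Longrightarrow> \<phi> \<tau> = l (F (z \<tau>))"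
  shows "integrable (lebesgue_on {0..t}) \<phi>"
    "(LINT \<tau>|lebesgue_on {0..t}. \<phi> \<tau>) = l (integral {0..t} (\<lambda>\<tau>. F (z \<tau>)))"
proof -
  have cF: "continuous_on {0..t} (\<lambda>\<tau>. F (z \<tau>))"
    by (rule lipschitz_on_balls_continuous_comp[OF lipschitz_F z])
  have "continuous_on {0..t} (\<lambda>\<tau>. l (F (z \<tau>)))"
    by (rule bounded_linear.continuous_on[OF l cF])
  then have i: "integrable (lebesgue_on {0..t}) (\<lambda>\<tau>. l (F (z \<tau>)))"
    by (rule continuous_imp_integrable_real)
  then show "integrable (lebesgue_on {0..t}) \<phi>"
    using eq by (subst Bochner_Integration.integrable_cong[OF refl, where g = "\<lambda>\<tau>. l (F (z \<tau>))"]) auto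
  have "(LINT \<tau>|lebesgue_on {0..t}. \<phi> \<tau>) = (LINT \<tau>|lebesgue_on {0..t}. l (F (z \<tau>)))"
    using eq by (intro Bochner_Integration.integral_cong) auto
  also have "\<dots> = integral {0..t} (\<lambda>\<tau>. l (F (z \<tau>)))"
    by (rule lebesgue_integral_eq_integral[OF i]) simp
  also have "\<dots> = l (integral {0..t} (\<lambda>\<tau>. F (z \<tau>)))"
    using integral_linear[OF integrable_continuous_real[OF cF] l] by (simp add: comp_def)
  finally show "(LINT \<tau>|lebesgue_on {0..t}. \<phi> \<tau>) = l (integral {0..t} (\<lambda>\<tau>. F (z \<tau>)))" .
qed

section \<open>Uniqueness among all solutions of the prescribed class\<close>

lemma bounded_linear_functionals:
  "bounded_linear (\<lambda>z :: (real \<Rightarrow>\<^sub>C real) \<times> (real \<Rightarrow>\<^sub>C real). apply_bcontfun (fst z) x)"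
  "bounded_linear (\<lambda>z :: (real \<Rightarrow>\<^sub>C real) \<times> (real \<Rightarrow>\<^sub>C real). apply_bcontfun (J (snd z)) x)"
  by (intro bounded_linear_compose[OF bounded_linear_apply_bcontfun]
      bounded_linear_compose[OF bounded_linear_J] bounded_linear_fst bounded_linear_snd)+

lemma solution_unique:
  fixes z :: "real \<Rightarrow> (real \<Rightarrow>\<^sub>C real) \<times> (real \<Rightarrow>\<^sub>C real)"
  assumes sol: "\<eta> \<in> H1T L T" "u \<in> H2T L T" "solves_integral_system L a b d \<eta>0 u0 T \<eta> u"
    and z: "continuous_on {0..T} z"
      "\<And>t. t \<in> {0..T} \<Longrightarrow> z t = (h0, p0) + integral {0..t} (\<lambda>s. F (z s))"
    and t: "t \<in> {0..T}"
  shows "ae_eq L (\<eta> t) (fst (z t))" "ae_eq L (u t) (J (snd (z t)))"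
proof -
  define h where "h t = ext (cont_rep L (\<eta> t))" for t
  define p where "p t = ext (cont_rep L (weak_deriv L (u t)))" for t
  have \<eta>: "\<eta> t \<in> sobolev L 1" if "t \<in> {0..T}" for t
    using sol(1) that by (auto simp: H1T_def)
  have u: "u t \<in> sobolev L 2" "u t \<in> H10 L" if "t \<in> {0..T}" for t
    using sol(2) that by (auto simp: H2T_def)
  have ux: "has_weak_deriv L (u t) (weak_deriv L (u t))" "weak_deriv L (u t) \<in> sobolev L 1"
    if t: "t \<in> {0..T}" for t
  proof -
    obtain g k where g: "has_weak_deriv L (u t) g" "has_weak_deriv L g k"
      using u(1)[OF t] unfolding sobolev_2_iff by blast
    note w = has_weak_deriv_weak_deriv[OF g(1)]
    show "has_weak_deriv L (u t) (weak_deriv L (u t))" by (rule w)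
    have "has_weak_deriv L (weak_deriv L (u t)) k"
      by (rule has_weak_deriv_cong[OF g(2) has_weak_derivD(2)[OF w(1)] has_weak_derivD(2)[OF g(2)]
            ae_eq_sym[OF w(2)]]) (rule ae_eqI, simp)
    then show "weak_deriv L (u t) \<in> sobolev L 1" unfolding sobolev_1_iff by blast
  qed
  have cr: "continuous_on {-L..L} (cont_rep L v)" "ae_eq L (cont_rep L v) v" if "v \<in> sobolev L 1" for v
    using that weak_deriv_cont_rep(1,2) unfolding sobolev_1_iff by blast+
  have ext_ae: "ae_eq L v (ext (cont_rep L v))" if "v \<in> sobolev L 1" for v
    by (rule ae_eq_trans[OF ae_eq_sym[OF cr(2)[OF that]] ae_eqI]) (simp add: apply_ext cr(1)[OF that])
  have clh: "clamped (h t)" and clp: "clamped (p t)" if "t \<in> {0..T}" for t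
    unfolding h_def p_def by (intro clamped_ext cr \<eta> ux that)+
  \<comment> \<open>Membership in \<open>H10\<close> gives \<open>u = 0\<close> at
    \<open>-L\<close>, which removes the constant of integration.\<close>
  have cru: "cont_rep L (u t) x = J (p t) x" if t: "t \<in> {0..T}" and x: "x \<in> {-L..L}" for t x
  proof -
    have "cont_rep L (u t) x = cont_rep L (u t) (-L) + integral {-L..x} (weak_deriv L (u t))"
      by (rule weak_deriv_cont_rep(3)[OF ux(1)[OF t] x])
    also have "integral {-L..x} (weak_deriv L (u t)) = integral {-L..x} (p t)"
      unfolding p_def
      by (rule integral_cong_ae_eq[OF has_weak_derivD(4)[OF ux(1)[OF t]] _ ext_ae[OF ux(2)[OF t]] x])
        (simp add: continuous_imp_integrable_real)
    finally show ?thesis using u(2)[OF t] x by (simp add: H10_def apply_J)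
  qed
  have u_ae: "ae_eq L (u t) (J (p t))" if t: "t \<in> {0..T}" for t
    using weak_deriv_cont_rep(2)[OF ux(1)[OF t]] cru[OF t] ae_eq_trans[OF ae_eq_sym ae_eqI] by blast
  have conth: "continuous_on {0..T} h"
    unfolding h_def
    by (rule continuous_on_ext_cont_rep[OF \<eta>]) (use sol(1) in \<open>auto simp: H1T_def continuous_in_time_def\<close>)
  have contp: "continuous_on {0..T} p"
    unfolding p_def
  proof (rule continuous_on_ext_cont_rep[OF ux(2)])
    fix t assume t: "t \<in> {0..T}"
    have lim: "((\<lambda>r. sobolev_norm L 2 (\<lambda>x. u r x - u t x)) \<longlongrightarrow> 0) (at t within {0..T})"
      using sol(2) t by (auto simp: H2T_def continuous_in_time_def)
    show "((\<lambda>r. sobolev_norm L 1 (\<lambda>x. weak_deriv L (u r) x - weak_deriv L (u t) x)) \<longlongrightarrow> 0)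
        (at t within {0..T})"
    proof (rule Lim_null_comparison[OF _ lim])
      \<comment> \<open>The chosen derivative of the difference agrees only almost everywhere with
        the difference of the chosen derivatives, so both norms are computed from a common second
        derivative \<open>k\<close>.\<close>
      have "norm (sobolev_norm L 1 (\<lambda>x. weak_deriv L (u r) x - weak_deriv L (u t) x)) \<le>
          sobolev_norm L 2 (\<lambda>x. u r x - u t x)" if r: "r \<in> {0..T}" for r
      proof -
        let ?v = "\<lambda>x. weak_deriv L (u r) x - weak_deriv L (u t) x"
        note w = has_weak_deriv_weak_deriv[OF has_weak_deriv_diff[OF ux(1)[OF r] ux(1)[OF t]]]
        obtain k where k: "has_weak_deriv L ?v k"
          using ux(2)[OF r] ux(2)[OF t] has_weak_deriv_diff unfolding sobolev_1_iff by blast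
        have "(sobolev_norm L 1 ?v)\<^sup>2 = (sobolev_norm L 1 (weak_deriv L (\<lambda>x. u r x - u t x)))\<^sup>2"
          using sobolev_norm_1_eq[OF k has_weak_derivD(2)[OF w(1)] ae_eq_sym[OF w(2)]]
            sobolev_norm_1_eq[OF k has_weak_derivD(1)[OF k] ae_eqI] by simp
        also have "\<dots> \<le> (sobolev_norm L 2 (\<lambda>x. u r x - u t x))\<^sup>2"
          by (simp add: sobolev_norm_2)
        finally show ?thesis
          using power2_le_imp_le sobolev_norm_nonneg by fastforce
      qed
      then show "\<forall>\<^sub>F r in at t within {0..T}.
          norm (sobolev_norm L 1 (\<lambda>x. weak_deriv L (u r) x - weak_deriv L (u t) x)) \<le>
          sobolev_norm L 2 (\<lambda>x. u r x - u t x)"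
        unfolding eventually_at_filter by (intro always_eventually) simp
    qed
  qed
  define y where "y t = (h t, p t)" for t
  have conty: "continuous_on {0..T} y" unfolding y_def by (intro continuous_intros conth contp)
  have int_eq: "eta_integrand L a b \<eta> u \<tau> x = fst (F (y \<tau>)) x" "u_integrand L d \<eta> u \<tau> x = J (snd (F (y \<tau>))) x"
    if \<tau>: "\<tau> \<in> {0..T}" and x: "x \<in> {-L..L}" for \<tau> x
  proof -
    obtain g where g: "has_weak_deriv L (\<eta> \<tau>) g" using \<eta>[OF \<tau>] unfolding sobolev_1_iff by blast
    have pr: "cont_rep L (weak_deriv L (u \<tau>)) x = snd (y \<tau>) x" if "x \<in> {-L..L}" for x
      using that by (simp add: y_def p_def apply_ext cr(1)[OF ux(2)[OF \<tau>]])
    have "ae_eq L (\<eta> \<tau>) (fst (y \<tau>))" "ae_eq L (u \<tau>) (J (snd (y \<tau>)))"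
      using ext_ae[OF \<eta>[OF \<tau>]] u_ae[OF \<tau>] by (simp_all add: y_def h_def)
    note * = L2_measurable[OF has_weak_derivD(1)[OF g]] this(1)
      L2_measurable[OF has_weak_derivD(1)[OF ux(1)[OF \<tau>]]] this(2)
    show "eta_integrand L a b \<eta> u \<tau> x = fst (F (y \<tau>)) x" by (rule integrand_eq(1)[where \<eta> = \<eta> and \<tau> = \<tau> and u = u and z = "y \<tau>", OF * pr x])
    show "u_integrand L d \<eta> u \<tau> x = J (snd (F (y \<tau>))) x" by (rule integrand_eq(2)[where \<eta> = \<eta> and \<tau> = \<tau> and u = u and z = "y \<tau>", OF * pr x])
  qed
  have eq: "y t = (h0, p0) + integral {0..t} (\<lambda>s. F (y s))" if t: "t \<in> {0..T}" for t
  proof -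
    have ct: "continuous_on {0..t} y" by (rule continuous_on_subset[OF conty]) (use t in auto)
    have cF: "continuous_on {0..t} (\<lambda>s. F (y s))"
      by (rule lipschitz_on_balls_continuous_comp[OF lipschitz_F ct])
    have clip: "clamped (fst (F (y s)))" "clamped (snd (F (y s)))" if "s \<in> {0..t}" for s
      using that t by (intro clamped_F; simp add: y_def clh clp)+
    define I where "I = integral {0..t} (\<lambda>s. F (y s))"
    have fstI: "fst I = integral {0..t} (\<lambda>s. fst (F (y s)))"
      and sndI: "snd I = integral {0..t} (\<lambda>s. snd (F (y s)))"
      using integral_linear[OF integrable_continuous_real[OF cF] bounded_linear_fst]
        integral_linear[OF integrable_continuous_real[OF cF] bounded_linear_snd]
      by (simp_all add: I_def comp_def)
    have clI: "clamped (fst I)" "clamped (snd I)"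
      unfolding fstI sndI by (intro clamped_integral continuous_on_fst continuous_on_snd cF clip; assumption)+
    have sys: "cont_rep L (\<eta> t) x = cont_rep L \<eta>0 x + (LINT \<tau>|lebesgue_on {0..t}. eta_integrand L a b \<eta> u \<tau> x)"
      "cont_rep L (u t) x = cont_rep L u0 x + (LINT \<tau>|lebesgue_on {0..t}. u_integrand L d \<eta> u \<tau> x)"
      if "x \<in> {-L..L}" for x
      using sol(3) t that unfolding solves_integral_system_def by blast+
    have "h t = h0 + fst I"
    proof (rule clamped_eqI)
      show "clamped (h t)" by (rule clh[OF t])
      show "clamped (h0 + fst I)" by (intro clamped_intros h0 clI)
      fix x assume x: "x \<in> {-L..L}"
      have "(LINT \<tau>|lebesgue_on {0..t}. eta_integrand L a b \<eta> u \<tau> x) = fst I x"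
        unfolding I_def by (rule integral_F(2)[OF bounded_linear_functionals(1) ct]) (use int_eq t x in auto)
      then show "h t x = (h0 + fst I) x"
        using sys(1)[OF x] x h0(3)[OF x] by (simp add: h_def apply_ext cr(1)[OF \<eta>[OF t]])
    qed
    \<comment> \<open>The second equation determines only the primitive of \<open>p t\<close>;
      injectivity of \<open>J\<close> on clamped functions then gives the equation for
      \<open>p t\<close> itself.\<close>
    moreover have "J (p t) = J (p0 + snd I)"
    proof (rule clamped_eqI)
      fix x assume x: "x \<in> {-L..L}"
      have "(LINT \<tau>|lebesgue_on {0..t}. u_integrand L d \<eta> u \<tau> x) = J (snd I) x"
        unfolding I_def by (rule integral_F(2)[OF bounded_linear_functionals(2) ct]) (use int_eq t x in auto)
      then show "J (p t) x = J (p0 + snd I) x"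
        using sys(2)[OF x] x p0(3)[OF x] cru[OF t x]
        by (simp add: bounded_linear.axioms(1)[OF bounded_linear_J, THEN linear_add])
    qed auto
    then have "p t = p0 + snd I" by (rule J_eqD[OF clp[OF t] clamped_intros(2)[OF p0(1) clI(2)]])
    ultimately show ?thesis unfolding I_def[symmetric] by (simp add: y_def prod_eq_iff)
  qed
  have "y t = z t"
    by (rule picard_uniqueness[OF lipschitz_F conty z(1) eq z(2) t])
  then show "ae_eq L (\<eta> t) (fst (z t))" "ae_eq L (u t) (J (snd (z t)))"
    using ext_ae[OF \<eta>[OF t]] u_ae[OF t] by (simp_all add: y_def h_def flip: \<open>y t = z t\<close>)
qed

section \<open>Sobolev bounds for the lift and existence\<close>

definition "lift_norm = sqrt (2 * L * (onorm embed)\<^sup>2 + 3 * ((L2_norm L g1)\<^sup>2 + (L2_norm L g2)\<^sup>2 + 2 * L))"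

lemma has_weak_deriv_embed:
  "has_weak_deriv L (embed e)
     (\<lambda>x. fst e * g1 x + fst (snd e) * g2 x + snd (snd (snd e)) x)"
proof -
  have "has_weak_deriv L (\<lambda>x. fst e * h0 x + fst (snd e) * p0 x + fst (snd (snd e)) + J (snd (snd (snd e))) x)
      (\<lambda>x. fst e * g1 x + fst (snd e) * g2 x + 0 + snd (snd (snd e)) x)"
    by (intro has_weak_deriv_add has_weak_deriv_cmult h0 p0 has_weak_deriv_J has_weak_deriv_const)
  moreover have "apply_bcontfun (embed e) =
      (\<lambda>x. fst e * h0 x + fst (snd e) * p0 x + fst (snd (snd e)) + J (snd (snd (snd e))) x)"
    by (simp add: embed_def fun_eq_iff)
  ultimately show ?thesis by simp
qed

lemma norm_components:
  fixes e :: "real \<times> real \<times> real \<times> (real \<Rightarrow>\<^sub>C real)"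
  shows "\<bar>fst e\<bar> \<le> norm e" "\<bar>fst (snd e)\<bar> \<le> norm e" "norm (snd (snd (snd e))) \<le> norm e"
proof -
  have *: "norm (fst p) \<le> norm p" "norm (snd p) \<le> norm p"
    for p :: "'x::real_normed_vector \<times> 'y::real_normed_vector"
    using norm_fst_le[of "fst p" "snd p"] norm_snd_le[of "snd p" "fst p"] by simp_all
  show "\<bar>fst e\<bar> \<le> norm e" using *(1)[of e] by simp
  show "\<bar>fst (snd e)\<bar> \<le> norm e" using *(2)[of e] *(1)[of "snd e"] by simp
  show "norm (snd (snd (snd e))) \<le> norm e"
    using *(2)[of e] *(2)[of "snd e"] *(2)[of "snd (snd e)"] by linarith
qed

text \<open>The function itself is bounded by its supremum on an interval of length
  \<open>2 * L\<close>, and its weak derivative by \<open>(p + q + r)\<^sup>2 \<le> 3 * (p\<^sup>2 +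
  q\<^sup>2 + r\<^sup>2)\<close>. The constants of \<open>lift_norm\<close> are those of these two
  estimates.\<close>

lemma embed_sobolev_norm: "(sobolev_norm L 1 (embed e))\<^sup>2 \<le> lift_norm\<^sup>2 * (norm e)\<^sup>2"
proof -
  let ?c = "fst e" and ?c' = "fst (snd e)" and ?y = "snd (snd (snd e))"
  let ?g = "\<lambda>x. ?c * g1 x + ?c' * g2 x + ?y x"
  note wd = has_weak_deriv_embed[of e]
  have y: "apply_bcontfun ?y \<in> L2_space L" by (rule L2_continuous) simp
  have g12: "g1 \<in> L2_space L" "g2 \<in> L2_space L"
    by (rule has_weak_derivD(2)[OF h0(2)], rule has_weak_derivD(2)[OF p0(2)])
  have i: "integrable M (\<lambda>x. (g1 x)\<^sup>2)" "integrable M (\<lambda>x. (g2 x)\<^sup>2)" "integrable M (\<lambda>x. (?y x)\<^sup>2)"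
    using y g12 by (simp_all add: L2_space_def)
  have "(L2_norm L ?g)\<^sup>2 \<le> (LINT x|M. 3 * (?c\<^sup>2 * (g1 x)\<^sup>2 + ?c'\<^sup>2 * (g2 x)\<^sup>2 + (?y x)\<^sup>2))"
    unfolding L2_norm_power2
  proof (rule integral_mono)
    show "integrable M (\<lambda>x. (?g x)\<^sup>2)" using has_weak_derivD(2)[OF wd] by (simp add: L2_space_def)
    show "integrable M (\<lambda>x. 3 * (?c\<^sup>2 * (g1 x)\<^sup>2 + ?c'\<^sup>2 * (g2 x)\<^sup>2 + (?y x)\<^sup>2))" using i by simp
    have "(p + q + r)\<^sup>2 \<le> 3 * (p\<^sup>2 + q\<^sup>2 + r\<^sup>2)" for p q r :: real
      using zero_le_power2[of "p - q"] zero_le_power2[of "q - r"] zero_le_power2[of "p - r"]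
      by (simp add: power2_eq_square algebra_simps)
    then show "(?g x)\<^sup>2 \<le> 3 * (?c\<^sup>2 * (g1 x)\<^sup>2 + ?c'\<^sup>2 * (g2 x)\<^sup>2 + (?y x)\<^sup>2)" for x
      by (metis power_mult_distrib)
  qed
  also have "\<dots> = 3 * (?c\<^sup>2 * (L2_norm L g1)\<^sup>2 + ?c'\<^sup>2 * (L2_norm L g2)\<^sup>2 + (L2_norm L ?y)\<^sup>2)"
    using i by (simp add: L2_norm_power2)
  also have "\<dots> \<le> 3 * ((norm e)\<^sup>2 * (L2_norm L g1)\<^sup>2 + (norm e)\<^sup>2 * (L2_norm L g2)\<^sup>2 + 2 * L * (norm e)\<^sup>2)"
  proof (intro mult_left_mono add_mono mult_right_mono)
    show "?c\<^sup>2 \<le> (norm e)\<^sup>2" "?c'\<^sup>2 \<le> (norm e)\<^sup>2"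
      using norm_components(1,2)[of e] by (simp_all add: abs_le_square_iff[symmetric])
    have "(norm ?y)\<^sup>2 \<le> (norm e)\<^sup>2" using norm_components(3)[of e] by (simp add: power_mono)
    then show "(L2_norm L ?y)\<^sup>2 \<le> 2 * L * (norm e)\<^sup>2"
      using L2_norm_bcontfun[of ?y] L_pos by (smt (verit) mult_left_mono)
  qed auto
  finally have 1: "(L2_norm L ?g)\<^sup>2 \<le> 3 * ((L2_norm L g1)\<^sup>2 + (L2_norm L g2)\<^sup>2 + 2 * L) * (norm e)\<^sup>2"
    by (simp add: algebra_simps)
  have "(norm (embed e))\<^sup>2 \<le> (onorm embed * norm e)\<^sup>2"
    using onorm[OF bounded_linear_embed] by (simp add: power_mono)
  then have "2 * L * (norm (embed e))\<^sup>2 \<le> 2 * L * (onorm embed * norm e)\<^sup>2"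
    using L_pos by simp
  then have 2: "(L2_norm L (embed e))\<^sup>2 \<le> 2 * L * (onorm embed)\<^sup>2 * (norm e)\<^sup>2"
    using L2_norm_bcontfun[of "embed e"] by (simp add: power_mult_distrib mult.assoc)
  have "(sobolev_norm L 1 (embed e))\<^sup>2 = (L2_norm L (embed e))\<^sup>2 + (L2_norm L ?g)\<^sup>2"
    by (rule sobolev_norm_1_eq[OF wd has_weak_derivD(1)[OF wd]]) (rule ae_eqI, simp)
  moreover have "lift_norm\<^sup>2 = 2 * L * (onorm embed)\<^sup>2 + 3 * ((L2_norm L g1)\<^sup>2 + (L2_norm L g2)\<^sup>2 + 2 * L)"
    unfolding lift_norm_def using L_pos by (intro real_sqrt_pow2) simp
  ultimately show ?thesis using 1 2 by (simp add: algebra_simps)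
qed

lemma J_embed_sobolev_norm:
  "(sobolev_norm L 2 (J (embed e)))\<^sup>2 \<le> (2 * L * (onorm (\<lambda>e. J (embed e)))\<^sup>2 + lift_norm\<^sup>2) * (norm e)\<^sup>2"
proof -
  note w = has_weak_deriv_weak_deriv[OF has_weak_deriv_J[of "embed e"]]
  have bl: "bounded_linear (\<lambda>e. J (embed e))"
    by (rule bounded_linear_compose[OF bounded_linear_J bounded_linear_embed])
  have "(norm (J (embed e)))\<^sup>2 \<le> (onorm (\<lambda>e. J (embed e)) * norm e)\<^sup>2"
    using onorm[OF bl] by (simp add: power_mono)
  then have "2 * L * (norm (J (embed e)))\<^sup>2 \<le> 2 * L * (onorm (\<lambda>e. J (embed e)) * norm e)\<^sup>2"
    using L_pos by simp
  then have "(L2_norm L (J (embed e)))\<^sup>2 \<le> 2 * L * (onorm (\<lambda>e. J (embed e)))\<^sup>2 * (norm e)\<^sup>2"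
    using L2_norm_bcontfun[of "J (embed e)"] by (simp add: power_mult_distrib mult.assoc)
  moreover have "(sobolev_norm L 1 (weak_deriv L (J (embed e))))\<^sup>2 = (sobolev_norm L 1 (embed e))\<^sup>2"
    using sobolev_norm_1_eq[OF has_weak_deriv_embed has_weak_derivD(2)[OF w(1)] ae_eq_sym[OF w(2)]]
      sobolev_norm_1_eq[OF has_weak_deriv_embed has_weak_derivD(1)[OF has_weak_deriv_embed] ae_eqI] by simp
  ultimately show ?thesis
    using embed_sobolev_norm[of e] unfolding sobolev_norm_2 by (simp add: distrib_right)
qed

theorem solution_exists:
  obtains T and z :: "real \<Rightarrow> (real \<Rightarrow>\<^sub>C real) \<times> (real \<Rightarrow>\<^sub>C real)"
  where "0 < T" "continuous_on {0..T} z"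
    "\<And>t. t \<in> {0..T} \<Longrightarrow> z t = (h0, p0) + integral {0..t} (\<lambda>s. F (z s))"
    "(\<lambda>t. apply_bcontfun (fst (z t))) \<in> H1T L T" "(\<lambda>t. apply_bcontfun (J (snd (z t)))) \<in> H2T L T"
    "solves_integral_system L a b d \<eta>0 u0 T (\<lambda>t. fst (z t)) (\<lambda>t. J (snd (z t)))"
proof -
  \<comment> \<open>Coordinates of the data: coefficient 1 on \<open>h0\<close> for \<eta>,
    coefficient 1 on \<open>p0\<close> for \<open>u_x\<close>, and no remainder.\<close>
  let ?w0 = "((1, 0, 0, 0), (0, 1, 0, 0)) :: (real \<times> real \<times> real \<times> (real \<Rightarrow>\<^sub>C real)) \<times> (real \<times> real \<times> real \<times> (real \<Rightarrow>\<^sub>C real))"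
  obtain T and w :: "real \<Rightarrow> (real \<times> real \<times> real \<times> (real \<Rightarrow>\<^sub>C real)) \<times> (real \<times> real \<times> real \<times> (real \<Rightarrow>\<^sub>C real))"
    where T: "0 < T" and contw: "continuous_on {0..T} w"
    and w: "\<And>t. t \<in> {0..T} \<Longrightarrow> w t = ?w0 + integral {0..t} (\<lambda>s. lifted_F (w s))"
    using picard_existence[OF lipschitz_lifted_F, of ?w0] by blast
  define z where "z t = embed2 (w t)" for t
  interpret E: bounded_linear embed2 by (rule bounded_linear_embed2)
  interpret e: bounded_linear embed by (rule bounded_linear_embed)
  interpret j: bounded_linear J by (rule bounded_linear_J)
  have contz: "continuous_on {0..T} z" unfolding z_def by (rule E.continuous_on[OF contw])
  have z: "z t = (h0, p0) + integral {0..t} (\<lambda>s. F (z s))" if t: "t \<in> {0..T}" for t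
  proof -
    have "continuous_on {0..t} (\<lambda>s. lifted_F (w s))"
      by (rule lipschitz_on_balls_continuous_comp[OF lipschitz_lifted_F continuous_on_subset[OF contw]])
        (use t in auto)
    then have "integral {0..t} (\<lambda>s. embed2 (lifted_F (w s))) = embed2 (integral {0..t} (\<lambda>s. lifted_F (w s)))"
      using integral_linear[OF integrable_continuous_real bounded_linear_embed2] by (simp add: comp_def)
    moreover have "embed2 ?w0 = (h0, p0)"
      by (simp add: embed2_def embed_def j.zero)
    ultimately show ?thesis
      using w[OF t] by (simp add: z_def E.add embed2_lifted_F)
  qed
  have contz': "continuous_on {0..t} z" if "t \<in> {0..T}" for t
    by (rule continuous_on_subset[OF contz]) (use that in auto)
  have zf: "fst (z t) = embed (fst (w t))" "snd (z t) = embed (snd (w t))" for t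
    by (simp_all add: z_def embed2_def)
  have ev: "l (z t) = l (h0, p0) + (LINT \<tau>|lebesgue_on {0..t}. l (F (z \<tau>)))"
    if l: "bounded_linear l" and t: "t \<in> {0..T}"
    for l :: "(real \<Rightarrow>\<^sub>C real) \<times> (real \<Rightarrow>\<^sub>C real) \<Rightarrow> real" and t
  proof -
    have "l (z t) = l (h0, p0) + l (integral {0..t} (\<lambda>s. F (z s)))"
      unfolding z[OF t] by (rule linear_add[OF bounded_linear.linear[OF l]])
    then show ?thesis using integral_F(2)[OF l contz'[OF t], of "\<lambda>\<tau>. l (F (z \<tau>))"] by simp
  qed
  \<comment> \<open>The condition at the right end is propagated in time: the primitive of
    \<open>snd (F z)\<close> is \<open>V_D\<close>, which vanishes at \<open>L\<close>, and it holds
    initially.\<close>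
  have JR: "J (snd (z t)) L = 0" if t: "t \<in> {0..T}" for t
  proof -
    have "J (snd (F (z \<tau>))) L = 0" for \<tau>
      by (simp add: F_def V_D_eq[OF beta_gamma_pos(2), symmetric] V_D_ends)
    then show ?thesis
      using ev[OF bounded_linear_functionals(2) t, of L] p0(4) by simp
  qed
  have wd_h: "\<exists>g. has_weak_deriv L (fst (z t)) g" and wd_p: "\<exists>g. has_weak_deriv L (snd (z t)) g" for t
    unfolding zf using has_weak_deriv_embed by blast+
  have crz: "cont_rep L (apply_bcontfun f) x = f x" if "x \<in> {-L..L}" for f x
    using that by (intro cont_rep_eq(3)[of "apply_bcontfun f"]) (auto intro: ae_eqI)
  have H1: "(\<lambda>t. apply_bcontfun (fst (z t))) \<in> H1T L T"
    unfolding H1T_def mem_Collect_eq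
  proof (intro conjI ballI)
    show "apply_bcontfun (fst (z t)) \<in> sobolev L 1" for t
      unfolding sobolev_1_iff by (rule wd_h)
    show "continuous_in_time L T 1 (\<lambda>t. apply_bcontfun (fst (z t)))"
    proof (rule continuous_in_timeI[where e = "\<lambda>t. fst (w t)" and K = "\<bar>lift_norm\<bar>"])
      show "continuous_on {0..T} (\<lambda>t. fst (w t))" by (rule continuous_on_fst[OF contw])
      fix r t
      have "(\<lambda>x. fst (z r) x - fst (z t) x) = embed (fst (w r) - fst (w t))"
        by (simp add: zf e.diff fun_eq_iff)
      then show "sobolev_norm L 1 (\<lambda>x. fst (z r) x - fst (z t) x) \<le> \<bar>lift_norm\<bar> * norm (fst (w r) - fst (w t))"
        using embed_sobolev_norm[of "fst (w r) - fst (w t)"]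
        by - (rule power2_le_imp_le, auto simp: power_mult_distrib)
    qed
  qed
  define K where "K = sqrt (2 * L * (onorm (\<lambda>e. J (embed e)))\<^sup>2 + lift_norm\<^sup>2)"
  have K2: "K\<^sup>2 = 2 * L * (onorm (\<lambda>e. J (embed e)))\<^sup>2 + lift_norm\<^sup>2"
    unfolding K_def using L_pos by (intro real_sqrt_pow2) simp
  have H2: "(\<lambda>t. apply_bcontfun (J (snd (z t)))) \<in> H2T L T"
    unfolding H2T_def mem_Collect_eq
  proof (intro conjI ballI IntI)
    fix t assume t: "t \<in> {0..T}"
    show "apply_bcontfun (J (snd (z t))) \<in> sobolev L 2"
      unfolding sobolev_2_iff using has_weak_deriv_J wd_p by blast
    have "apply_bcontfun (J (snd (z t))) \<in> sobolev L 1"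
      unfolding sobolev_1_iff using has_weak_deriv_J by blast
    then show "apply_bcontfun (J (snd (z t))) \<in> H10 L"
      unfolding H10_def using L_pos JR[OF t] crz by simp
  next
    show "continuous_in_time L T 2 (\<lambda>t. apply_bcontfun (J (snd (z t))))"
    proof (rule continuous_in_timeI[where e = "\<lambda>t. snd (w t)" and K = K])
      show "continuous_on {0..T} (\<lambda>t. snd (w t))" by (rule continuous_on_snd[OF contw])
      fix r t
      have "(\<lambda>x. J (snd (z r)) x - J (snd (z t)) x) = J (embed (snd (w r) - snd (w t)))"
        by (simp add: zf e.diff j.diff fun_eq_iff)
      then show "sobolev_norm L 2 (\<lambda>x. J (snd (z r)) x - J (snd (z t)) x) \<le> K * norm (snd (w r) - snd (w t))"
        using J_embed_sobolev_norm[of "snd (w r) - snd (w t)"] L_pos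
        by - (rule power2_le_imp_le, auto simp: power_mult_distrib K2 K_def)
    qed
  qed
  have int_eq: "eta_integrand L a b (\<lambda>t. fst (z t)) (\<lambda>t. J (snd (z t))) \<tau> x = fst (F (z \<tau>)) x"
    "u_integrand L d (\<lambda>t. fst (z t)) (\<lambda>t. J (snd (z t))) \<tau> x = J (snd (F (z \<tau>))) x"
    if x: "x \<in> {-L..L}" for \<tau> x
  proof -
    have pr: "cont_rep L (weak_deriv L (J (snd (z \<tau>)))) x = snd (z \<tau>) x" if "x \<in> {-L..L}" for x
      using that ae_eq_sym[OF has_weak_deriv_weak_deriv(2)[OF has_weak_deriv_J[of "snd (z \<tau>)"]]]
      by (intro cont_rep_eq(3)) auto
    have m: "apply_bcontfun f \<in> borel_measurable M" for f by (rule continuous_measurable_M) simp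
    have ae: "ae_eq L (apply_bcontfun f) f" for f by (rule ae_eqI) simp
    show "eta_integrand L a b (\<lambda>t. fst (z t)) (\<lambda>t. J (snd (z t))) \<tau> x = fst (F (z \<tau>)) x"
      by (rule integrand_eq(1)[where z = "z \<tau>" and \<eta> = "\<lambda>t. fst (z t)" and u = "\<lambda>t. J (snd (z t))" and \<tau> = \<tau>, OF m ae m ae pr x])
    show "u_integrand L d (\<lambda>t. fst (z t)) (\<lambda>t. J (snd (z t))) \<tau> x = J (snd (F (z \<tau>))) x"
      by (rule integrand_eq(2)[where z = "z \<tau>" and \<eta> = "\<lambda>t. fst (z t)" and u = "\<lambda>t. J (snd (z t))" and \<tau> = \<tau>, OF m ae m ae pr x])
  qed
  have "solves_integral_system L a b d \<eta>0 u0 T (\<lambda>t. fst (z t)) (\<lambda>t. J (snd (z t)))"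
    unfolding solves_integral_system_def
  proof (intro ballI conjI)
    fix t x assume t: "t \<in> {0..T}" and x: "x \<in> {-L..L}"
    note i1 = integral_F[OF bounded_linear_functionals(1) contz'[OF t] int_eq(1)[OF x]]
    note i2 = integral_F[OF bounded_linear_functionals(2) contz'[OF t] int_eq(2)[OF x]]
    show "integrable (lebesgue_on {0..t}) (\<lambda>\<tau>. eta_integrand L a b (\<lambda>t. fst (z t)) (\<lambda>t. J (snd (z t))) \<tau> x)"
      by (rule i1)
    show "integrable (lebesgue_on {0..t}) (\<lambda>\<tau>. u_integrand L d (\<lambda>t. fst (z t)) (\<lambda>t. J (snd (z t))) \<tau> x)"
      by (rule i2)
    show "cont_rep L (fst (z t)) x = cont_rep L \<eta>0 x +
        (LINT \<tau>|lebesgue_on {0..t}. eta_integrand L a b (\<lambda>t. fst (z t)) (\<lambda>t. J (snd (z t))) \<tau> x)"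
      using ev[OF bounded_linear_functionals(1) t, of x] x by (simp add: int_eq crz h0(3))
    show "cont_rep L (J (snd (z t))) x = cont_rep L u0 x +
        (LINT \<tau>|lebesgue_on {0..t}. u_integrand L d (\<lambda>t. fst (z t)) (\<lambda>t. J (snd (z t))) \<tau> x)"
      using ev[OF bounded_linear_functionals(2) t, of x] x by (simp add: int_eq crz p0(3))
  qed
  then show thesis using that[OF T contz z H1 H2] by blast
qed

end

theorem proposition3p2:
  fixes L a b d :: real and \<eta>0 u0 :: "real \<Rightarrow> real"
  assumes "L > 0" and "a < 0" and "b > 0" and "d > 0" and "a + b + d = 1 / 3"
    and "\<eta>0 \<in> sobolev L 1" and "u0 \<in> sobolev L 2 \<inter> H10 L"
  shows "\<exists>T>0. \<exists>\<eta> u.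
           \<eta> \<in> H1T L T \<and> u \<in> H2T L T \<and> solves_integral_system L a b d \<eta>0 u0 T \<eta> u \<and>
           (\<forall>\<eta>' u'. \<eta>' \<in> H1T L T \<and> u' \<in> H2T L T \<and>
                solves_integral_system L a b d \<eta>0 u0 T \<eta>' u' \<longrightarrow>
                (\<forall>t\<in>{0..T}. ae_eq L (\<eta>' t) (\<eta> t) \<and> ae_eq L (u' t) (u t)))"
proof -
  interpret interval L by standard fact
  obtain g where g: "has_weak_deriv L \<eta>0 g"
    using assms(6) unfolding sobolev_1_iff by blast
  obtain v k where v: "has_weak_deriv L u0 v" "has_weak_deriv L v k"
    using assms(7) unfolding Int_iff sobolev_2_iff by blast
  \<comment> \<open>The weak derivatives \<open>g\<close>, \<open>v\<close>, \<open>k\<close> are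
    arbitrary representatives; \<open>h0\<close> and \<open>p0\<close> replace \<eta>0 and
    \<open>v\<close> by their continuous ones, extended by constants.\<close>
  define h0 where "h0 = ext (cont_rep L \<eta>0)"
  define p0 where "p0 = ext (cont_rep L v)"
  note c\<eta> = weak_deriv_cont_rep[OF g] and cu = weak_deriv_cont_rep[OF v(1)] and cv = weak_deriv_cont_rep[OF v(2)]
  have L2: "apply_bcontfun f \<in> L2_space L" for f by (rule L2_continuous) simp
  have h0_ae: "ae_eq L \<eta>0 h0"
    by (rule ae_eq_trans[OF ae_eq_sym[OF c\<eta>(2)] ae_eqI]) (simp add: h0_def apply_ext c\<eta>(1))
  have p0_ae: "ae_eq L v p0"
    by (rule ae_eq_trans[OF ae_eq_sym[OF cv(2)] ae_eqI]) (simp add: p0_def apply_ext cv(1))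
  have Jp0: "cont_rep L u0 x = J p0 x" if x: "x \<in> {-L..L}" for x
  proof -
    have "integral {-L..x} v = integral {-L..x} p0"
      by (rule integral_cong_ae_eq[OF has_weak_derivD(4)[OF v(1)] L2_integrable[OF L2] p0_ae x])
    then show ?thesis using cu(3)[OF x] assms(7) x by (simp add: H10_def apply_J)
  qed
  interpret wave_system L a b d \<eta>0 u0 g k h0 p0
  proof
    show "clamped h0" "clamped p0"
      unfolding h0_def p0_def by (rule clamped_ext, fact)+
    show "has_weak_deriv L h0 g"
      by (rule has_weak_deriv_cong[OF g L2 has_weak_derivD(2)[OF g] h0_ae]) (rule ae_eqI, simp)
    show "has_weak_deriv L p0 k"
      by (rule has_weak_deriv_cong[OF v(2) L2 has_weak_derivD(2)[OF v(2)] p0_ae]) (rule ae_eqI, simp)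
    show "cont_rep L \<eta>0 x = h0 x" if "x \<in> {-L..L}" for x
      using that by (simp add: h0_def apply_ext c\<eta>(1))
    show "cont_rep L u0 x = J p0 x" if "x \<in> {-L..L}" for x
      by (rule Jp0[OF that])
    show "J p0 L = 0"
      using Jp0[of L] assms(1,7) by (simp add: H10_def)
  qed fact+
  obtain T z where z: "0 < T" "continuous_on {0..T} z"
    "\<And>t. t \<in> {0..T} \<Longrightarrow> z t = (h0, p0) + integral {0..t} (\<lambda>s. F (z s))"
    and sol: "(\<lambda>t. apply_bcontfun (fst (z t))) \<in> H1T L T"
      "(\<lambda>t. apply_bcontfun (J (snd (z t)))) \<in> H2T L T"
      "solves_integral_system L a b d \<eta>0 u0 T (\<lambda>t. fst (z t)) (\<lambda>t. J (snd (z t)))"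
    using solution_exists by blast
  \<comment> \<open>Competitors are compared on the whole existence interval, so uniqueness requires
    no further shrinking of \<open>T\<close>.\<close>
  have unique: "ae_eq L (\<eta>' t) (fst (z t)) \<and> ae_eq L (u' t) (J (snd (z t)))"
    if "\<eta>' \<in> H1T L T" "u' \<in> H2T L T" "solves_integral_system L a b d \<eta>0 u0 T \<eta>' u'"
      "t \<in> {0..T}" for \<eta>' u' t
    using solution_unique[OF that(1-3) z(2,3) that(4)] by blast
  show ?thesis
    by (rule exI[of _ T], rule conjI[OF z(1)], rule exI[of _ "\<lambda>t. apply_bcontfun (fst (z t))"],
        rule exI[of _ "\<lambda>t. apply_bcontfun (J (snd (z t)))"]) (use sol unique in blast)
qed

end
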